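(* Let $\Gamma^{\wedge}{>\!\!\!\triangleleft}\,\Gamma^{\wedge *}$ be the graded Heisenberg double of the exterior Hopf algebra $\Gamma^\wedge$ over a Hopf algebra $\mathcal A$ and of its dual exterior Hopf algebra $\Gamma^{\wedge *}$ over $\mathcal A^*$, as described in the context, with vector fields $\chi_i\in\mathcal A^*$, braid matrix $\sigma^{ij}_{kl}$, structure constants $C^k_{ij}$, generators $\gamma_i\in\Gamma^{(1)*}$ and $\Omega^i=\omega^jS^{-1}(f^i_j)$, so that the $\chi_i$ satisfy the quantum Lie algebra relations $\chi_i\chi_j-\sigma^{mk}_{ij}\chi_m\chi_k=C^k_{ij}\chi_k$. Let $h$ be the height of $\sigma$, i.e. the antisymmetrizers satisfy $A_{1\to n}=0$ for all $n>h$. Then the BRST operator $Q$ for this quantum Lie algebra has the form $$Q=\Omega^i\chi_i+\sum_{r=1}^{h-1}Q_{(r)},\qquad Q_{(r)}=\Omega^{i_{r+1}}\wedge\Omega^{i_r}\wedge\dots\wedge\Omega^{i_1}\;X^{j_1\dots j_r}_{i_1\dots i_{r+1}}\;\gamma_{j_1}\wedge\dots\wedge\gamma_{j_r},$$ where the $X^{\langle 1\dots r|}_{|1\dots r+1\rangle}=\big(X^{j_1\dots j_r}_{i_1\dots i_{r+1}}\big)$ are numerical tensors satisfying the recurrent relations (for $2\le r\le h-1$) $$A_{1\to r+1}\,X^{\langle 1\dots r|}_{|1\dots r+1\rangle}\,A_{1\to r}=A_{1\to r+1}\left((-1)^r\sigma_{r+1\leftarrow 1}-\mathbf 1\right)X^{\langle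 2\dots r|}_{|2\dots r+1\rangle}\,A_{2\to r}$$ with the initial condition (for $r=1$) $$A_{12}\,X^{\langle 0|}_{|12\rangle}=-\,C^{\langle 0|}_{|12\rangle},\qquad\text{i.e. } (\mathbf 1-\sigma)^{mn}_{ij}X^k_{mn}=-C^k_{ij}.$$ That is, $Q$ is a bi-invariant element of degree $1$ of $\Gamma^{\wedge}{>\!\!\!\triangleleft}\,\Gamma^{\wedge *}$ such that $Q\wedge Q=0$ and $d\omega=[Q,\omega]_\pm$ for all $\omega\in\Gamma^\wedge$, where $[Q,\omega]_\pm=Q\omega-(-1)^{\deg\omega}\omega Q$ on homogeneous $\omega$.
   Context: Setting. $\mathcal A$ is a Hopf algebra $(\Delta,\epsilon,S)$ with Hopf dual $\mathcal A^*$ and non-degenerate pairing $\langle h,a\rangle=h(a)$; antipodes are invertible. Sweedler notation is used; for $f\in\mathcal A^*$, $a\in\mathcal A$: $f\triangleright a=a_{(1)}\langle f,a_{(2)}\rangle$, $a\triangleleft f=\langle f,a_{(1)}\rangle a_{(2)}$; similarly $a\triangleright h=h_{(1)}\langle h_{(2)},a\rangle$ for $h\in\mathcal A^*$. Summation over repeated indices $1,\dots,N$ is understood. Bicovariant calculus. $\Gamma^{(1)}$ is a bicovariant $\mathcal A$-bimodule with basis of left-invariant elements $\omega^1,\dots,\omega^N$, $\Delta_L(\omega^i)=1\otimes\omega^i$, $\Delta_R(\omega^i)=\omega^j\otimes r^i_j$ with $r^i_j\in\mathcal A$, and $\omega^i a=(f^i_j\triangleright a)\,\omega^j$ with $f^i_j\in\mathcal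 A^*$. These satisfy $(f^j_i\triangleright a)r^i_k=r^j_i(a\triangleleft f^i_k)$ for all $a\in\mathcal A$, $\Delta(f^i_j)=f^i_k\otimes f^k_j$, $\Delta(r^i_j)=r^k_j\otimes r^i_k$. The braid matrix is $\sigma^{ij}_{kl}=\langle f^i_l,r^j_k\rangle$; it satisfies the Yang–Baxter equation $\sigma_{12}\sigma_{23}\sigma_{12}=\sigma_{23}\sigma_{12}\sigma_{23}$. Index notation. A tensor with lower indices $i_1,i_2,\dots$ and upper indices $j_1,\dots$ is regarded as a matrix whose incoming (row) indices are the lower ones and outgoing (column) indices are the upper ones; in a product of matrices, read from left to right, the upper indices of a factor are contracted with the lower indices of the next factor. Numbers $1,2,\dots$ label copies of the index space; $\langle n|$ denotes an outgoing (upper) index and $|n\rangle$ an incoming (lower) index in copy $n$; spaces not mentioned are acted on by the identity. $X^{\langle 2\dots r|}_{|2\dots r+1\rangle}$ denotes the tensor $X$ with $r-1$ upper and $r$ lower indices placed in spaces $2,\dots,r+1$. $C^{\langle 0|}_{|12\rangle}$ denotes $C^{k}_{ij}$ with lower indices $i,j$ in spaces $1,2$ and upper index $k$ in space $0$. Put $\sigma_{n\leftarrow k}=\sigma_{n-1\,n}\cdots\sigma_{k+1\,k+2}\,\sigma_{k\,k+1}$ and $\sigma_{k\to n}=\sigma_{k\,k+1}\sigma_{k+1\,k+2}\cdots\sigma_{n-1\,n}$ for $n>k$. The antisymmetrizers are defined by $A_{1\to1}=\mathbf 1$, $$A_{1\to n}=\Big(1-\sum_{k=1}^{n-1}(-1)^{n-k-1}\sigma_{k\to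 n}\Big)A_{1\to n-1}=\Big(1-\sum_{k=2}^{n}(-1)^k\sigma_{k\leftarrow1}\Big)A_{2\to n},$$ where $A_{k\to n}$ is the analogous operator in spaces $k,\dots,n$; $A_{12}=A_{1\to 2}=\mathbf 1-\sigma_{12}$. If $A_{1\to n}=0$ for all $n>h$ (and $h$ is the number at which the vanishing starts at step $n=h+1$), then $h$ is called the height of $\sigma$. Exterior Hopf algebra. $\Gamma^\wedge=\mathcal A\oplus\Gamma^{(1)}\oplus\Gamma^{(2)}\oplus\cdots$, where $\omega^{\langle1|}\wedge\dots\wedge\omega^{\langle n|}=\omega^{\langle1|}\otimes\dots\otimes\omega^{\langle n|}A_{1\to n}$; $\deg=n$ on $\Gamma^{(n)}$; it is a graded Hopf algebra with $\Delta(\omega^i)=1\otimes\omega^i+\omega^j\otimes r^i_j$ extending $\Delta$ of $\mathcal A$ (graded tensor products). There is a differential $d:\Gamma^{(n)}\to\Gamma^{(n+1)}$ with $d^2=0$, $d(\omega_1\omega_2)=d(\omega_1)\omega_2+(-1)^{\deg\omega_1}\omega_1 d(\omega_2)$ and $\Delta d=(d\otimes id+id\otimes d)\Delta$. The vector fields $\chi_i\in\mathcal A^*$ are defined by $d(a)=(\chi_i\triangleright a)\omega^i$ for $a\in\mathcal A$; then $\Delta(\chi_i)=\chi_j\otimes f^j_i+1\otimes\chi_i$, and with $C^k_{ij}=\langle\chi_j,r^k_i\rangle$ they satisfy $\chi_i\chi_j=\sigma^{mk}_{ij}\chi_m\chi_k+C^k_{ij}\chi_k$. Dual exterior Hopf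 algebra. $\Gamma^{\wedge*}=\mathcal A^*\oplus\Gamma^{(1)*}\oplus\Gamma^{(2)*}\oplus\cdots$ is generated by $\mathcal A^*$ and left-invariant basis elements $\gamma_i$ of $\Gamma^{(1)*}$, with $\gamma_i h=(r^j_i\triangleright h)\gamma_j$ for $h\in\mathcal A^*$, $\Delta(\gamma_i)=1\otimes\gamma_i+\gamma_j\otimes f^j_i$, and $\gamma_{|1\rangle}\wedge\dots\wedge\gamma_{|n\rangle}=A_{1\to n}\gamma_{|1\rangle}\otimes\dots\otimes\gamma_{|n\rangle}$; $\deg=-n$ on $\Gamma^{(n)*}$. $\Gamma^{\wedge*}$ and $\Gamma^\wedge$ are dual with a pairing compatible with the grading, extending that of $\mathcal A^*,\mathcal A$, with $\langle h\gamma_i,a\omega^j\rangle=\langle h,a\rangle\delta^j_i$. Heisenberg double. $\Gamma^{\wedge}{>\!\!\!\triangleleft}\,\Gamma^{\wedge *}$ is the associative algebra that is the product of $\Gamma^\wedge$ and $\Gamma^{\wedge*}$ with cross-multiplication $\gamma\,\omega=(-1)^{\deg(\gamma_{(1)})\deg(\omega_{(2)})}\,\omega_{(1)}\langle\gamma_{(1)},\omega_{(2)}\rangle\gamma_{(2)}$ for $\gamma\in\Gamma^{\wedge*}$, $\omega\in\Gamma^\wedge$. In particular $[\chi_i,\omega^j]_-=C^j_{lk}\omega^lf^k_i$, $[\gamma_i,\omega^j]_+=f^j_i$, $[\gamma_i,a]=0$ for $a\in\mathcal A$. The elements $\Omega^i=\omega^jS^{-1}(f^i_j)$ commute with all $a\in\mathcal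 A$, and $\Omega^{\langle r|}\wedge\dots\wedge\Omega^{\langle1|}=\Omega^{\langle r|}\otimes\dots\otimes\Omega^{\langle1|}A_{1\to r}$. Bi-invariance. With dual bases $\{e^\alpha\}$ of $\mathcal A^*$ and $\{e_\alpha\}$ of $\mathcal A$ and $\mathcal C=e^\alpha\otimes e_\alpha$, the right $\mathcal A$-coaction and left $\mathcal A^*$-coaction on the Heisenberg double are $\Delta_R(z)=\mathcal C(z\otimes1)\mathcal C^{-1}$, $\Delta_L(z)=\mathcal C^{-1}(1\otimes z)\mathcal C$; $z$ is bi-invariant if $\Delta_R(z)=z\otimes1$ and $\Delta_L(z)=1\otimes z$. BRST operator. A BRST operator is a bi-invariant element $Q$ of the Heisenberg double, of degree $1$, with $Q\wedge Q=0$ and $d\omega=[Q,\omega]_\pm$ for all $\omega\in\Gamma^\wedge$.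
   Formalization: Left invariance is taken for the left A-coaction (Δ on A, ω^i ↦ 1⊗ω^i, trivial on Γ^∧* ), as the printed Δ_L-invariance forces [Q,a]=0, contradicting da=[Q,a]; the cross-multiplication gets the extra sign (-1)^{deg γ deg ω}, needed for the stated [γ_i,ω^j]_+=f^j_i. *)

theory Defs
  imports Complex_Main
begin

section \<open>Formal tensors and graded Hopf algebras\<close>

text \<open>An element of a tensor product \<open>V \<otimes> W\<close> is written as a list of pairs, the list
  \<open>[(x\<^sub>1, y\<^sub>1), \<dots>, (x\<^sub>m, y\<^sub>m)]\<close> standing for \<open>x\<^sub>1 \<otimes> y\<^sub>1 + \<dots> + x\<^sub>m \<otimes> y\<^sub>m\<close>. Over a field two such sums
  are the same element of \<open>V \<otimes> W\<close> iff no bilinear form separates them. Sweedler sums are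
  sums over the list.\<close>

definition bilinear_form ::
  "('k::field \<Rightarrow> 'v \<Rightarrow> 'v) \<Rightarrow> ('k \<Rightarrow> 'w \<Rightarrow> 'w) \<Rightarrow> ('v::ab_group_add \<Rightarrow> 'w::ab_group_add \<Rightarrow> 'k) \<Rightarrow> bool" where
  "bilinear_form sV sW \<beta> \<longleftrightarrow>
     (\<forall>y. Vector_Spaces.linear sV (*) (\<lambda>x. \<beta> x y)) \<and> (\<forall>x. Vector_Spaces.linear sW (*) (\<beta> x))"

definition tensor_eq ::
  "('k::field \<Rightarrow> 'v \<Rightarrow> 'v) \<Rightarrow> ('k \<Rightarrow> 'w \<Rightarrow> 'w) \<Rightarrow>
   ('v::ab_group_add \<times> 'w::ab_group_add) list \<Rightarrow> ('v \<times> 'w) list \<Rightarrow> bool" where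
  "tensor_eq sV sW s t \<longleftrightarrow>
     (\<forall>\<beta>. bilinear_form sV sW \<beta> \<longrightarrow> (\<Sum>(x, y)\<leftarrow>s. \<beta> x y) = (\<Sum>(x, y)\<leftarrow>t. \<beta> x y))"

definition trilinear_form ::
  "('k::field \<Rightarrow> 'v \<Rightarrow> 'v) \<Rightarrow> ('v::ab_group_add \<Rightarrow> 'v \<Rightarrow> 'v \<Rightarrow> 'k) \<Rightarrow> bool" where
  "trilinear_form sV \<beta> \<longleftrightarrow>
     (\<forall>y z. Vector_Spaces.linear sV (*) (\<lambda>x. \<beta> x y z)) \<and>
     (\<forall>x z. Vector_Spaces.linear sV (*) (\<lambda>y. \<beta> x y z)) \<and>
     (\<forall>x y. Vector_Spaces.linear sV (*) (\<beta> x y))"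

definition tensor_eq3 ::
  "('k::field \<Rightarrow> 'v \<Rightarrow> 'v) \<Rightarrow> ('v::ab_group_add \<times> 'v \<times> 'v) list \<Rightarrow> ('v \<times> 'v \<times> 'v) list \<Rightarrow> bool" where
  "tensor_eq3 sV s t \<longleftrightarrow>
     (\<forall>\<beta>. trilinear_form sV \<beta> \<longrightarrow> (\<Sum>(x, y, z)\<leftarrow>s. \<beta> x y z) = (\<Sum>(x, y, z)\<leftarrow>t. \<beta> x y z))"

locale algebra_over = vector_space scale
  for scale :: "'k::field \<Rightarrow> 'a::ring_1 \<Rightarrow> 'a" +
  assumes scale_mult_left: "scale c (x * y) = scale c x * y"
    and scale_mult_right: "scale c (x * y) = x * scale c y"

record ('k, 'a) graded_hopf =
  smult :: "'k \<Rightarrow> 'a \<Rightarrow> 'a"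
  component :: "nat \<Rightarrow> 'a set"
  coprod :: "'a \<Rightarrow> ('a \<times> 'a) list"
  counit :: "'a \<Rightarrow> 'k"
  antipode :: "'a \<Rightarrow> 'a"

text \<open>The degree of a nonzero homogeneous element. (The value \<open>0\<close> at the zero element never
  matters, since degrees are only used in signs.)\<close>

definition deg :: "('k, 'a) graded_hopf \<Rightarrow> 'a \<Rightarrow> nat" where
  "deg K x = (LEAST n. x \<in> component K n)"

definition koszul :: "nat \<Rightarrow> nat \<Rightarrow> 'k::ring_1" where
  "koszul m n = (-1) ^ (m * n)"

text \<open>Graded Hopf algebras with bijective antipode. The list \<^term>\<open>coprod K x\<close> is a chosen
  representative of the coproduct of \<open>x\<close>, with homogeneous entries when \<open>x\<close> is homogeneous. The
  product of \<open>K \<otimes> K\<close> is the graded one: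
  \<open>(x\<^sub>1 \<otimes> x\<^sub>2)(y\<^sub>1 \<otimes> y\<^sub>2) = (-1)^(deg x\<^sub>2 deg y\<^sub>1) x\<^sub>1y\<^sub>1 \<otimes> x\<^sub>2y\<^sub>2\<close>. In degree zero all signs are trivial and
  \<^term>\<open>component K 0\<close> is an ordinary Hopf algebra.\<close>

locale graded_hopf_algebra =
  fixes K :: "('k::field, 'a::ring_1) graded_hopf" (structure)
  assumes algebra: "algebra_over (smult K)"
    and comp_subspace: "module.subspace (smult K) (component K n)"
    and comp_direct: "\<exists>!c. (\<forall>n. c n \<in> component K n) \<and> finite {n. c n \<noteq> 0} \<and> x = (\<Sum>n | c n \<noteq> 0. c n)"
    and one_comp: "1 \<in> component K 0"
    and mult_comp: "x \<in> component K m \<Longrightarrow> y \<in> component K n \<Longrightarrow> x * y \<in> component K (m + n)"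
    and coprod_add: "tensor_eq (smult K) (smult K) (coprod K (x + y)) (coprod K x @ coprod K y)"
    and coprod_smult: "tensor_eq (smult K) (smult K)
          (coprod K (smult K c x)) [(smult K c x1, x2). (x1, x2) \<leftarrow> coprod K x]"
    and coprod_comp: "x \<in> component K n \<Longrightarrow> (x1, x2) \<in> set (coprod K x) \<Longrightarrow>
          \<exists>p q. p + q = n \<and> x1 \<in> component K p \<and> x2 \<in> component K q"
    and coassoc: "tensor_eq3 (smult K)
          [(y1, y2, x2). (x1, x2) \<leftarrow> coprod K x, (y1, y2) \<leftarrow> coprod K x1]
          [(x1, y1, y2). (x1, x2) \<leftarrow> coprod K x, (y1, y2) \<leftarrow> coprod K x2]"
    and coprod_one: "tensor_eq (smult K) (smult K) (coprod K 1) [(1, 1)]"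
    and coprod_mult: "x \<in> component K m \<Longrightarrow> y \<in> component K n \<Longrightarrow>
          tensor_eq (smult K) (smult K) (coprod K (x * y))
            [(smult K (koszul (deg K x2) (deg K y1)) (x1 * y1), x2 * y2).
               (x1, x2) \<leftarrow> coprod K x, (y1, y2) \<leftarrow> coprod K y]"
    and counit_linear: "Vector_Spaces.linear (smult K) (*) (counit K)"
    and counit_one: "counit K 1 = 1"
    and counit_mult: "counit K (x * y) = counit K x * counit K y"
    and counit_comp: "x \<in> component K n \<Longrightarrow> n > 0 \<Longrightarrow> counit K x = 0"
    and counit_left: "(\<Sum>(x1, x2)\<leftarrow>coprod K x. smult K (counit K x1) x2) = x"
    and counit_right: "(\<Sum>(x1, x2)\<leftarrow>coprod K x. smult K (counit K x2) x1) = x"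
    and antipode_linear: "Vector_Spaces.linear (smult K) (smult K) (antipode K)"
    and antipode_comp: "x \<in> component K n \<Longrightarrow> antipode K x \<in> component K n"
    and antipode_left: "(\<Sum>(x1, x2)\<leftarrow>coprod K x. antipode K x1 * x2) = smult K (counit K x) 1"
    and antipode_right: "(\<Sum>(x1, x2)\<leftarrow>coprod K x. x1 * antipode K x2) = smult K (counit K x) 1"
    and antipode_bij: "bij (antipode K)"

context graded_hopf_algebra
begin

lemma vs: "vector_space (smult K)"
  using algebra by (simp add: algebra_over_def)

end

lemma functional_separates:
  fixes s :: "'k::field \<Rightarrow> 'v::ab_group_add \<Rightarrow> 'v"
  assumes "vector_space s" and "\<And>\<xi>. Vector_Spaces.linear s (*) \<xi> \<Longrightarrow> \<xi> v = (0::'k)"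
  shows "v = 0"
proof (rule ccontr)
  assume "v \<noteq> 0"
  interpret vector_space s by fact
  interpret K: vector_space "(*) :: 'k \<Rightarrow> 'k \<Rightarrow> 'k" by unfold_locales (auto simp: algebra_simps)
  interpret P: vector_space_pair s "(*) :: 'k \<Rightarrow> 'k \<Rightarrow> 'k" ..
  have "independent {v}" using \<open>v \<noteq> 0\<close> by simp
  then obtain \<xi> where "Vector_Spaces.linear s (*) \<xi>" "\<forall>x\<in>{v}. \<xi> x = (1::'k)"
    using P.linear_independent_extend[of "{v}" "\<lambda>_. 1"] by blast
  then show False using assms(2)[of \<xi>] by simp
qed

lemma linear_functionalI:
  fixes s :: "'k::field \<Rightarrow> 'v::ab_group_add \<Rightarrow> 'v"
  assumes "vector_space s" "\<And>x y. f (x + y) = f x + f y" "\<And>c x. f (s c x) = c * f x"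
  shows "Vector_Spaces.linear s (*) f"
proof -
  interpret vector_space s by fact
  interpret K: vector_space "(*) :: 'k \<Rightarrow> 'k \<Rightarrow> 'k" by unfold_locales (auto simp: algebra_simps)
  show ?thesis by unfold_locales (use assms in auto)
qed

lemma linear_sum_list:
  assumes "Vector_Spaces.linear s t \<xi>"
  shows "\<xi> (\<Sum>x\<leftarrow>l. g x) = (\<Sum>x\<leftarrow>l. \<xi> (g x))"
proof -
  interpret Vector_Spaces.linear s t \<xi> by fact
  show ?thesis by (induction l) (auto simp: add zero)
qed

lemma sum_list_concat_map: "(\<Sum>x\<leftarrow>concat (map f l). g x) = (\<Sum>y\<leftarrow>l. \<Sum>x\<leftarrow>f y. g x)"
  by (induction l) auto

lemma sum_list_cong_set: "(\<And>x. x \<in> set l \<Longrightarrow> f x = g x) \<Longrightarrow> (\<Sum>x\<leftarrow>l. f x) = (\<Sum>x\<leftarrow>l. g x)"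
  by (metis map_eq_conv)

lemma sum_list_sum_swap: "(\<Sum>x\<leftarrow>l. \<Sum>i\<in>A. g x i) = (\<Sum>i\<in>A. \<Sum>x\<leftarrow>l. g x i)"
  by (induction l) (auto simp: sum.distrib)


section \<open>Tensors with upper and lower indices\<close>

text \<open>A tensor is a function of the list of its lower indices (rows) and the list of its upper
  indices (columns); the entry for space \<open>p\<close> is at list position \<open>p - 1\<close>.
  \<open>tmul m M N\<close> contracts the upper indices of \<open>M\<close>, of which there are \<open>m\<close>, with the lower indices
  of \<open>N\<close>.\<close>

type_synonym ('k, 'n) tensor = "'n list \<Rightarrow> 'n list \<Rightarrow> 'k"

definition multi :: "nat \<Rightarrow> 'n list set" where
  "multi m = {I. length I = m}"

definition tid :: "('k::field, 'n) tensor" where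
  "tid I J = of_bool (I = J)"

definition tmul :: "nat \<Rightarrow> ('k::field, 'n) tensor \<Rightarrow> ('k, 'n) tensor \<Rightarrow> ('k, 'n) tensor" where
  "tmul m M N I J = (\<Sum>L\<in>multi m. M I L * N L J)"

definition tprod :: "nat \<Rightarrow> ('k::field, 'n) tensor list \<Rightarrow> ('k, 'n) tensor" where
  "tprod m Ms = foldr (tmul m) Ms tid"

text \<open>\<open>shift M\<close> is \<open>M\<close> moved one space to the right, with the identity in space 1.\<close>

definition shift :: "('k::field, 'n) tensor \<Rightarrow> ('k, 'n) tensor" where
  "shift M I J = (if I \<noteq> [] \<and> J \<noteq> [] \<and> hd I = hd J then M (tl I) (tl J) else 0)"

text \<open>In the rest of this section \<open>\<sigma> i j k l\<close> is \<open>\<sigma>\<close> with upper indices \<open>i, j\<close> and lower indices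
  \<open>k, l\<close>. \<open>braid_at \<sigma> k\<close> is \<open>\<sigma>\<close> in the spaces \<open>k, k+1\<close>; \<open>braid_up \<sigma> m k n\<close> is \<open>\<sigma>\<close> with index
  \<open>k \<rightarrow> n\<close>, \<open>braid_down \<sigma> m n k\<close> is \<open>\<sigma>\<close> with index \<open>n \<leftarrow> k\<close>, and \<open>antisym \<sigma> m k n\<close> is \<open>A\<close> with
  index \<open>k \<rightarrow> n\<close>, all as operators in the \<open>m\<close> spaces \<open>1, \<dots>, m\<close>.\<close>

definition braid_at :: "('n \<Rightarrow> 'n \<Rightarrow> 'n \<Rightarrow> 'n \<Rightarrow> 'k::field) \<Rightarrow> nat \<Rightarrow> ('k, 'n) tensor" where
  "braid_at \<sigma> k I J =
     (if length I = length J \<and> (\<forall>p<length I. p \<noteq> k - 1 \<and> p \<noteq> k \<longrightarrow> I ! p = J ! p)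
      then \<sigma> (J ! (k - 1)) (J ! k) (I ! (k - 1)) (I ! k) else 0)"

definition braid_up :: "('n \<Rightarrow> 'n \<Rightarrow> 'n \<Rightarrow> 'n \<Rightarrow> 'k::field) \<Rightarrow> nat \<Rightarrow> nat \<Rightarrow> nat \<Rightarrow> ('k, 'n) tensor" where
  "braid_up \<sigma> m k n = tprod m (map (braid_at \<sigma>) [k..<n])"

definition braid_down :: "('n \<Rightarrow> 'n \<Rightarrow> 'n \<Rightarrow> 'n \<Rightarrow> 'k::field) \<Rightarrow> nat \<Rightarrow> nat \<Rightarrow> nat \<Rightarrow> ('k, 'n) tensor" where
  "braid_down \<sigma> m n k = tprod m (map (braid_at \<sigma>) (rev [k..<n]))"

primrec antisym :: "('n \<Rightarrow> 'n \<Rightarrow> 'n \<Rightarrow> 'n \<Rightarrow> 'k::field) \<Rightarrow> nat \<Rightarrow> nat \<Rightarrow> nat \<Rightarrow> ('k, 'n) tensor" where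
  "antisym \<sigma> m k 0 = tid"
| "antisym \<sigma> m k (Suc n) =
     (if n < k then tid
      else tmul m (\<lambda>I J. tid I J - (\<Sum>j=k..n. (-1) ^ (n - j) * braid_up \<sigma> m j (Suc n) I J))
             (antisym \<sigma> m k n))"

definition is_height :: "('n \<Rightarrow> 'n \<Rightarrow> 'n \<Rightarrow> 'n \<Rightarrow> 'k::field) \<Rightarrow> nat \<Rightarrow> bool" where
  "is_height \<sigma> h \<longleftrightarrow>
     (\<forall>n>h. \<forall>I\<in>multi n. \<forall>J\<in>multi n. antisym \<sigma> n 1 n I J = 0) \<and>
     (\<exists>I\<in>multi h. \<exists>J\<in>multi h. antisym \<sigma> h 1 h I J \<noteq> 0)"

definition yang_baxter :: "('n \<Rightarrow> 'n \<Rightarrow> 'n \<Rightarrow> 'n \<Rightarrow> 'k::field) \<Rightarrow> bool" where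
  "yang_baxter \<sigma> \<longleftrightarrow>
     (\<forall>I\<in>multi 3. \<forall>J\<in>multi 3.
        tprod 3 [braid_at \<sigma> 1, braid_at \<sigma> 2, braid_at \<sigma> 1] I J =
        tprod 3 [braid_at \<sigma> 2, braid_at \<sigma> 1, braid_at \<sigma> 2] I J)"


section \<open>The Heisenberg double of the exterior Hopf algebras\<close>

text \<open>\<open>ext\<close> and \<open>dext\<close> are the exterior Hopf algebra and its dual; \<open>\<A>\<close> and \<open>\<A>*\<close> are their components
  of degree zero, and \<^term>\<open>component (dext E) n\<close> is the component of degree \<open>-n\<close>. The Heisenberg double
  has carrier type \<open>'h\<close>, and \<open>emb\<close>, \<open>demb\<close> are the inclusions of the two factors.
  \<open>rmat E i j\<close> and \<open>fmat E i j\<close> have upper index \<open>i\<close> and lower index \<open>j\<close>.\<close>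

record ('k, 'n, 'g, 'd, 'h) heisenberg_data =
  ext :: "('k, 'g) graded_hopf"
  dext :: "('k, 'd) graded_hopf"
  pair :: "'d \<Rightarrow> 'g \<Rightarrow> 'k"
  hsmult :: "'k \<Rightarrow> 'h \<Rightarrow> 'h"
  emb :: "'g \<Rightarrow> 'h"
  demb :: "'d \<Rightarrow> 'h"
  form :: "'n \<Rightarrow> 'g"
  rmat :: "'n \<Rightarrow> 'n \<Rightarrow> 'g"
  fmat :: "'n \<Rightarrow> 'n \<Rightarrow> 'd"
  vfield :: "'n \<Rightarrow> 'd"
  dform :: "'n \<Rightarrow> 'd"
  diff :: "'g \<Rightarrow> 'g"

text \<open>\<open>lact E \<phi> x = \<phi> \<triangleright> x\<close> and \<open>ract E x \<phi> = x \<triangleleft> \<phi>\<close> for \<open>\<phi> \<in> \<A>*\<close>; \<open>dlact E a h = a \<triangleright> h\<close> for \<open>a \<in> \<A>\<close>.\<close>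

definition lact :: "('k::field, 'n, 'g::ring_1, 'd, 'h) heisenberg_data \<Rightarrow> 'd \<Rightarrow> 'g \<Rightarrow> 'g" where
  "lact E \<phi> x = (\<Sum>(x1, x2)\<leftarrow>coprod (ext E) x. smult (ext E) (pair E \<phi> x2) x1)"

definition ract :: "('k::field, 'n, 'g::ring_1, 'd, 'h) heisenberg_data \<Rightarrow> 'g \<Rightarrow> 'd \<Rightarrow> 'g" where
  "ract E x \<phi> = (\<Sum>(x1, x2)\<leftarrow>coprod (ext E) x. smult (ext E) (pair E \<phi> x1) x2)"

definition dlact :: "('k::field, 'n, 'g, 'd::ring_1, 'h) heisenberg_data \<Rightarrow> 'g \<Rightarrow> 'd \<Rightarrow> 'd" where
  "dlact E a h = (\<Sum>(h1, h2)\<leftarrow>coprod (dext E) h. smult (dext E) (pair E h2 a) h1)"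

definition braid :: "('k, 'n, 'g, 'd, 'h) heisenberg_data \<Rightarrow> 'n \<Rightarrow> 'n \<Rightarrow> 'n \<Rightarrow> 'n \<Rightarrow> 'k" where
  "braid E i j k l = pair E (fmat E i l) (rmat E j k)"

text \<open>\<open>struct_const E k i j\<close> is \<open>C\<close> with upper index \<open>k\<close> and lower indices \<open>i, j\<close>.\<close>

definition struct_const :: "('k, 'n, 'g, 'd, 'h) heisenberg_data \<Rightarrow> 'n \<Rightarrow> 'n \<Rightarrow> 'n \<Rightarrow> 'k" where
  "struct_const E k i j = pair E (vfield E j) (rmat E k i)"

definition Omega :: "('k, 'n::finite, 'g, 'd, 'h::ring_1) heisenberg_data \<Rightarrow> 'n \<Rightarrow> 'h" where
  "Omega E i = (\<Sum>j\<in>UNIV. emb E (form E j) * demb E (inv (antipode (dext E)) (fmat E i j)))"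

definition wedge :: "('n \<Rightarrow> 'a::monoid_mult) \<Rightarrow> 'n list \<Rightarrow> 'a" where
  "wedge e I = prod_list (map e I)"

definition all_indices :: "'n::finite list" where
  "all_indices = (SOME I. set I = UNIV \<and> distinct I)"

text \<open>Conventions for the signs. The pairing of \<open>\<phi> \<otimes> \<psi>\<close> with \<open>x \<otimes> y\<close> is
  \<open>(-1)^(deg \<psi> deg x) \<langle>\<phi>, x\<rangle>\<langle>\<psi>, y\<rangle>\<close>. In the cross-multiplication the sign
  \<open>(-1)^(deg \<gamma>\<^sub>(\<^sub>1\<^sub>) deg \<omega>\<^sub>(\<^sub>2\<^sub>))\<close> is accompanied by the sign \<open>(-1)^(deg \<gamma> deg \<omega>)\<close> for interchanging \<open>\<gamma>\<close>
  and \<open>\<omega>\<close>; this is what gives \<open>\<gamma>\<^sub>i \<omega>\<^sup>j + \<omega>\<^sup>j \<gamma>\<^sub>i = f\<^sup>j\<^sub>i\<close>.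

  The wedge relations say that \<open>\<Gamma>\<^sup>(\<^sup>n\<^sup>)\<close> is the left \<open>\<A>\<close>-submodule of the \<open>n\<close>-th tensor power of
  \<open>\<Gamma>\<^sup>(\<^sup>1\<^sup>)\<close> (free on the tensor monomials in the \<open>\<omega>\<^sup>i\<close>) spanned by the columns of \<open>\<omega> \<otimes> \<dots> \<otimes> \<omega> A\<close>: an
  \<open>\<A>\<close>-combination of wedge monomials vanishes iff its coordinates in the tensor power do.
  Likewise for the \<open>\<gamma>\<^sub>i\<close> (with rows of \<open>A\<close>) and for numerical combinations of the \<open>\<Omega>\<^sup>i\<close>.\<close>

locale exterior_heisenberg_double =
  fixes E :: "('k::field, 'n::finite, 'g::ring_1, 'd::ring_1, 'h::ring_1) heisenberg_data" (structure)
  assumes ext_hopf: "graded_hopf_algebra (ext E)"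
    and dext_hopf: "graded_hopf_algebra (dext E)"
    \<comment> \<open>duality of the two exterior Hopf algebras\<close>
    and pair_bilinear: "bilinear_form (smult (dext E)) (smult (ext E)) (pair E)"
    and pair_comp: "\<phi> \<in> component (dext E) m \<Longrightarrow> x \<in> component (ext E) n \<Longrightarrow> m \<noteq> n \<Longrightarrow> pair E \<phi> x = 0"
    and pair_nondegenerate_left: "(\<And>x. pair E \<phi> x = 0) \<Longrightarrow> \<phi> = 0"
    and pair_nondegenerate_right: "(\<And>\<phi>. pair E \<phi> x = 0) \<Longrightarrow> x = 0"
    and pair_one_left: "pair E 1 x = counit (ext E) x"
    and pair_one_right: "pair E \<phi> 1 = counit (dext E) \<phi>"
    and pair_mult_left: "\<phi> \<in> component (dext E) m \<Longrightarrow> \<psi> \<in> component (dext E) n \<Longrightarrow> x \<in> component (ext E) l \<Longrightarrow>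
          pair E (\<phi> * \<psi>) x =
            (\<Sum>(x1, x2)\<leftarrow>coprod (ext E) x. koszul n (deg (ext E) x1) * pair E \<phi> x1 * pair E \<psi> x2)"
    and pair_mult_right: "\<phi> \<in> component (dext E) l \<Longrightarrow> x \<in> component (ext E) m \<Longrightarrow> y \<in> component (ext E) n \<Longrightarrow>
          pair E \<phi> (x * y) =
            (\<Sum>(\<phi>1, \<phi>2)\<leftarrow>coprod (dext E) \<phi>. koszul (deg (dext E) \<phi>2) m * pair E \<phi>1 x * pair E \<phi>2 y)"
    \<comment> \<open>the bicovariant bimodule\<close>
    and form_comp: "form E i \<in> component (ext E) 1"
    and rmat_comp: "rmat E i j \<in> component (ext E) 0"
    and fmat_comp: "fmat E i j \<in> component (dext E) 0"
    and coprod_form: "tensor_eq (smult (ext E)) (smult (ext E)) (coprod (ext E) (form E i))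
          ((1, form E i) # [(form E j, rmat E i j). j \<leftarrow> all_indices])"
    and form_mult: "a \<in> component (ext E) 0 \<Longrightarrow>
          form E i * a = (\<Sum>j\<in>UNIV. lact E (fmat E i j) a * form E j)"
    and bicovariant: "a \<in> component (ext E) 0 \<Longrightarrow>
          (\<Sum>i\<in>UNIV. lact E (fmat E j i) a * rmat E i k) = (\<Sum>i\<in>UNIV. rmat E j i * ract E a (fmat E i k))"
    and coprod_fmat: "tensor_eq (smult (dext E)) (smult (dext E)) (coprod (dext E) (fmat E i j))
          [(fmat E i k, fmat E k j). k \<leftarrow> all_indices]"
    and coprod_rmat: "tensor_eq (smult (ext E)) (smult (ext E)) (coprod (ext E) (rmat E i j))
          [(rmat E k j, rmat E i k). k \<leftarrow> all_indices]"
    and braid_yang_baxter: "yang_baxter (braid E)"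
    \<comment> \<open>the exterior algebra\<close>
    and ext_span: "component (ext E) n =
          {\<Sum>I\<in>multi n. s I * wedge (form E) I |s. \<forall>I. s I \<in> component (ext E) 0}"
    and ext_wedge: "(\<And>J. s J \<in> component (ext E) 0) \<Longrightarrow>
          (\<Sum>J\<in>multi n. s J * wedge (form E) J) = 0 \<longleftrightarrow>
          (\<forall>I\<in>multi n. (\<Sum>J\<in>multi n. smult (ext E) (antisym (braid E) n 1 n I J) (s J)) = 0)"
    \<comment> \<open>the differential\<close>
    and diff_linear: "Vector_Spaces.linear (smult (ext E)) (smult (ext E)) (diff E)"
    and diff_comp: "x \<in> component (ext E) n \<Longrightarrow> diff E x \<in> component (ext E) (Suc n)"
    and diff_diff: "diff E (diff E x) = 0"
    and diff_mult: "x \<in> component (ext E) n \<Longrightarrow>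
          diff E (x * y) = diff E x * y + smult (ext E) ((-1) ^ n) (x * diff E y)"
    and diff_coprod: "x \<in> component (ext E) n \<Longrightarrow>
          tensor_eq (smult (ext E)) (smult (ext E)) (coprod (ext E) (diff E x))
            ([(diff E x1, x2). (x1, x2) \<leftarrow> coprod (ext E) x] @
             [(smult (ext E) ((-1) ^ deg (ext E) x1) x1, diff E x2). (x1, x2) \<leftarrow> coprod (ext E) x])"
    and vfield_comp: "vfield E i \<in> component (dext E) 0"
    and diff_vfield: "a \<in> component (ext E) 0 \<Longrightarrow>
          diff E a = (\<Sum>i\<in>UNIV. lact E (vfield E i) a * form E i)"
    and coprod_vfield: "tensor_eq (smult (dext E)) (smult (dext E)) (coprod (dext E) (vfield E i))
          ((1, vfield E i) # [(vfield E j, fmat E j i). j \<leftarrow> all_indices])"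
    and quantum_lie: "vfield E i * vfield E j =
          (\<Sum>m\<in>UNIV. \<Sum>k\<in>UNIV. smult (dext E) (braid E m k i j) (vfield E m * vfield E k)) +
          (\<Sum>k\<in>UNIV. smult (dext E) (struct_const E k i j) (vfield E k))"
    \<comment> \<open>the dual exterior algebra\<close>
    and dform_comp: "dform E i \<in> component (dext E) 1"
    and coprod_dform: "tensor_eq (smult (dext E)) (smult (dext E)) (coprod (dext E) (dform E i))
          ((1, dform E i) # [(dform E j, fmat E j i). j \<leftarrow> all_indices])"
    and dform_mult: "h \<in> component (dext E) 0 \<Longrightarrow>
          dform E i * h = (\<Sum>j\<in>UNIV. dlact E (rmat E j i) h * dform E j)"
    and dext_span: "component (dext E) n =
          {\<Sum>I\<in>multi n. u I * wedge (dform E) I |u. \<forall>I. u I \<in> component (dext E) 0}"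
    and dext_wedge: "(\<And>I. u I \<in> component (dext E) 0) \<Longrightarrow>
          (\<Sum>I\<in>multi n. u I * wedge (dform E) I) = 0 \<longleftrightarrow>
          (\<forall>J\<in>multi n. (\<Sum>I\<in>multi n. smult (dext E) (antisym (braid E) n 1 n I J) (u I)) = 0)"
    and pair_dform_form: "h \<in> component (dext E) 0 \<Longrightarrow> a \<in> component (ext E) 0 \<Longrightarrow>
          pair E (h * dform E i) (a * form E j) = pair E h a * of_bool (i = j)"
    \<comment> \<open>the Heisenberg double\<close>
    and heisenberg_algebra: "algebra_over (hsmult E)"
    and emb_linear: "Vector_Spaces.linear (smult (ext E)) (hsmult E) (emb E)"
    and emb_one: "emb E 1 = 1"
    and emb_mult: "emb E (x * y) = emb E x * emb E y"
    and demb_linear: "Vector_Spaces.linear (smult (dext E)) (hsmult E) (demb E)"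
    and demb_one: "demb E 1 = 1"
    and demb_mult: "demb E (\<phi> * \<psi>) = demb E \<phi> * demb E \<psi>"
    and heisenberg_span: "\<exists>t. z = (\<Sum>(x, \<phi>)\<leftarrow>t. emb E x * demb E \<phi>)"
    and heisenberg_free: "(\<Sum>(x, \<phi>)\<leftarrow>t. emb E x * demb E \<phi>) = 0 \<Longrightarrow>
          tensor_eq (smult (ext E)) (smult (dext E)) t []"
    and cross_mult: "\<phi> \<in> component (dext E) m \<Longrightarrow> x \<in> component (ext E) n \<Longrightarrow>
          demb E \<phi> * emb E x =
            (\<Sum>(\<phi>1, \<phi>2)\<leftarrow>coprod (dext E) \<phi>. \<Sum>(x1, x2)\<leftarrow>coprod (ext E) x.
               hsmult E (koszul m n * koszul (deg (dext E) \<phi>1) (deg (ext E) x2) * pair E \<phi>1 x2)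
                 (emb E x1 * demb E \<phi>2))"
    and Omega_comm: "a \<in> component (ext E) 0 \<Longrightarrow> Omega E i * emb E a = emb E a * Omega E i"
    and Omega_wedge: "(\<Sum>J\<in>multi n. hsmult E (c J) (wedge (Omega E) (rev J))) = 0 \<longleftrightarrow>
          (\<forall>I\<in>multi n. (\<Sum>J\<in>multi n. antisym (braid E) n 1 n I J * c J) = 0)"


section \<open>BRST operators\<close>

definition heisenberg_comp :: "('k::field, 'n::finite, 'g::ring_1, 'd::ring_1, 'h::ring_1) heisenberg_data \<Rightarrow> int \<Rightarrow> 'h set" where
  "heisenberg_comp E k =
     {\<Sum>(x, \<phi>)\<leftarrow>t. emb E x * demb E \<phi> |t.
        \<forall>(x, \<phi>)\<in>set t. \<exists>m n. x \<in> component (ext E) m \<and> \<phi> \<in> component (dext E) n \<and> int m - int n = k}"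

text \<open>An element \<open>\<Sum> z\<^sub>i \<otimes> a\<^sub>i\<close> with \<open>a\<^sub>i \<in> \<A>\<close>, possibly an infinite formal sum, is encoded as the map
  \<open>h \<mapsto> \<Sum> \<langle>h, a\<^sub>i\<rangle> z\<^sub>i\<close> on \<open>\<A>*\<close>; products become convolutions. The canonical element \<open>\<C>\<close> is
  the inclusion of \<open>\<A>*\<close>, its inverse is the antipode, so \<open>\<C>(z \<otimes> 1)\<C>\<^sup>-\<^sup>1\<close> is
  \<open>h \<mapsto> h\<^sub>(\<^sub>1\<^sub>) z S(h\<^sub>(\<^sub>2\<^sub>))\<close>. Exchanging the roles of \<open>\<A>\<close> and \<open>\<A>*\<close>, \<open>\<C>\<^sup>-\<^sup>1(1 \<otimes> z)\<C>\<close> is the map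
  \<open>a \<mapsto> S(a\<^sub>(\<^sub>1\<^sub>)) z a\<^sub>(\<^sub>2\<^sub>)\<close> on \<open>\<A>\<close>.\<close>

definition right_coaction :: "('k::field, 'n::finite, 'g::ring_1, 'd::ring_1, 'h::ring_1) heisenberg_data \<Rightarrow> 'h \<Rightarrow> 'd \<Rightarrow> 'h" where
  "right_coaction E z h =
     (\<Sum>(h1, h2)\<leftarrow>coprod (dext E) h. demb E h1 * z * demb E (antipode (dext E) h2))"

definition right_invariant :: "('k::field, 'n::finite, 'g::ring_1, 'd::ring_1, 'h::ring_1) heisenberg_data \<Rightarrow> 'h \<Rightarrow> bool" where
  "right_invariant E z \<longleftrightarrow> (\<forall>h\<in>component (dext E) 0. right_coaction E z h = hsmult E (pair E h 1) z)"

definition left_costar_coaction :: "('k::field, 'n::finite, 'g::ring_1, 'd::ring_1, 'h::ring_1) heisenberg_data \<Rightarrow> 'h \<Rightarrow> 'g \<Rightarrow> 'h" where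
  "left_costar_coaction E z a =
     (\<Sum>(a1, a2)\<leftarrow>coprod (ext E) a. emb E (antipode (ext E) a1) * z * emb E a2)"

context exterior_heisenberg_double
begin

lemma antipode_vfield_sum:
  "(\<Sum>(a1, a2)\<leftarrow>coprod (ext E) a. antipode (ext E) a1 * lact E (vfield E i) a2)
     = smult (ext E) (pair E (vfield E i) a) 1"
proof -
  interpret G: graded_hopf_algebra "ext E" by (rule ext_hopf)
  interpret V: algebra_over "smult (ext E)" by (rule G.algebra)
  let ?s = "smult (ext E)" and ?S = "antipode (ext E)" and ?c = "vfield E i"
  interpret pl: Vector_Spaces.linear ?s "(*)" "pair E ?c"
    using pair_bilinear by (simp add: bilinear_form_def)
  interpret Sl: Vector_Spaces.linear ?s ?s ?S by (rule G.antipode_linear)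
  define T where "T x y z = ?s (pair E ?c z) (?S x * y)" for x y z
  have lhs: "(\<Sum>(a1, a2)\<leftarrow>coprod (ext E) a. ?S a1 * lact E ?c a2)
      = (\<Sum>(x, y, z)\<leftarrow>[(x1, y1, y2). (x1, x2) \<leftarrow> coprod (ext E) a, (y1, y2) \<leftarrow> coprod (ext E) x2]. T x y z)"
    unfolding lact_def T_def
    by (simp add: sum_list_concat_map split_def sum_list_const_mult[symmetric] V.scale_mult_right
          o_def)
  have rhs: "(\<Sum>(x, y, z)\<leftarrow>[(y1, y2, x2). (x1, x2) \<leftarrow> coprod (ext E) a, (y1, y2) \<leftarrow> coprod (ext E) x1]. T x y z)
      = ?s (pair E ?c a) 1"
  proof -
    have in1: "(\<Sum>(y1, y2)\<leftarrow>coprod (ext E) x1. T y1 y2 x2) = ?s (pair E ?c (?s (counit (ext E) x1) x2)) 1" for x1 x2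
    proof -
      have "(\<Sum>(y1, y2)\<leftarrow>coprod (ext E) x1. T y1 y2 x2)
          = ?s (pair E ?c x2) (\<Sum>(y1, y2)\<leftarrow>coprod (ext E) x1. ?S y1 * y2)"
        unfolding T_def split_def
        using linear_sum_list[OF V.linear_scale_self, of "pair E ?c x2" "\<lambda>p. ?S (fst p) * snd p" "coprod (ext E) x1"]
        by simp
      also have "\<dots> = ?s (pair E ?c (?s (counit (ext E) x1) x2)) 1"
        by (simp add: G.antipode_left pl.scale mult.commute)
      finally show ?thesis .
    qed
    have "(\<Sum>(x1, x2)\<leftarrow>coprod (ext E) a. ?s (pair E ?c (?s (counit (ext E) x1) x2)) 1)
        = ?s (pair E ?c (\<Sum>(x1, x2)\<leftarrow>coprod (ext E) a. ?s (counit (ext E) x1) x2)) 1"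
    proof -
      have "?s (\<Sum>x\<leftarrow>l. g x) 1 = (\<Sum>x\<leftarrow>l. ?s (g x) 1)" for l :: "('g \<times> 'g) list" and g
        by (induction l) (auto simp: V.scale_left_distrib)
      then show ?thesis
        by (simp add: split_def linear_sum_list[OF pl.linear_axioms])
    qed
    then show ?thesis
      by (simp add: sum_list_concat_map split_def in1[unfolded split_def] G.counit_left[unfolded split_def] o_def)
  qed
  have "\<xi> (\<Sum>(a1, a2)\<leftarrow>coprod (ext E) a. ?S a1 * lact E ?c a2) = \<xi> (?s (pair E ?c a) 1)"
    if \<xi>: "Vector_Spaces.linear ?s (*) \<xi>" for \<xi>
  proof -
    interpret X: Vector_Spaces.linear ?s "(*)" \<xi> by (rule \<xi>)
    have "trilinear_form ?s (\<lambda>x y z. \<xi> (T x y z))"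
      unfolding trilinear_form_def T_def
      by (intro conjI allI linear_functionalI[OF G.vs])
         (simp_all add: X.add X.scale pl.add pl.scale Sl.add Sl.scale distrib_left distrib_right
            V.scale_left_distrib V.scale_mult_left[symmetric] V.scale_mult_right[symmetric]
            mult.left_commute del: V.scale_scale)
    then have "(\<Sum>(x, y, z)\<leftarrow>[(y1, y2, x2). (x1, x2) \<leftarrow> coprod (ext E) a, (y1, y2) \<leftarrow> coprod (ext E) x1]. \<xi> (T x y z))
        = (\<Sum>(x, y, z)\<leftarrow>[(x1, y1, y2). (x1, x2) \<leftarrow> coprod (ext E) a, (y1, y2) \<leftarrow> coprod (ext E) x2]. \<xi> (T x y z))"
      using G.coassoc[of a] unfolding tensor_eq3_def by blast
    then show ?thesis
      unfolding lhs rhs[symmetric] by (simp add: linear_sum_list[OF \<xi>] split_def)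
  qed
  then have "(\<Sum>(a1, a2)\<leftarrow>coprod (ext E) a. ?S a1 * lact E ?c a2) - ?s (pair E ?c a) 1 = 0"
    by (intro functional_separates[OF G.vs])
       (simp add: module_hom.diff[OF module_hom_iff_linear[THEN iffD2]])
  then show ?thesis by simp
qed

lemma left_costar_coaction_BRST:
  assumes z: "\<And>a. a \<in> component (ext E) 0 \<Longrightarrow> z * emb E a - emb E a * z = emb E (diff E a)"
    and a: "a \<in> component (ext E) 0"
  shows "left_costar_coaction E z a =
      hsmult E (counit (ext E) a) z + (\<Sum>i\<in>UNIV. hsmult E (pair E (vfield E i) a) (emb E (form E i)))"
proof -
  interpret G: graded_hopf_algebra "ext E" by (rule ext_hopf)
  interpret V: algebra_over "smult (ext E)" by (rule G.algebra)
  interpret H: algebra_over "hsmult E" by (rule heisenberg_algebra)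
  interpret el: Vector_Spaces.linear "smult (ext E)" "hsmult E" "emb E" by (rule emb_linear)
  let ?s = "smult (ext E)" and ?S = "antipode (ext E)"
  have "left_costar_coaction E z a = (\<Sum>(a1, a2)\<leftarrow>coprod (ext E) a.
      emb E (?S a1 * a2) * z + (\<Sum>i\<in>UNIV. emb E ((?S a1 * lact E (vfield E i) a2) * form E i)))"
    unfolding left_costar_coaction_def
  proof (rule sum_list_cong_set)
    fix p assume p: "p \<in> set (coprod (ext E) a)"
    obtain a1 a2 where p_def: "p = (a1, a2)" by force
    with p G.coprod_comp[OF a, of a1 a2] have a2: "a2 \<in> component (ext E) 0" by auto
    have "z * emb E a2 = emb E a2 * z + emb E (diff E a2)"
      using z[OF a2] by (simp add: algebra_simps)
    then have "emb E (?S a1) * z * emb E a2 = emb E (?S a1 * a2) * z + emb E (?S a1 * diff E a2)"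
      by (simp add: mult.assoc emb_mult distrib_left)
    also have "emb E (?S a1 * diff E a2)
        = (\<Sum>i\<in>UNIV. emb E ((?S a1 * lact E (vfield E i) a2) * form E i))"
      by (simp add: diff_vfield[OF a2] sum_distrib_left mult.assoc el.sum)
    finally show "(case p of (a1, a2) \<Rightarrow> emb E (?S a1) * z * emb E a2) = (case p of (a1, a2) \<Rightarrow>
        emb E (?S a1 * a2) * z + (\<Sum>i\<in>UNIV. emb E ((?S a1 * lact E (vfield E i) a2) * form E i)))"
      by (simp add: p_def)
  qed
  also have "\<dots> = emb E (\<Sum>(a1, a2)\<leftarrow>coprod (ext E) a. ?S a1 * a2) * z
      + (\<Sum>i\<in>UNIV. emb E ((\<Sum>(a1, a2)\<leftarrow>coprod (ext E) a. ?S a1 * lact E (vfield E i) a2) * form E i))"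
    by (simp add: split_def sum_list_addf sum_list_sum_swap linear_sum_list[OF emb_linear]
        sum_list_mult_const[symmetric])
  also have "\<dots> = hsmult E (counit (ext E) a) z
      + (\<Sum>i\<in>UNIV. hsmult E (pair E (vfield E i) a) (emb E (form E i)))"
    by (simp add: G.antipode_left antipode_vfield_sum el.scale emb_one
        V.scale_mult_left[symmetric] H.scale_mult_left[symmetric])
  finally show ?thesis .
qed

lemma emb_eq_zero:
  assumes "emb E y = 0"
  shows "y = 0"
proof -
  interpret G: graded_hopf_algebra "ext E" by (rule ext_hopf)
  interpret D: graded_hopf_algebra "dext E" by (rule dext_hopf)
  interpret c: Vector_Spaces.linear "smult (dext E)" "(*)" "counit (dext E)" by (rule D.counit_linear)
  have free: "tensor_eq (smult (ext E)) (smult (dext E)) [(y, 1)] []"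
    by (rule heisenberg_free) (simp add: assms demb_one)
  show ?thesis
  proof (rule functional_separates[OF G.vs])
    fix \<xi> assume \<xi>: "Vector_Spaces.linear (smult (ext E)) (*) \<xi>"
    interpret X: Vector_Spaces.linear "smult (ext E)" "(*)" \<xi> by (rule \<xi>)
    have bil: "bilinear_form (smult (ext E)) (smult (dext E)) (\<lambda>x \<phi>. \<xi> x * counit (dext E) \<phi>)"
      unfolding bilinear_form_def
      by (intro conjI allI linear_functionalI[OF G.vs] linear_functionalI[OF D.vs])
         (simp_all only: X.add X.scale c.add c.scale distrib_left distrib_right mult.assoc mult.left_commute)
    show "\<xi> y = 0"
      using free[unfolded tensor_eq_def, THEN spec, THEN mp, OF bil] by (simp add: D.counit_one)
  qed
qed

text \<open>An element with \<open>[z, a] = da\<close> for \<open>a \<in> \<A>\<close> that is invariant under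
  \<open>z \<mapsto> \<C>\<^sup>-\<^sup>1(1 \<otimes> z)\<C>\<close> exists only if \<open>d\<close> vanishes on \<open>\<A>\<close>.\<close>

lemma costar_invariant_BRST_trivial:
  assumes z: "\<And>a. a \<in> component (ext E) 0 \<Longrightarrow> z * emb E a - emb E a * z = emb E (diff E a)"
    and inv: "\<And>a. a \<in> component (ext E) 0 \<Longrightarrow> left_costar_coaction E z a = hsmult E (counit (ext E) a) z"
    and a: "a \<in> component (ext E) 0"
  shows "diff E a = 0"
proof -
  interpret G: graded_hopf_algebra "ext E" by (rule ext_hopf)
  interpret V: algebra_over "smult (ext E)" by (rule G.algebra)
  interpret el: Vector_Spaces.linear "smult (ext E)" "hsmult E" "emb E" by (rule emb_linear)
  let ?s = "smult (ext E)"
  have 0: "(\<Sum>i\<in>UNIV. ?s (pair E (vfield E i) b) (form E i)) = 0" if b: "b \<in> component (ext E) 0" for b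
  proof (rule emb_eq_zero)
    show "emb E (\<Sum>i\<in>UNIV. ?s (pair E (vfield E i) b) (form E i)) = 0"
      using left_costar_coaction_BRST[OF z b] inv[OF b] by (simp add: el.sum el.scale)
  qed
  have "diff E a = (\<Sum>(a1, a2)\<leftarrow>coprod (ext E) a.
      a1 * (\<Sum>i\<in>UNIV. ?s (pair E (vfield E i) a2) (form E i)))"
    unfolding diff_vfield[OF a] lact_def split_def
    by (simp add: sum_distrib_left sum_list_sum_swap sum_list_mult_const[symmetric]
        V.scale_mult_left[symmetric] V.scale_mult_right[symmetric])
  also have "\<dots> = (\<Sum>(a1, a2)\<leftarrow>coprod (ext E) a. 0)"
  proof (rule sum_list_cong_set)
    fix p assume p: "p \<in> set (coprod (ext E) a)"
    obtain a1 a2 where p_def: "p = (a1, a2)" by force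
    with p G.coprod_comp[OF a, of a1 a2] have "a2 \<in> component (ext E) 0" by auto
    then show "(case p of (a1, a2) \<Rightarrow> a1 * (\<Sum>i\<in>UNIV. ?s (pair E (vfield E i) a2) (form E i)))
        = (case p of (a1, a2) \<Rightarrow> 0)"
      by (simp add: p_def 0)
  qed
  finally show ?thesis by (simp add: split_def)
qed

end

text \<open>Invariance under the coaction \<open>z \<mapsto> \<C>\<^sup>-\<^sup>1(1 \<otimes> z)\<C>\<close> means that \<open>z\<close> commutes with \<open>\<A>\<close>, which
  contradicts \<open>[z, a] = da\<close> unless \<open>d = 0\<close> on \<open>\<A>\<close>. Left invariance
  is therefore taken with respect to the left \<open>\<A>\<close>-coaction that extends the left coaction
  \<open>a \<mapsto> \<Delta>(a)\<close>, \<open>\<omega>\<^sup>i \<mapsto> 1 \<otimes> \<omega>\<^sup>i\<close> of the bicovariant calculus and is \<open>\<phi> \<mapsto> 1 \<otimes> \<phi>\<close> on the dual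
  exterior algebra; in the encoding above it is
  \<open>\<Delta>\<^sub>L(x\<phi>) = (h \<mapsto> (x \<triangleleft> h) \<phi>)\<close>.\<close>

definition left_invariant ::
  "('k::field, 'n::finite, 'g::ring_1, 'd::ring_1, 'h::ring_1) heisenberg_data \<Rightarrow> 'h \<Rightarrow> bool" where
  "left_invariant E z \<longleftrightarrow>
     (\<forall>t. z = (\<Sum>(x, \<phi>)\<leftarrow>t. emb E x * demb E \<phi>) \<longrightarrow>
        (\<forall>h\<in>component (dext E) 0.
           (\<Sum>(x, \<phi>)\<leftarrow>t. emb E (ract E x h) * demb E \<phi>) = hsmult E (pair E h 1) z))"

definition bi_invariant ::
  "('k::field, 'n::finite, 'g::ring_1, 'd::ring_1, 'h::ring_1) heisenberg_data \<Rightarrow> 'h \<Rightarrow> bool" where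
  "bi_invariant E z \<longleftrightarrow> right_invariant E z \<and> left_invariant E z"

definition is_BRST_operator ::
  "('k::field, 'n::finite, 'g::ring_1, 'd::ring_1, 'h::ring_1) heisenberg_data \<Rightarrow> 'h \<Rightarrow> bool" where
  "is_BRST_operator E Q \<longleftrightarrow>
     bi_invariant E Q \<and> Q \<in> heisenberg_comp E 1 \<and> Q * Q = 0 \<and>
     (\<forall>n. \<forall>x\<in>component (ext E) n. emb E (diff E x) = Q * emb E x - hsmult E ((-1) ^ n) (emb E x * Q))"

text \<open>\<open>X r I J\<close> has lower indices \<open>I = [i\<^sub>1, \<dots>, i\<^sub>r\<^sub>+\<^sub>1]\<close> and upper indices \<open>J = [j\<^sub>1, \<dots>, j\<^sub>r]\<close>.\<close>

definition BRST_term :: "('k::field, 'n::finite, 'g::ring_1, 'd::ring_1, 'h::ring_1) heisenberg_data \<Rightarrow>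
    (nat \<Rightarrow> ('k, 'n) tensor) \<Rightarrow> nat \<Rightarrow> 'h" where
  "BRST_term E X r = (\<Sum>I\<in>multi (r + 1). \<Sum>J\<in>multi r.
     hsmult E (X r I J) (wedge (Omega E) (rev I) * demb E (wedge (dform E) J)))"

definition BRST_charge :: "('k::field, 'n::finite, 'g::ring_1, 'd::ring_1, 'h::ring_1) heisenberg_data \<Rightarrow>
    nat \<Rightarrow> (nat \<Rightarrow> ('k, 'n) tensor) \<Rightarrow> 'h" where
  "BRST_charge E h X = (\<Sum>i\<in>UNIV. Omega E i * demb E (vfield E i)) + (\<Sum>r=1..h - 1. BRST_term E X r)"

definition BRST_initial ::
  "('k::field, 'n::finite, 'g::ring_1, 'd::ring_1, 'h::ring_1) heisenberg_data \<Rightarrow> (nat \<Rightarrow> ('k, 'n) tensor) \<Rightarrow> bool" where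
  "BRST_initial E X \<longleftrightarrow>
     (\<forall>i j k. tmul 2 (antisym (braid E) 2 1 2) (X 1) [i, j] [k] = - struct_const E k i j)"

definition BRST_recurrence ::
  "('k::field, 'n::finite, 'g::ring_1, 'd::ring_1, 'h::ring_1) heisenberg_data \<Rightarrow> (nat \<Rightarrow> ('k, 'n) tensor) \<Rightarrow> nat \<Rightarrow> bool" where
  "BRST_recurrence E X r \<longleftrightarrow>
     (let \<sigma> = braid E; A = antisym \<sigma> (r + 1) 1 (r + 1) in
      \<forall>I\<in>multi (r + 1). \<forall>J\<in>multi r.
        tmul (r + 1) A (tmul r (X r) (antisym \<sigma> r 1 r)) I J =
        tmul (r + 1) A
          (tmul (r + 1) (\<lambda>I J. (-1) ^ r * braid_down \<sigma> (r + 1) (r + 1) 1 I J - tid I J)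
            (tmul r (shift (X (r - 1))) (antisym \<sigma> r 2 r))) I J)"

end

theory Submission
  imports Defs "HOL-Library.Function_Algebras"
begin

text \<open>The Heisenberg double acts on \<open>\<Gamma>\<^sup>\<and>\<close> with \<open>\<Gamma>\<^sup>\<and>\<^sup>*\<close> annihilating the vacuum, and this action is
  faithful; a BRST operator is an element that acts as \<open>d\<close>. Reordering \<open>Q \<omega>\<^sup>k + \<omega>\<^sup>k Q\<close> normally, the
  recurrence for \<open>r\<close> says exactly that the terms with \<open>r - 1 > 0\<close> factors \<open>\<gamma>\<close> cancel, and the top term
  vanishes because of the height. The remaining term without \<open>\<gamma>\<close> lies in \<open>\<Gamma>\<^sup>(\<^sup>2\<^sup>)\<A>*\<close> and acts on \<open>\<A>\<close> as
  multiplication by \<open>d\<omega>\<^sup>k\<close>, by the initial condition, which is the Maurer--Cartan equation. Hence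
  \<open>[Q, \<cdot>] = d\<close>, and \<open>Q\<^sup>2 = 0\<close> and right invariance follow by faithfulness. Conversely, the charge built
  from \<open>X\<^sub>1, \<dots>, X\<^sub>r\<^sub>-\<^sub>1\<close> acts on forms of degree \<open>r\<close> as \<open>d\<close> plus the right-hand side of the recurrence;
  both are well defined on \<open>\<Gamma>\<^sup>(\<^sup>r\<^sup>)\<close>, so the right-hand side factors through \<open>A\<close> and \<open>X\<^sub>r\<close> exists.\<close>

section \<open>Linear algebra\<close>

text \<open>Monomials in the \<Omega> or in the \<gamma> are linearly dependent, so a normally
  ordered expression has no well-defined coefficients; only their contractions with antisymmetrizers
  can be compared. This shapes both directions. For cancellation, relations known for numerical
  coefficients have to be used with coefficients in the double, which is
  \<open>sum_numeric_kernel\<close>. For existence, a right-hand side annihilating the kernel of A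
  is divided by A with a generalized inverse. The A to the right of X in the recurrence has an
  indirect origin: moving \<omega> leftwards through r factors \<gamma> yields a signed sum of the
  \<sigma> with index p <- 1 applied to f \<gamma> ... \<gamma>, whose relations are governed by A
  with index 2 -> r. The product of the two is A with index 1 -> r. \<open>antisym\<close> is
  defined by the other recursion, so the agreement of the two recursions must first be derived from
  Yang-Baxter. Left invariance and degree are not read off from the action; they hold because the
  charge can be normally ordered with products of the \<omega>, without coefficients from \<A>, in
  front.\<close>

lemma linearI:
  fixes s :: "'k::field \<Rightarrow> 'v::ab_group_add \<Rightarrow> 'v" and t :: "'k \<Rightarrow> 'w::ab_group_add \<Rightarrow> 'w"
  assumes "vector_space s" "vector_space t"
    and "\<And>x y. f (x + y) = f x + f y" "\<And>c x. f (s c x) = t c (f x)"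
  shows "Vector_Spaces.linear s t f"
proof -
  interpret s: vector_space s by fact
  interpret t: vector_space t by fact
  show ?thesis by unfold_locales (use assms in auto)
qed

lemma vector_space_mult: "vector_space ((*) :: 'k::field \<Rightarrow> 'k \<Rightarrow> 'k)"
  by unfold_locales (auto simp: algebra_simps)

lemma linear_vector_spaces:
  assumes "Vector_Spaces.linear s t f"
  shows "vector_space s" "vector_space t"
  using assms unfolding Vector_Spaces.linear_def by blast+

lemma linear_sum:
  assumes "Vector_Spaces.linear s t \<xi>"
  shows "\<xi> (\<Sum>x\<in>A. g x) = (\<Sum>x\<in>A. \<xi> (g x))"
proof -
  interpret Vector_Spaces.linear s t \<xi> by fact
  show ?thesis by (rule sum)
qed

lemma linearD:
  assumes "Vector_Spaces.linear s t f"
  shows "f (x + y) = f x + f y" "f (s c x) = t c (f x)" "f 0 = 0" "f (- x) = - f x" "f (x - y) = f x - f y"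
proof -
  interpret Vector_Spaces.linear s t f by fact
  show "f (x + y) = f x + f y" "f (s c x) = t c (f x)" "f 0 = 0" "f (- x) = - f x" "f (x - y) = f x - f y"
    by (rule add scale zero neg diff)+
qed

lemma linear_comp:
  assumes "Vector_Spaces.linear s t f" "Vector_Spaces.linear t u g"
  shows "Vector_Spaces.linear s u (\<lambda>x. g (f x))"
  by (rule linearI) (use assms linear_vector_spaces in \<open>auto simp: linearD(1,2)[OF assms(1)] linearD(1,2)[OF assms(2)]\<close>)

lemma functionals_eqI:
  fixes s :: "'k::field \<Rightarrow> 'v::ab_group_add \<Rightarrow> 'v"
  assumes s: "vector_space s" and eq: "\<And>\<xi>. Vector_Spaces.linear s (*) \<xi> \<Longrightarrow> \<xi> v = \<xi> w"
  shows "v = w"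
proof -
  have "v - w = 0"
  proof (rule functional_separates[OF s])
    fix \<xi> assume \<xi>: "Vector_Spaces.linear s (*) \<xi>"
    interpret Vector_Spaces.linear s "(*)" \<xi> by (rule \<xi>)
    show "\<xi> (v - w) = 0" using eq[OF \<xi>] by (simp add: diff)
  qed
  then show ?thesis by simp
qed

text \<open>Linear functionals separate the points of \<open>u\<close>, so the scalar forms
  quantified over in \<open>tensor_eq\<close> already control vector-valued bilinear maps. Known
  coproducts are substituted into Sweedler sums in this way.\<close>

lemma tensor_eq_sum:
  fixes u :: "'k::field \<Rightarrow> 'u::ab_group_add \<Rightarrow> 'u"
  assumes eq: "tensor_eq sV sW s t" and u: "vector_space u"
    and B1: "\<And>y. Vector_Spaces.linear sV u (\<lambda>x. B x y)"
    and B2: "\<And>x. Vector_Spaces.linear sW u (B x)"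
  shows "(\<Sum>(x, y)\<leftarrow>s. B x y) = (\<Sum>(x, y)\<leftarrow>t. B x y)"
proof (rule functionals_eqI[OF u])
  fix \<xi> assume \<xi>: "Vector_Spaces.linear u (*) \<xi>"
  have "bilinear_form sV sW (\<lambda>x y. \<xi> (B x y))"
    unfolding bilinear_form_def
    using linear_comp[OF B1 \<xi>] linear_comp[OF B2 \<xi>] by blast
  then have "(\<Sum>(x, y)\<leftarrow>s. \<xi> (B x y)) = (\<Sum>(x, y)\<leftarrow>t. \<xi> (B x y))"
    using eq unfolding tensor_eq_def by blast
  then show "\<xi> (\<Sum>(x, y)\<leftarrow>s. B x y) = \<xi> (\<Sum>(x, y)\<leftarrow>t. B x y)"
    by (simp add: linear_sum_list[OF \<xi>] split_def)
qed

lemma tensor_eq3_sum: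
  fixes u :: "'k::field \<Rightarrow> 'u::ab_group_add \<Rightarrow> 'u"
  assumes eq: "tensor_eq3 sV s t" and u: "vector_space u"
    and T1: "\<And>y z. Vector_Spaces.linear sV u (\<lambda>x. T x y z)"
    and T2: "\<And>x z. Vector_Spaces.linear sV u (\<lambda>y. T x y z)"
    and T3: "\<And>x y. Vector_Spaces.linear sV u (T x y)"
  shows "(\<Sum>(x, y, z)\<leftarrow>s. T x y z) = (\<Sum>(x, y, z)\<leftarrow>t. T x y z)"
proof (rule functionals_eqI[OF u])
  fix \<xi> assume \<xi>: "Vector_Spaces.linear u (*) \<xi>"
  have "trilinear_form sV (\<lambda>x y z. \<xi> (T x y z))"
    unfolding trilinear_form_def
    using linear_comp[OF T1 \<xi>] linear_comp[OF T2 \<xi>] linear_comp[OF T3 \<xi>] by blast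
  then have "(\<Sum>(x, y, z)\<leftarrow>s. \<xi> (T x y z)) = (\<Sum>(x, y, z)\<leftarrow>t. \<xi> (T x y z))"
    using eq unfolding tensor_eq3_def by blast
  then show "\<xi> (\<Sum>(x, y, z)\<leftarrow>s. T x y z) = \<xi> (\<Sum>(x, y, z)\<leftarrow>t. T x y z)"
    by (simp add: linear_sum_list[OF \<xi>] split_def)
qed

text \<open>Expanding every \<open>y j\<close> in one basis turns the vector relation into scalar
  relations, one for each basis vector, to which \<open>e\<close> applies. In the applications the
  \<open>y j\<close> are coefficients in the double, \<open>B\<close> sends a number to that
  multiple of a monomial, \<open>G\<close> attaches a coefficient to the monomial, and
  \<open>D\<close> multiplies by a basis vector on the same side.\<close>

lemma sum_numeric_kernel:
  fixes s :: "'k::field \<Rightarrow> 'w::ab_group_add \<Rightarrow> 'w"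
  assumes s: "vector_space s" and S: "finite S"
    and y: "\<And>i. i \<in> T \<Longrightarrow> (\<Sum>j\<in>S. s (A i j) (y j)) = 0"
    and e: "\<And>c. (\<And>i. i \<in> T \<Longrightarrow> (\<Sum>j\<in>S. A i j * c j) = 0) \<Longrightarrow> (\<Sum>j\<in>S. B j (c j)) = (0::'u::ab_group_add)"
    and B: "\<And>j. j \<in> S \<Longrightarrow> Vector_Spaces.linear (*) u (B j)"
    and G: "\<And>b j. j \<in> S \<Longrightarrow> Vector_Spaces.linear s u' (G j)"
    and GB: "\<And>c b j. j \<in> S \<Longrightarrow> G j (s c b) = D b (B j c)"
    and D: "\<And>b. Vector_Spaces.linear u u' (D b)"
  shows "(\<Sum>j\<in>S. G j (y j)) = 0"
proof -
  interpret vector_space s by fact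
  define b where "b = extend_basis {}"
  have ind: "independent b" and sp: "span b = UNIV"
    unfolding b_def using independent_extend_basis[OF independent_empty] span_extend_basis[OF independent_empty] by auto
  define \<rho> where "\<rho> v x = representation b v x" for v x
  define Z where "Z = (\<Union>j\<in>S. {x. \<rho> (y j) x \<noteq> 0})"
  have fin: "finite Z" unfolding Z_def \<rho>_def using S by (auto intro: finite_representation)
  have rep: "y j = (\<Sum>x\<in>Z. s (\<rho> (y j) x) x)" if "j \<in> S" for j
  proof -
    have "y j = (\<Sum>x | \<rho> (y j) x \<noteq> 0. s (\<rho> (y j) x) x)"
      unfolding \<rho>_def using sum_nonzero_representation_eq[OF ind, of "y j"] sp by simp
    also have "\<dots> = (\<Sum>x\<in>Z. s (\<rho> (y j) x) x)"
      by (rule sum.mono_neutral_left) (use fin that in \<open>auto simp: Z_def\<close>)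
    finally show ?thesis .
  qed
  have zero: "(\<Sum>j\<in>S. B j (\<rho> (y j) x)) = 0" for x
  proof (rule e)
    fix i assume i: "i \<in> T"
    have "(\<Sum>j\<in>S. A i j * \<rho> (y j) x) = \<rho> (\<Sum>j\<in>S. s (A i j) (y j)) x"
      unfolding \<rho>_def using sp by (simp add: representation_sum[OF ind] representation_scale[OF ind])
    also have "\<dots> = 0" using y[OF i] by (simp add: \<rho>_def representation_zero)
    finally show "(\<Sum>j\<in>S. A i j * \<rho> (y j) x) = 0" .
  qed
  have "(\<Sum>j\<in>S. G j (y j)) = (\<Sum>j\<in>S. \<Sum>x\<in>Z. D x (B j (\<rho> (y j) x)))"
  proof (rule sum.cong)
    fix j assume j: "j \<in> S"
    have "G j (y j) = (\<Sum>x\<in>Z. G j (s (\<rho> (y j) x) x))"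
      by (subst rep[OF j]) (simp add: linear_sum[OF G[OF j]])
    then show "G j (y j) = (\<Sum>x\<in>Z. D x (B j (\<rho> (y j) x)))" by (simp add: GB[OF j])
  qed simp
  also have "\<dots> = (\<Sum>x\<in>Z. D x (\<Sum>j\<in>S. B j (\<rho> (y j) x)))"
    by (subst sum.swap) (simp add: linear_sum[OF D])
  also have "\<dots> = 0"
    using zero by (simp add: linearD(3)[OF D])
  finally show ?thesis .
qed

text \<open>Expanding the left entries in a basis groups the sum by basis vectors, and the
  coordinate functionals are among the \<open>\<xi>\<close> of the hypothesis.\<close>

lemma sum_bilinear_eq_zero:
  fixes sV :: "'k::field \<Rightarrow> 'v::ab_group_add \<Rightarrow> 'v" and sW :: "'k \<Rightarrow> 'w::ab_group_add \<Rightarrow> 'w"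
  assumes V: "vector_space sV" and W: "vector_space sW" and u: "vector_space u"
    and zero: "\<And>\<xi>. Vector_Spaces.linear sV (*) \<xi> \<Longrightarrow> (\<Sum>(x, \<phi>)\<leftarrow>t. sW (\<xi> x) \<phi>) = 0"
    and B1: "\<And>y. Vector_Spaces.linear sV u (\<lambda>x. B x y)"
    and B2: "\<And>x. Vector_Spaces.linear sW u (B x)"
  shows "(\<Sum>(x, \<phi>)\<leftarrow>t. B x \<phi>) = 0"
proof -
  interpret V: vector_space sV by fact
  interpret W: vector_space sW by fact
  interpret u: vector_space u by fact
  define b where "b = V.extend_basis {}"
  have ind: "V.independent b" and sp: "V.span b = UNIV"
    unfolding b_def using V.independent_extend_basis[OF V.independent_empty] V.span_extend_basis[OF V.independent_empty] by auto
  define \<rho> where "\<rho> x v = V.representation b v x" for v x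
  define Z where "Z = (\<Union>v\<in>fst ` set t. {x. \<rho> x v \<noteq> 0})"
  have fin: "finite Z" unfolding Z_def \<rho>_def by (auto intro: V.finite_representation)
  have rep: "v = (\<Sum>x\<in>Z. sV (\<rho> x v) x)" if "(v, \<phi>) \<in> set t" for v \<phi>
  proof -
    have "v = (\<Sum>x | \<rho> x v \<noteq> 0. sV (\<rho> x v) x)"
      unfolding \<rho>_def using V.sum_nonzero_representation_eq[OF ind, of v] sp by simp
    also have "\<dots> = (\<Sum>x\<in>Z. sV (\<rho> x v) x)"
      by (rule sum.mono_neutral_left) (use fin that in \<open>force simp: Z_def\<close>)+
    finally show ?thesis .
  qed
  have lin: "Vector_Spaces.linear sV (*) (\<rho> x)" for x
    unfolding \<rho>_def using sp
    by (intro linear_functionalI[OF V]) (simp_all add: V.representation_add[OF ind] V.representation_scale[OF ind])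
  have "(\<Sum>(v, \<phi>)\<leftarrow>t. B v \<phi>) = (\<Sum>(v, \<phi>)\<leftarrow>t. \<Sum>x\<in>Z. B x (sW (\<rho> x v) \<phi>))"
  proof (rule sum_list_cong_set, clarify)
    fix v \<phi> assume v: "(v, \<phi>) \<in> set t"
    have "B v \<phi> = (\<Sum>x\<in>Z. B (sV (\<rho> x v) x) \<phi>)"
      by (subst rep[OF v]) (simp add: linear_sum[OF B1])
    also have "\<dots> = (\<Sum>x\<in>Z. B x (sW (\<rho> x v) \<phi>))"
      by (simp add: linearD(2)[OF B1] linearD(2)[OF B2])
    finally show "B v \<phi> = (\<Sum>x\<in>Z. B x (sW (\<rho> x v) \<phi>))" .
  qed
  also have "\<dots> = (\<Sum>x\<in>Z. \<Sum>(v, \<phi>)\<leftarrow>t. B x (sW (\<rho> x v) \<phi>))"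
    by (simp add: split_def sum_list_sum_swap)
  also have "\<dots> = (\<Sum>x\<in>Z. B x (\<Sum>(v, \<phi>)\<leftarrow>t. sW (\<rho> x v) \<phi>))"
    by (simp add: split_def linear_sum_list[OF B2])
  also have "\<dots> = 0"
    using zero[OF lin] by (simp add: linearD(3)[OF B2])
  finally show ?thesis .
qed

lemma sum_fun_eval: "(\<Sum>x\<in>A. f x) y = (\<Sum>x\<in>A. f x y)"
  by (induction A rule: infinite_finite_induct) auto

text \<open>A linear map has a linear \<open>g\<close> inverting it on its range, and its values on
  unit vectors are the entries. With A g A = A, any matrix annihilating the kernel of A is divisible
  by A on the right, which is how the recurrence is solved.\<close>

lemma matrix_generalized_inverse:
  fixes A :: "'i \<Rightarrow> 'j \<Rightarrow> 'k::field"
  assumes fin: "finite S" "finite T"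
  obtains g where "\<And>i j. i \<in> T \<Longrightarrow> j \<in> S \<Longrightarrow>
    (\<Sum>k\<in>S. A i k * (\<Sum>l\<in>T. g k l * A l j)) = A i j"
proof -
  define sV :: "'k \<Rightarrow> ('j \<Rightarrow> 'k) \<Rightarrow> 'j \<Rightarrow> 'k" where "sV c v = (\<lambda>j. c * v j)" for c v
  define sW :: "'k \<Rightarrow> ('i \<Rightarrow> 'k) \<Rightarrow> 'i \<Rightarrow> 'k" where "sW c v = (\<lambda>j. c * v j)" for c v
  have V: "vector_space sV" and W: "vector_space sW"
    by (unfold_locales; auto simp: sV_def sW_def algebra_simps fun_eq_iff)+
  interpret P: vector_space_pair sV sW
    using V W unfolding vector_space_pair_def vector_space_def by blast
  \<comment> \<open>The value 0 outside \<open>T\<close> makes \<open>f v\<close> a finite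
    combination of the \<open>\<delta> l\<close>, although the index types may be infinite.\<close>
  define f where "f v = (\<lambda>i. if i \<in> T then \<Sum>j\<in>S. A i j * v j else 0)" for v
  have f: "Vector_Spaces.linear sV sW f"
    by (rule linearI[OF V W]) (auto simp: f_def sV_def sW_def fun_eq_iff algebra_simps sum.distrib sum_distrib_left)
  obtain g where g: "Vector_Spaces.linear sW sV g" "\<And>v. f (g (f v)) = f v"
    using P.linear_exists_right_inverse_on[OF f P.vs1.subspace_UNIV] by auto
  define \<delta> :: "'i \<Rightarrow> 'i \<Rightarrow> 'k" where "\<delta> l = (\<lambda>i. of_bool (i = l))" for l
  have exp: "w = (\<Sum>l\<in>T. sW (w l) (\<delta> l))" if "\<And>i. i \<notin> T \<Longrightarrow> w i = 0" for w
  proof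
    fix i
    have "T \<inter> {i} = (if i \<in> T then {i} else {})" by auto
    then show "w i = (\<Sum>l\<in>T. sW (w l) (\<delta> l)) i"
      using that[of i] fin by (simp add: sW_def \<delta>_def sum_fun_eval)
  qed
  have "(\<Sum>k\<in>S. A i k * (\<Sum>l\<in>T. g (\<delta> l) k * A l j)) = A i j" if i: "i \<in> T" and j: "j \<in> S" for i j
  proof -
    define v :: "'j \<Rightarrow> 'k" where "v = (\<lambda>k. of_bool (k = j))"
    have fv: "f v l = A l j" if "l \<in> T" for l using that j fin by (simp add: f_def v_def)
    have "f v = (\<Sum>l\<in>T. sW (f v l) (\<delta> l))" by (rule exp) (simp add: f_def)
    then have "g (f v) = (\<Sum>l\<in>T. g (sW (f v l) (\<delta> l)))" using linear_sum[OF g(1)] by metis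
    also have "\<dots> = (\<Sum>l\<in>T. sV (f v l) (g (\<delta> l)))"
      by (simp add: linearD(2)[OF g(1)])
    finally have "g (f v) k = (\<Sum>l\<in>T. g (\<delta> l) k * A l j)" for k
      by (simp add: sV_def fv sum_fun_eval mult.commute)
    then have "f (g (f v)) i = (\<Sum>k\<in>S. A i k * (\<Sum>l\<in>T. g (\<delta> l) k * A l j))"
      using i by (simp add: f_def)
    then show ?thesis using g(2) fv[OF i] by simp
  qed
  then show ?thesis using that[of "\<lambda>k l. g (\<delta> l) k"] by blast
qed

lemma sum_list_swap: "(\<Sum>x\<leftarrow>l. \<Sum>y\<leftarrow>m. f x y :: 'a::comm_monoid_add) = (\<Sum>y\<leftarrow>m. \<Sum>x\<leftarrow>l. f x y)"
  by (induction l) (auto simp: sum_list_addf)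

section \<open>Graded Hopf algebras\<close>

context graded_hopf_algebra
begin

interpretation V: algebra_over "smult K" by (rule algebra)

lemma comp_zero [simp]: "0 \<in> component K n"
  using V.subspace_0[OF comp_subspace] .

lemma comp_add: "x \<in> component K n \<Longrightarrow> y \<in> component K n \<Longrightarrow> x + y \<in> component K n"
  using V.subspace_add[OF comp_subspace] .

lemma comp_scale: "x \<in> component K n \<Longrightarrow> smult K c x \<in> component K n"
  using V.subspace_scale[OF comp_subspace] .

lemma comp_diff: "x \<in> component K n \<Longrightarrow> y \<in> component K n \<Longrightarrow> x - y \<in> component K n"
  using V.subspace_diff[OF comp_subspace] .

lemma comp_sum: "(\<And>i. i \<in> A \<Longrightarrow> f i \<in> component K n) \<Longrightarrow> sum f A \<in> component K n"
  using V.subspace_sum[OF comp_subspace, of A f n] by blast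

lemma comp_sum_list: "(\<And>i. i \<in> set l \<Longrightarrow> f i \<in> component K n) \<Longrightarrow> (\<Sum>i\<leftarrow>l. f i) \<in> component K n"
  by (induction l) (auto intro: comp_add)

section \<open>Homogeneous components and the grading\<close>

lemma decomposition_unique:
  assumes "\<And>n. c n \<in> component K n" "\<And>n. d n \<in> component K n"
    and "finite F" "\<And>n. n \<notin> F \<Longrightarrow> c n = 0" "\<And>n. n \<notin> F \<Longrightarrow> d n = 0"
    and "(\<Sum>n\<in>F. c n) = (\<Sum>n\<in>F. d n)"
  shows "c = d"
proof -
  have fin: "finite {n. c n \<noteq> 0}" "finite {n. d n \<noteq> 0}"
    using assms(3,4,5) by (auto intro: finite_subset[of _ F])
  have "(\<Sum>n\<in>F. c n) = (\<Sum>n | c n \<noteq> 0. c n)" "(\<Sum>n\<in>F. d n) = (\<Sum>n | d n \<noteq> 0. d n)"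
    by (rule sum.mono_neutral_right; use assms(3,4,5) in auto)+
  then show ?thesis
    using comp_direct[of "\<Sum>n\<in>F. c n"] assms(1,2,6) fin by metis
qed

lemma decomposition_exists:
  obtains c F where "\<And>n. c n \<in> component K n" "finite F" "\<And>n. n \<notin> F \<Longrightarrow> c n = 0" "x = (\<Sum>n\<in>F. c n)"
  using comp_direct[of x] that by (metis (mono_tags, lifting) mem_Collect_eq)

lemma comp_disjoint:
  assumes "x \<in> component K m" "x \<in> component K n" "m \<noteq> n"
  shows "x = 0"
proof -
  have "(\<lambda>k. if k = m then x else 0) = (\<lambda>k. if k = n then x else 0)"
    by (rule decomposition_unique[of _ _ "{m, n}"]) (use assms in auto)
  then show ?thesis using assms(3) by metis
qed

lemma deg_eq:
  assumes "x \<in> component K n" "x \<noteq> 0"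
  shows "deg K x = n"
  unfolding deg_def by (rule Least_equality) (use assms comp_disjoint in \<open>blast+\<close>)

lemma deg_degree0: "x \<in> component K 0 \<Longrightarrow> deg K x = 0"
  unfolding deg_def by (simp add: Least_eq_0)

text \<open>Uniqueness makes the chosen decompositions linear in the element. The projection serves
  to write a degree-dependent sign of the cross-multiplication as a linear map.\<close>

lemma projection_degree0:
  obtains p where "Vector_Spaces.linear (smult K) (smult K) p"
    "\<And>x. x \<in> component K 0 \<Longrightarrow> p x = x" "\<And>x n. x \<in> component K (Suc n) \<Longrightarrow> p x = 0"
proof -
  have "\<exists>c. (\<forall>n. c n \<in> component K n) \<and> finite {n. c n \<noteq> 0} \<and> x = (\<Sum>n | c n \<noteq> 0. c n)" for x
    using comp_direct by blast
  then obtain c where c: "\<And>x n. c x n \<in> component K n" "\<And>x. finite {n. c x n \<noteq> 0}"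
    "\<And>x. x = (\<Sum>n | c x n \<noteq> 0. c x n)" by metis
  have uniq: "d = c x" if "\<And>n. d n \<in> component K n" "finite F" "\<And>n. n \<notin> F \<Longrightarrow> d n = 0" "x = (\<Sum>n\<in>F. d n)" for d x F
  proof (rule decomposition_unique[of _ _ "F \<union> {n. c x n \<noteq> 0}"])
    have "(\<Sum>n\<in>F. d n) = (\<Sum>n\<in>F \<union> {n. c x n \<noteq> 0}. d n)"
      by (rule sum.mono_neutral_left) (use that c in auto)
    moreover have "(\<Sum>n | c x n \<noteq> 0. c x n) = (\<Sum>n\<in>F \<union> {n. c x n \<noteq> 0}. c x n)"
      by (rule sum.mono_neutral_left) (use that c in auto)
    ultimately show "(\<Sum>n\<in>F \<union> {n. c x n \<noteq> 0}. d n) = (\<Sum>n\<in>F \<union> {n. c x n \<noteq> 0}. c x n)"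
      using that(4) c(3) by metis
  qed (use that c in auto)
  have "(\<lambda>n. c x n + c y n) = c (x + y)" for x y
  proof (rule uniq)
    let ?F = "{n. c x n \<noteq> 0} \<union> {n. c y n \<noteq> 0}"
    have "(\<Sum>n | c x n \<noteq> 0. c x n) = (\<Sum>n\<in>?F. c x n)" "(\<Sum>n | c y n \<noteq> 0. c y n) = (\<Sum>n\<in>?F. c y n)"
      by (rule sum.mono_neutral_left; use c in auto)+
    then show "x + y = (\<Sum>n\<in>?F. c x n + c y n)" using c(3) by (simp add: sum.distrib)
  qed (use c in \<open>auto intro: comp_add\<close>)
  moreover have "(\<lambda>n. smult K a (c x n)) = c (smult K a x)" for a x
  proof (rule uniq)
    show "smult K a x = (\<Sum>n | c x n \<noteq> 0. smult K a (c x n))"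
      using c(3)[of x] by (simp flip: V.scale_sum_right)
  qed (use c in \<open>auto intro: comp_scale\<close>)
  ultimately have "Vector_Spaces.linear (smult K) (smult K) (\<lambda>x. c x 0)"
    by (intro linearI[OF vs vs]) metis+
  moreover have "(\<lambda>k. if k = n then x else 0) = c x" if "x \<in> component K n" for x n
    by (rule uniq[of _ "{n}"]) (use that in auto)
  note decomp = this
  have "c x 0 = (if n = 0 then x else 0)" if "x \<in> component K n" for x n
    using fun_cong[OF decomp[OF that], of 0] by auto
  ultimately show ?thesis by (intro that[of "\<lambda>x. c x 0"]) auto
qed

lemma coprod_degree0:
  assumes "x \<in> component K 0" "(x1, x2) \<in> set (coprod K x)"
  shows "x1 \<in> component K 0" "x2 \<in> component K 0"
  using coprod_comp[OF assms] by auto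

lemma coassoc_sum:
  fixes u :: "'k \<Rightarrow> 'u::ab_group_add \<Rightarrow> 'u"
  assumes "vector_space u"
    and "\<And>y z. Vector_Spaces.linear (smult K) u (\<lambda>x. T x y z)"
    and "\<And>x z. Vector_Spaces.linear (smult K) u (\<lambda>y. T x y z)"
    and "\<And>x y. Vector_Spaces.linear (smult K) u (T x y)"
  shows "(\<Sum>(x1, x2)\<leftarrow>coprod K x. \<Sum>(y1, y2)\<leftarrow>coprod K x1. T y1 y2 x2)
       = (\<Sum>(x1, x2)\<leftarrow>coprod K x. \<Sum>(y1, y2)\<leftarrow>coprod K x2. T x1 y1 y2)"
  using tensor_eq3_sum[OF coassoc assms, of x]
  by (simp add: sum_list_concat_map split_def o_def)

section \<open>The antipode and its inverse on the component of degree zero\<close>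

lemma coprod_mult_degree0:
  fixes u :: "'k \<Rightarrow> 'u::ab_group_add \<Rightarrow> 'u"
  assumes x: "x \<in> component K 0" and y: "y \<in> component K 0" and u: "vector_space u"
    and B: "\<And>y. Vector_Spaces.linear (smult K) u (\<lambda>x. B x y)" "\<And>x. Vector_Spaces.linear (smult K) u (B x)"
  shows "(\<Sum>(z1, z2)\<leftarrow>coprod K (x * y). B z1 z2)
       = (\<Sum>(x1, x2)\<leftarrow>coprod K x. \<Sum>(y1, y2)\<leftarrow>coprod K y. B (x1 * y1) (x2 * y2))"
  unfolding tensor_eq_sum[OF coprod_mult[OF x y] u B]
  by (simp add: sum_list_concat_map split_def o_def)
     (intro sum_list_cong_set, auto dest!: coprod_degree0[OF x] coprod_degree0[OF y] simp: deg_degree0 koszul_def)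

lemmas antipode_simps = linearD[OF antipode_linear] linearD[OF counit_linear]
  V.scale_mult_left[symmetric] V.scale_mult_right[symmetric] V.scale_right_distrib V.scale_left_distrib
  distrib_left distrib_right

lemma antipode_one [simp]: "antipode K 1 = 1"
proof -
  have "(\<Sum>(x1, x2)\<leftarrow>coprod K 1. antipode K x1 * x2) = (\<Sum>(x1, x2)\<leftarrow>[(1, 1)]. antipode K x1 * x2)"
    by (rule tensor_eq_sum[OF coprod_one vs]) (auto intro!: linearI[OF vs vs] simp: antipode_simps)
  then show ?thesis by (simp add: antipode_left counit_one)
qed

lemma sum_counit_left:
  assumes f: "Vector_Spaces.linear (smult K) u f"
  shows "(\<Sum>(x1, x2)\<leftarrow>coprod K x. u (counit K x1) (f x2)) = f x"
proof -
  have "f (\<Sum>(x1, x2)\<leftarrow>coprod K x. smult K (counit K x1) x2) = f x" by (simp add: counit_left)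
  then show ?thesis by (simp add: split_def linear_sum_list[OF f] linearD[OF f])
qed

lemma sum_counit_right:
  assumes f: "Vector_Spaces.linear (smult K) u f"
  shows "(\<Sum>(x1, x2)\<leftarrow>coprod K x. u (counit K x2) (f x1)) = f x"
proof -
  have "f (\<Sum>(x1, x2)\<leftarrow>coprod K x. smult K (counit K x2) x1) = f x" by (simp add: counit_right)
  then show ?thesis by (simp add: split_def linear_sum_list[OF f] linearD[OF f])
qed

text \<open>The usual convolution argument: the counit of a leg of \<open>y\<close> is opened as
  \<open>z1 * antipode K z2\<close>, and coassociativity regroups the legs so that the antipode
  identity for a product of \<open>x\<close> with a leg of \<open>y\<close> appears. Degree zero
  keeps the coproduct of this product free of signs.\<close>

lemma antipode_mult_right:
  assumes x: "x \<in> component K 0" and y: "y \<in> component K 0"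
  shows "(\<Sum>(x1, x2)\<leftarrow>coprod K x. antipode K (x1 * y) * x2) = smult K (counit K x) (antipode K y)"
proof -
  have "(\<Sum>(x1, x2)\<leftarrow>coprod K x. antipode K (x1 * y) * x2)
      = (\<Sum>(x1, x2)\<leftarrow>coprod K x. \<Sum>(y1, y2)\<leftarrow>coprod K y. \<Sum>(z1, z2)\<leftarrow>coprod K y2. antipode K (x1 * y1) * x2 * (z1 * antipode K z2))"
  proof (rule sum_list_cong_set, clarify)
    fix x1 x2
    have "(\<Sum>(y1, y2)\<leftarrow>coprod K y. smult K (counit K y2) (antipode K (x1 * y1) * x2)) = antipode K (x1 * y) * x2"
      by (rule sum_counit_right) (auto intro!: linearI[OF vs vs] simp: antipode_simps)
    moreover have "(\<Sum>(z1, z2)\<leftarrow>coprod K y2. antipode K (x1 * y1) * x2 * (z1 * antipode K z2))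
        = smult K (counit K y2) (antipode K (x1 * y1) * x2)" for y1 y2
      using antipode_right[of y2] by (simp add: split_def sum_list_const_mult V.scale_mult_right[symmetric])
    ultimately show "antipode K (x1 * y) * x2 = (\<Sum>(y1, y2)\<leftarrow>coprod K y. \<Sum>(z1, z2)\<leftarrow>coprod K y2. antipode K (x1 * y1) * x2 * (z1 * antipode K z2))"
      by simp
  qed
  also have "\<dots> = (\<Sum>(x1, x2)\<leftarrow>coprod K x. \<Sum>(y1, y2)\<leftarrow>coprod K y. \<Sum>(z1, z2)\<leftarrow>coprod K y1. antipode K (x1 * z1) * x2 * (z2 * antipode K y2))"
    by (intro sum_list_cong_set, clarify, rule coassoc_sum[symmetric, OF vs])
       (auto intro!: linearI[OF vs vs] simp: antipode_simps)
  also have "\<dots> = (\<Sum>(y1, y2)\<leftarrow>coprod K y. (\<Sum>(x1, x2)\<leftarrow>coprod K x. \<Sum>(z1, z2)\<leftarrow>coprod K y1. antipode K (x1 * z1) * (x2 * z2)) * antipode K y2)"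
    unfolding split_def
    by (subst sum_list_swap) (simp add: sum_list_mult_const[symmetric] mult.assoc)
  also have "\<dots> = (\<Sum>(y1, y2)\<leftarrow>coprod K y. smult K (counit K x * counit K y1) (antipode K y2))"
  proof (rule sum_list_cong_set, clarify)
    fix y1 y2 assume "(y1, y2) \<in> set (coprod K y)"
    then have y1: "y1 \<in> component K 0" using coprod_degree0[OF y] by blast
    have "(\<Sum>(x1, x2)\<leftarrow>coprod K x. \<Sum>(z1, z2)\<leftarrow>coprod K y1. antipode K (x1 * z1) * (x2 * z2))
        = (\<Sum>(z1, z2)\<leftarrow>coprod K (x * y1). antipode K z1 * z2)"
      by (rule coprod_mult_degree0[OF x y1 vs, where B = "\<lambda>u v. antipode K u * v", symmetric]) (auto intro!: linearI[OF vs vs] simp: antipode_simps)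
    then show "(\<Sum>(x1, x2)\<leftarrow>coprod K x. \<Sum>(z1, z2)\<leftarrow>coprod K y1. antipode K (x1 * z1) * (x2 * z2)) * antipode K y2
        = smult K (counit K x * counit K y1) (antipode K y2)"
      by (simp add: antipode_left counit_mult V.scale_mult_left[symmetric])
  qed
  also have "\<dots> = smult K (counit K x) (\<Sum>(y1, y2)\<leftarrow>coprod K y. smult K (counit K y1) (antipode K y2))"
    by (simp add: split_def linear_sum_list[OF V.linear_scale_self])
  also have "\<dots> = smult K (counit K x) (antipode K y)"
    by (simp add: sum_counit_left[OF antipode_linear])
  finally show ?thesis .
qed

text \<open>Opening the counit of \<open>x\<close> as \<open>z1 * antipode K z2\<close> and
  regrouping produces the sum of \<open>antipode_mult_right\<close>, followed by the antipode of the
  remaining leg of \<open>x\<close>.\<close>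

lemma antipode_mult:
  assumes x: "x \<in> component K 0" and y: "y \<in> component K 0"
  shows "antipode K (x * y) = antipode K y * antipode K x"
proof -
  have "antipode K (x * y) = (\<Sum>(x1, x2)\<leftarrow>coprod K x. smult K (counit K x2) (antipode K (x1 * y)))"
    by (rule sum_counit_right[symmetric]) (auto intro!: linearI[OF vs vs] simp: antipode_simps)
  also have "\<dots> = (\<Sum>(x1, x2)\<leftarrow>coprod K x. \<Sum>(z1, z2)\<leftarrow>coprod K x2. antipode K (x1 * y) * (z1 * antipode K z2))"
    using antipode_right by (simp add: split_def sum_list_const_mult V.scale_mult_right[symmetric])
  also have "\<dots> = (\<Sum>(x1, x2)\<leftarrow>coprod K x. \<Sum>(z1, z2)\<leftarrow>coprod K x1. antipode K (z1 * y) * (z2 * antipode K x2))"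
    by (rule coassoc_sum[symmetric, OF vs]) (auto intro!: linearI[OF vs vs] simp: antipode_simps)
  also have "\<dots> = (\<Sum>(x1, x2)\<leftarrow>coprod K x. smult K (counit K x1) (antipode K y * antipode K x2))"
  proof (rule sum_list_cong_set, clarify)
    fix x1 x2 assume "(x1, x2) \<in> set (coprod K x)"
    then have x1: "x1 \<in> component K 0" using coprod_degree0[OF x] by blast
    show "(\<Sum>(z1, z2)\<leftarrow>coprod K x1. antipode K (z1 * y) * (z2 * antipode K x2))
        = smult K (counit K x1) (antipode K y * antipode K x2)"
      using antipode_mult_right[OF x1 y]
      by (simp add: split_def sum_list_mult_const mult.assoc[symmetric] V.scale_mult_left)
  qed
  also have "\<dots> = antipode K y * antipode K x"
    by (rule sum_counit_left) (auto intro!: linearI[OF vs vs] simp: antipode_simps)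
  finally show ?thesis .
qed

lemma antipode_inv [simp]: "antipode K (inv (antipode K) x) = x"
  by (rule surj_f_inv_f[OF bij_is_surj[OF antipode_bij]])

lemma antipode_eq_iff: "antipode K x = antipode K y \<longleftrightarrow> x = y"
  using bij_is_inj[OF antipode_bij] by (simp add: inj_eq)

lemma inv_antipode_linear: "Vector_Spaces.linear (smult K) (smult K) (inv (antipode K))"
  by (rule linearI[OF vs vs]; subst antipode_eq_iff[symmetric]) (simp_all add: antipode_simps)

text \<open>The antipodes of the homogeneous components of the preimage form a decomposition of
  \<open>x\<close>; uniqueness and injectivity leave only the component of degree
  \<open>n\<close>.\<close>

lemma inv_antipode_comp:
  assumes x: "x \<in> component K n"
  shows "inv (antipode K) x \<in> component K n"
proof -
  obtain c F where c: "\<And>n. c n \<in> component K n" "finite F" "\<And>n. n \<notin> F \<Longrightarrow> c n = 0" "inv (antipode K) x = (\<Sum>n\<in>F. c n)"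
    using decomposition_exists[of "inv (antipode K) x"] by blast
  have "(\<lambda>k. antipode K (c k)) = (\<lambda>k. if k = n then x else 0)"
  proof (rule decomposition_unique[of _ _ "insert n F"])
    have "x = antipode K (\<Sum>n\<in>F. c n)" using c(4) by (metis antipode_inv)
    also have "\<dots> = (\<Sum>k\<in>F. antipode K (c k))" by (rule linear_sum[OF antipode_linear])
    also have "\<dots> = (\<Sum>k\<in>insert n F. antipode K (c k))"
      by (rule sum.mono_neutral_left) (use c in \<open>auto simp: antipode_simps\<close>)
    finally show "(\<Sum>k\<in>insert n F. antipode K (c k)) = (\<Sum>k\<in>insert n F. if k = n then x else 0)"
      using c(2) by simp
  qed (use c x antipode_comp in \<open>auto simp: antipode_simps\<close>)
  then have "antipode K (c k) = 0" if "k \<noteq> n" for k using that by (simp add: fun_eq_iff)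
  then have ck: "c k = 0" if "k \<noteq> n" for k
    using that antipode_eq_iff[of "c k" 0] by (simp add: linearD(3)[OF antipode_linear])
  have "c k \<in> component K n" for k using c(1)[of k] ck[of k] by (cases "k = n") auto
  then have "(\<Sum>n\<in>F. c n) \<in> component K n" by (intro comp_sum)
  then show ?thesis using c(4) by simp
qed

text \<open>Applying the antipode reverses the product and gives the ordinary antipode identity;
  hence the flipped order of the two Sweedler legs.\<close>

lemma inv_antipode_left:
  assumes x: "x \<in> component K 0"
  shows "(\<Sum>(x1, x2)\<leftarrow>coprod K x. inv (antipode K) x2 * x1) = smult K (counit K x) 1"
proof -
  have "antipode K (\<Sum>(x1, x2)\<leftarrow>coprod K x. inv (antipode K) x2 * x1) = (\<Sum>(x1, x2)\<leftarrow>coprod K x. antipode K x1 * x2)"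
    unfolding linear_sum_list[OF antipode_linear] split_def
    by (intro sum_list_cong_set, clarify, frule coprod_degree0(1)[OF x], drule coprod_degree0(2)[OF x])
       (simp add: antipode_mult inv_antipode_comp)
  also have "\<dots> = antipode K (smult K (counit K x) 1)" by (simp add: antipode_left antipode_simps)
  finally show ?thesis by (simp add: antipode_eq_iff)
qed

lemma inv_antipode_right:
  assumes x: "x \<in> component K 0"
  shows "(\<Sum>(x1, x2)\<leftarrow>coprod K x. x2 * inv (antipode K) x1) = smult K (counit K x) 1"
proof -
  have "antipode K (\<Sum>(x1, x2)\<leftarrow>coprod K x. x2 * inv (antipode K) x1) = (\<Sum>(x1, x2)\<leftarrow>coprod K x. x1 * antipode K x2)"
    unfolding linear_sum_list[OF antipode_linear] split_def
    by (intro sum_list_cong_set, clarify, frule coprod_degree0(1)[OF x], drule coprod_degree0(2)[OF x])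
       (simp add: antipode_mult inv_antipode_comp)
  also have "\<dots> = antipode K (smult K (counit K x) 1)" by (simp add: antipode_right antipode_simps)
  finally show ?thesis by (simp add: antipode_eq_iff)
qed

end

section \<open>Braid operators on indexed families\<close>

lemma finite_multi [simp]: "finite (multi n :: 'n::finite list set)"
  using finite_lists_length_eq[of "UNIV :: 'n set" n] by (simp add: multi_def)

lemma multi_0 [simp]: "multi 0 = {[]}"
  by (auto simp: multi_def)

lemma in_multi_iff: "I \<in> multi n \<longleftrightarrow> length I = n"
  by (simp add: multi_def)

lemma sum_multi_Suc:
  fixes f :: "'n::finite list \<Rightarrow> 'a::comm_monoid_add"
  shows "(\<Sum>I\<in>multi (Suc n). f I) = (\<Sum>i\<in>UNIV. \<Sum>I\<in>multi n. f (i # I))"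
proof -
  have "(\<Sum>I\<in>multi (Suc n). f I) = (\<Sum>(i, I)\<in>UNIV \<times> multi n. f (i # I))"
    by (rule sum.reindex_bij_witness[of _ "\<lambda>(i, I). i # I" "\<lambda>I. (hd I, tl I)"])
       (auto simp: multi_def length_Suc_conv)
  then show ?thesis by (simp add: sum.cartesian_product)
qed

text \<open>\<open>braid_op s \<sigma> p\<close> is \<open>\<sigma>\<close> acting in the spaces \<open>p + 1, p + 2\<close>, i.e. on the list positions
  \<open>p, p + 1\<close>, of a family with values in a vector space.\<close>

definition braid_op :: "('k::field \<Rightarrow> 'w::ab_group_add \<Rightarrow> 'w) \<Rightarrow> ('n::finite \<Rightarrow> 'n \<Rightarrow> 'n \<Rightarrow> 'n \<Rightarrow> 'k) \<Rightarrow>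
    nat \<Rightarrow> ('n list \<Rightarrow> 'w) \<Rightarrow> 'n list \<Rightarrow> 'w" where
  "braid_op s \<sigma> p v I =
     (if Suc p < length I
      then \<Sum>a\<in>UNIV. \<Sum>b\<in>UNIV. s (\<sigma> a b (I ! p) (I ! Suc p)) (v (I[p := a, Suc p := b])) else 0)"

text \<open>This is \<sigma> with index p+1 <- 1. The factor in spaces 1, 2 is innermost, since the
  last factor of a matrix product acts first on a family.\<close>

primrec down_op :: "('k::field \<Rightarrow> 'w::ab_group_add \<Rightarrow> 'w) \<Rightarrow> ('n::finite \<Rightarrow> 'n \<Rightarrow> 'n \<Rightarrow> 'n \<Rightarrow> 'k) \<Rightarrow>
    nat \<Rightarrow> ('n list \<Rightarrow> 'w) \<Rightarrow> 'n list \<Rightarrow> 'w" where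
  "down_op s \<sigma> 0 v = v"
| "down_op s \<sigma> (Suc p) v = braid_op s \<sigma> p (down_op s \<sigma> p v)"

text \<open>This is \<sigma> with index j+1 -> n+1; \<open>j\<close> and \<open>n\<close> are list
  positions counted from 0.\<close>

primrec up_op :: "('k::field \<Rightarrow> 'w::ab_group_add \<Rightarrow> 'w) \<Rightarrow> ('n::finite \<Rightarrow> 'n \<Rightarrow> 'n \<Rightarrow> 'n \<Rightarrow> 'k) \<Rightarrow>
    nat \<Rightarrow> nat \<Rightarrow> ('n list \<Rightarrow> 'w) \<Rightarrow> 'n list \<Rightarrow> 'w" where
  "up_op s \<sigma> j 0 v = v"
| "up_op s \<sigma> j (Suc n) v = (if n < j then v else up_op s \<sigma> j n (braid_op s \<sigma> n v))"

text \<open>This is A with index k+1 -> n. The summand \<open>j = n\<close> is the identity and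
  absorbs the leading 1 of the recursion.\<close>

primrec antisym_op :: "('k::field \<Rightarrow> 'w::ab_group_add \<Rightarrow> 'w) \<Rightarrow> ('n::finite \<Rightarrow> 'n \<Rightarrow> 'n \<Rightarrow> 'n \<Rightarrow> 'k) \<Rightarrow>
    nat \<Rightarrow> nat \<Rightarrow> ('n list \<Rightarrow> 'w) \<Rightarrow> 'n list \<Rightarrow> 'w" where
  "antisym_op s \<sigma> k 0 v = v"
| "antisym_op s \<sigma> k (Suc n) v =
     (if n < k then v
      else (\<lambda>I. \<Sum>j=k..n. s ((-1) ^ (n - j)) (up_op s \<sigma> j n (antisym_op s \<sigma> k n v) I)))"

text \<open>The left factor in the second recursion for A, the one with the \<sigma> with index k <-
  1, where k = p + 1.\<close>

definition shuffle_op :: "('k::field \<Rightarrow> 'w::ab_group_add \<Rightarrow> 'w) \<Rightarrow> ('n::finite \<Rightarrow> 'n \<Rightarrow> 'n \<Rightarrow> 'n \<Rightarrow> 'k) \<Rightarrow>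
    nat \<Rightarrow> ('n list \<Rightarrow> 'w) \<Rightarrow> 'n list \<Rightarrow> 'w" where
  "shuffle_op s \<sigma> n v I = (\<Sum>p<n. s ((-1) ^ p) (down_op s \<sigma> p v I))"

text \<open>The operator only forms linear combinations of values at lists of equal length, so it
  commutes with linear maps applied to the values. The sum over \<open>S\<close> allows an expansion
  into several families; most uses pull a fixed multiplication or a constant vector out of an
  operator.\<close>

lemma braid_op_natural:
  assumes f: "\<And>j. j \<in> S \<Longrightarrow> Vector_Spaces.linear s' s (f j)" and s: "vector_space s"
    and v: "\<And>I. length I = n \<Longrightarrow> v I = (\<Sum>j\<in>S. f j (u j I))" and I: "length I = n"
  shows "braid_op s \<sigma> p v I = (\<Sum>j\<in>S. f j (braid_op s' \<sigma> p (u j) I))"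
proof (cases "Suc p < length I")
  case True
  interpret vector_space s by fact
  have "braid_op s \<sigma> p v I = (\<Sum>a\<in>UNIV. \<Sum>b\<in>UNIV. \<Sum>j\<in>S. s (\<sigma> a b (I ! p) (I ! Suc p)) (f j (u j (I[p := a, Suc p := b]))))"
    using True I by (simp add: braid_op_def v scale_sum_right)
  also have "\<dots> = (\<Sum>a\<in>UNIV. \<Sum>j\<in>S. \<Sum>b\<in>UNIV. s (\<sigma> a b (I ! p) (I ! Suc p)) (f j (u j (I[p := a, Suc p := b]))))"
    by (intro sum.cong refl sum.swap)
  also have "\<dots> = (\<Sum>j\<in>S. \<Sum>a\<in>UNIV. \<Sum>b\<in>UNIV. s (\<sigma> a b (I ! p) (I ! Suc p)) (f j (u j (I[p := a, Suc p := b]))))"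
    by (rule sum.swap)
  also have "\<dots> = (\<Sum>j\<in>S. f j (braid_op s' \<sigma> p (u j) I))"
    using True by (intro sum.cong refl) (simp add: braid_op_def linear_sum[OF f] linearD(2)[OF f])
  finally show ?thesis .
next
  case False
  then show ?thesis by (simp add: braid_op_def linearD(3)[OF f])
qed

lemma down_op_natural:
  assumes f: "\<And>j. j \<in> S \<Longrightarrow> Vector_Spaces.linear s' s (f j)" and s: "vector_space s"
    and v: "\<And>I. length I = n \<Longrightarrow> v I = (\<Sum>j\<in>S. f j (u j I))" and I: "length I = n"
  shows "down_op s \<sigma> p v I = (\<Sum>j\<in>S. f j (down_op s' \<sigma> p (u j) I))"
  using I
proof (induction p arbitrary: I)
  case (Suc p)
  show ?case unfolding down_op.simps by (rule braid_op_natural[OF f s Suc.IH Suc.prems])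
qed (simp add: v)

lemma up_op_natural:
  assumes f: "\<And>j. j \<in> S \<Longrightarrow> Vector_Spaces.linear s' s (f j)" and s: "vector_space s"
    and v: "\<And>I. length I = n \<Longrightarrow> v I = (\<Sum>j\<in>S. f j (u j I))" and I: "length I = n"
  shows "up_op s \<sigma> k p v I = (\<Sum>j\<in>S. f j (up_op s' \<sigma> k p (u j) I))"
  using I v
proof (induction p arbitrary: I v u)
  case (Suc p)
  have b: "braid_op s \<sigma> p v L = (\<Sum>j\<in>S. f j (braid_op s' \<sigma> p (u j) L))" if "length L = n" for L
    by (rule braid_op_natural[OF f s Suc.prems(2) that])
  show ?case
    using Suc.IH[OF Suc.prems(1) b] Suc.prems by simp
qed simp

lemma shuffle_op_natural:
  assumes f: "\<And>j. j \<in> S \<Longrightarrow> Vector_Spaces.linear s' s (f j)" and s: "vector_space s"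
    and v: "\<And>I. length I = n \<Longrightarrow> v I = (\<Sum>j\<in>S. f j (u j I))" and I: "length I = n"
  shows "shuffle_op s \<sigma> p v I = (\<Sum>j\<in>S. f j (shuffle_op s' \<sigma> p (u j) I))"
proof -
  interpret vector_space s by fact
  have d: "down_op s \<sigma> q v I = (\<Sum>j\<in>S. f j (down_op s' \<sigma> q (u j) I))" for q
    by (rule down_op_natural[OF f s v I])
  have "shuffle_op s \<sigma> p v I = (\<Sum>q<p. \<Sum>j\<in>S. f j (s' ((-1) ^ q) (down_op s' \<sigma> q (u j) I)))"
    unfolding shuffle_op_def d
    by (intro sum.cong refl) (simp add: scale_sum_right linearD(2)[OF f])
  also have "\<dots> = (\<Sum>j\<in>S. f j (shuffle_op s' \<sigma> p (u j) I))"
    by (subst sum.swap) (simp add: shuffle_op_def linear_sum[OF f])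
  finally show ?thesis .
qed

lemma up_op_cong:
  assumes s: "vector_space s" and v: "\<And>I. length I = n \<Longrightarrow> v I = w I" and I: "length I = n"
  shows "up_op s \<sigma> k p v I = up_op s \<sigma> k p w I"
  using up_op_natural[of "{()}" s s "\<lambda>_ x. x" n v "\<lambda>_. w"] linearI[OF s s, of "\<lambda>x. x"] assms by simp

lemma braid_op_cong:
  assumes s: "vector_space s" and v: "\<And>I. length I = n \<Longrightarrow> v I = w I" and I: "length I = n"
  shows "braid_op s \<sigma> p v I = braid_op s \<sigma> p w I"
  using braid_op_natural[of "{()}" s s "\<lambda>_ x. x" n v "\<lambda>_. w"] linearI[OF s s, of "\<lambda>x. x"] assms by simp

lemma down_op_cong:
  assumes s: "vector_space s" and v: "\<And>I. length I = n \<Longrightarrow> v I = w I" and I: "length I = n"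
  shows "down_op s \<sigma> p v I = down_op s \<sigma> p w I"
  using down_op_natural[of "{()}" s s "\<lambda>_ x. x" n v "\<lambda>_. w"] linearI[OF s s, of "\<lambda>x. x"] assms by simp

lemma shuffle_op_cong:
  assumes s: "vector_space s" and v: "\<And>I. length I = n \<Longrightarrow> v I = w I" and I: "length I = n"
  shows "shuffle_op s \<sigma> p v I = shuffle_op s \<sigma> p w I"
  using down_op_cong[OF assms] by (simp add: shuffle_op_def)

lemma up_op_trivial [simp]: "n \<le> j \<Longrightarrow> up_op s \<sigma> j n v = v"
  by (cases n) auto

lemma antisym_op_trivial [simp]: "n \<le> k \<Longrightarrow> antisym_op s \<sigma> k n v = v"
  by (cases n) auto

lemma braid_op_Suc: "braid_op s \<sigma> (Suc p) v (i # I) = braid_op s \<sigma> p (\<lambda>L. v (i # L)) I"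
  by (simp add: braid_op_def)

lemma down_op_Suc: "down_op s \<sigma> (Suc p) v (i # I) = down_op s \<sigma> p (\<lambda>L. braid_op s \<sigma> 0 v (i # L)) I"
proof (induction p arbitrary: I)
  case (Suc p)
  have eq: "(\<lambda>L. down_op s \<sigma> (Suc p) v (i # L)) = down_op s \<sigma> p (\<lambda>L. braid_op s \<sigma> 0 v (i # L))"
    by (rule ext) (rule Suc.IH)
  have "down_op s \<sigma> (Suc (Suc p)) v (i # I) = braid_op s \<sigma> p (\<lambda>L. down_op s \<sigma> (Suc p) v (i # L)) I"
    by (simp only: down_op.simps(2)[of s \<sigma> "Suc p"] braid_op_Suc)
  also have "\<dots> = down_op s \<sigma> (Suc p) (\<lambda>L. braid_op s \<sigma> 0 v (i # L)) I"
    by (simp only: eq) simp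
  finally show ?case .
qed simp

lemma up_op_Suc: "up_op s \<sigma> (Suc j) (Suc n) v (i # I) = up_op s \<sigma> j n (\<lambda>L. v (i # L)) I"
proof (induction n arbitrary: v)
  case (Suc n)
  have eq: "(\<lambda>L. braid_op s \<sigma> (Suc n) v (i # L)) = braid_op s \<sigma> n (\<lambda>L. v (i # L))"
    by (rule ext) (rule braid_op_Suc)
  have "up_op s \<sigma> (Suc j) (Suc (Suc n)) v (i # I) =
      (if Suc n < Suc j then v (i # I) else up_op s \<sigma> (Suc j) (Suc n) (braid_op s \<sigma> (Suc n) v) (i # I))"
    by (subst up_op.simps(2)) simp
  then show ?case by (simp only: Suc.IH eq up_op.simps(2)[of s \<sigma> j n]) simp
qed simp

lemma antisym_op_Suc:
  "antisym_op s \<sigma> (Suc k) (Suc n) v (i # I) = antisym_op s \<sigma> k n (\<lambda>L. v (i # L)) I"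
proof (induction n arbitrary: I)
  case (Suc n)
  have eq: "(\<lambda>L. antisym_op s \<sigma> (Suc k) (Suc n) v (i # L)) = antisym_op s \<sigma> k n (\<lambda>L. v (i # L))"
    by (rule ext) (rule Suc.IH)
  have "antisym_op s \<sigma> (Suc k) (Suc (Suc n)) v (i # I) =
      (if Suc n < Suc k then v (i # I) else \<Sum>j=Suc k..Suc n. s ((-1) ^ (Suc n - j)) (up_op s \<sigma> j (Suc n) (antisym_op s \<sigma> (Suc k) (Suc n) v) (i # I)))"
    by (subst antisym_op.simps(2)) simp
  then show ?case
    by (simp only: sum.shift_bounds_cl_Suc_ivl up_op_Suc eq antisym_op.simps(2)[of s \<sigma> k n]) simp
qed simp

lemma braid_op_commute:
  assumes s: "vector_space s" and pq: "Suc p < q"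
  shows "braid_op s \<sigma> p (braid_op s \<sigma> q v) = braid_op s \<sigma> q (braid_op s \<sigma> p v)"
proof (rule ext)
  fix I
  interpret vector_space s by fact
  show "braid_op s \<sigma> p (braid_op s \<sigma> q v) I = braid_op s \<sigma> q (braid_op s \<sigma> p v) I"
  proof (cases "Suc q < length I")
    case True
    let ?t = "\<lambda>a b c d. s (\<sigma> a b (I ! p) (I ! Suc p) * \<sigma> c d (I ! q) (I ! Suc q))
      (v (I[p := a, Suc p := b, q := c, Suc q := d]))"
    have upd: "I[q := c, Suc q := d, p := a, Suc p := b] = I[p := a, Suc p := b, q := c, Suc q := d]" for a b c d
      by (rule nth_equalityI) (use pq True in \<open>auto simp: nth_list_update\<close>)
    have "braid_op s \<sigma> p (braid_op s \<sigma> q v) I = (\<Sum>a\<in>UNIV. \<Sum>b\<in>UNIV. \<Sum>c\<in>UNIV. \<Sum>d\<in>UNIV. ?t a b c d)"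
      using True pq by (simp add: braid_op_def scale_sum_right)
    also have "\<dots> = (\<Sum>a\<in>UNIV. \<Sum>c\<in>UNIV. \<Sum>b\<in>UNIV. \<Sum>d\<in>UNIV. ?t a b c d)"
      by (intro sum.cong refl sum.swap)
    also have "\<dots> = (\<Sum>c\<in>UNIV. \<Sum>a\<in>UNIV. \<Sum>b\<in>UNIV. \<Sum>d\<in>UNIV. ?t a b c d)"
      by (rule sum.swap)
    also have "\<dots> = (\<Sum>c\<in>UNIV. \<Sum>a\<in>UNIV. \<Sum>d\<in>UNIV. \<Sum>b\<in>UNIV. ?t a b c d)"
      by (intro sum.cong refl sum.swap)
    also have "\<dots> = (\<Sum>c\<in>UNIV. \<Sum>d\<in>UNIV. \<Sum>a\<in>UNIV. \<Sum>b\<in>UNIV. ?t a b c d)"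
      by (intro sum.cong refl sum.swap)
    also have "\<dots> = braid_op s \<sigma> q (braid_op s \<sigma> p v) I"
      using True pq by (simp add: braid_op_def scale_sum_right upd mult.commute)
    finally show ?thesis .
  next
    case False
    then show ?thesis by (simp add: braid_op_def)
  qed
qed

section \<open>Matrices acting on families, and the braid relations for families\<close>

definition tensor_app :: "('k::field \<Rightarrow> 'w::ab_group_add \<Rightarrow> 'w) \<Rightarrow> nat \<Rightarrow> ('k, 'n::finite) tensor \<Rightarrow>
    ('n list \<Rightarrow> 'w) \<Rightarrow> 'n list \<Rightarrow> 'w" where
  "tensor_app s m M v I = (\<Sum>L\<in>multi m. s (M I L) (v L))"

lemma tensor_app_tmul:
  assumes "vector_space s"
  shows "tensor_app s m (tmul n M N) v I = tensor_app s n M (tensor_app s m N v) I"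
proof -
  interpret vector_space s by fact
  have "tensor_app s m (tmul n M N) v I = (\<Sum>L\<in>multi m. \<Sum>J\<in>multi n. s (M I J * N J L) (v L))"
    by (simp add: tensor_app_def tmul_def scale_sum_left)
  also have "\<dots> = tensor_app s n M (tensor_app s m N v) I"
    by (subst sum.swap) (simp add: tensor_app_def scale_sum_right)
  finally show ?thesis .
qed

lemma tensor_app_tid:
  assumes "vector_space s" "length I = m"
  shows "tensor_app s m tid v I = v I"
proof -
  interpret vector_space s by fact
  have "tensor_app s m tid v I = (\<Sum>L\<in>multi m. if L = I then v L else 0)"
    unfolding tensor_app_def tid_def by (intro sum.cong) auto
  then show ?thesis using assms(2) by (simp add: in_multi_iff)
qed

lemma tensor_app_cong:
  "(\<And>L. length L = m \<Longrightarrow> v L = w L) \<Longrightarrow> tensor_app s m M v I = tensor_app s m M w I"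
  by (simp add: tensor_app_def in_multi_iff)

lemma tensor_app_braid_at:
  assumes "vector_space s" "length I = m" "Suc p < m"
  shows "tensor_app s m (braid_at \<sigma> (Suc p)) v I = braid_op s \<sigma> p v I"
proof -
  interpret vector_space s by fact
  let ?R = "{L \<in> multi m. \<forall>q<m. q \<noteq> p \<and> q \<noteq> Suc p \<longrightarrow> I ! q = L ! q}"
  have "tensor_app s m (braid_at \<sigma> (Suc p)) v I = (\<Sum>L\<in>?R. s (\<sigma> (L ! p) (L ! Suc p) (I ! p) (I ! Suc p)) (v L))"
    unfolding tensor_app_def
  proof (rule sum.mono_neutral_cong_right)
    show "\<forall>L\<in>multi m - ?R. s (braid_at \<sigma> (Suc p) I L) (v L) = 0"
      using assms(2) by (auto simp: braid_at_def in_multi_iff)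
  qed (use assms(2) in \<open>auto simp: braid_at_def in_multi_iff\<close>)
  also have "\<dots> = (\<Sum>(a, b)\<in>UNIV \<times> UNIV. s (\<sigma> a b (I ! p) (I ! Suc p)) (v (I[p := a, Suc p := b])))"
  proof (rule sum.reindex_bij_witness[of _ "\<lambda>(a, b). I[p := a, Suc p := b]" "\<lambda>L. (L ! p, L ! Suc p)"])
    fix L assume "L \<in> ?R"
    then show "(case (L ! p, L ! Suc p) of (a, b) \<Rightarrow> I[p := a, Suc p := b]) = L"
      using assms(2,3) by (auto simp: in_multi_iff nth_list_update intro!: nth_equalityI)
    then show "(case (L ! p, L ! Suc p) of (a, b) \<Rightarrow> s (\<sigma> a b (I ! p) (I ! Suc p)) (v (I[p := a, Suc p := b])))
        = s (\<sigma> (L ! p) (L ! Suc p) (I ! p) (I ! Suc p)) (v L)" by simp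
  qed (use assms(2,3) in \<open>auto simp: in_multi_iff\<close>)
  also have "\<dots> = braid_op s \<sigma> p v I"
    using assms(2,3) by (simp add: braid_op_def sum.cartesian_product)
  finally show ?thesis .
qed

lemma braid_op_append:
  assumes "Suc q < length J"
  shows "braid_op s \<sigma> (length P + q) v (P @ J @ S) = braid_op s \<sigma> q (\<lambda>L. v (P @ L @ S)) J"
proof -
  have "(P @ J @ S)[length P + q := a, Suc (length P + q) := b] = P @ (J[q := a, Suc q := b]) @ S" for a b
    using assms by (simp add: list_update_append)
  then show ?thesis using assms by (simp add: braid_op_def nth_append)
qed

text \<open>Both sides change only three adjacent entries, so the list is cut into
  \<open>P @ J @ S\<close> with \<open>length J = 3\<close> and the identity in three spaces is
  applied to \<open>J\<close>. On shorter lists both sides are 0 by the default value of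
  \<open>braid_op\<close>.\<close>

lemma braid_op_yang_baxter:
  assumes s: "vector_space s" and YB: "yang_baxter \<sigma>"
  shows "braid_op s \<sigma> p (braid_op s \<sigma> (Suc p) (braid_op s \<sigma> p v)) =
    braid_op s \<sigma> (Suc p) (braid_op s \<sigma> p (braid_op s \<sigma> (Suc p) v))"
proof (rule ext)
  fix I
  interpret vector_space s by fact
  show "braid_op s \<sigma> p (braid_op s \<sigma> (Suc p) (braid_op s \<sigma> p v)) I =
    braid_op s \<sigma> (Suc p) (braid_op s \<sigma> p (braid_op s \<sigma> (Suc p) v)) I"
  proof (cases "Suc (Suc p) < length I")
    case True
    define P J S where "P = take p I" and "J = take 3 (drop p I)" and "S = drop 3 (drop p I)"
    have I: "I = P @ J @ S" unfolding P_def J_def S_def by (metis append_take_drop_id)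
    have lP: "length P = p" and lJ: "length J = 3" using True by (auto simp: P_def J_def)
    define w where "w = (\<lambda>L. v (P @ L @ S))"
    have step: "braid_op s \<sigma> (p + q) u (P @ L @ S) = braid_op s \<sigma> q u' L"
      if "q < 2" "length L = 3" "\<And>L. length L = 3 \<Longrightarrow> u (P @ L @ S) = u' L" for q u u' L
      using that(1,2) lP braid_op_append[where q = q and J = L and P = P and S = S and s = s and \<sigma> = \<sigma> and v = u] braid_op_cong[OF s that(3) that(2)] by simp
    have l: "braid_op s \<sigma> (p + 0) (braid_op s \<sigma> (p + 1) (braid_op s \<sigma> (p + 0) v)) I
        = braid_op s \<sigma> 0 (braid_op s \<sigma> 1 (braid_op s \<sigma> 0 w)) J"
      unfolding I by (rule step, simp, rule lJ, rule step, simp, assumption, rule step) (auto simp: w_def)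
    have r: "braid_op s \<sigma> (p + 1) (braid_op s \<sigma> (p + 0) (braid_op s \<sigma> (p + 1) v)) I
        = braid_op s \<sigma> 1 (braid_op s \<sigma> 0 (braid_op s \<sigma> 1 w)) J"
      unfolding I by (rule step, simp, rule lJ, rule step, simp, assumption, rule step) (auto simp: w_def)
    have t: "tensor_app s 3 (tprod 3 [braid_at \<sigma> (Suc a), braid_at \<sigma> (Suc b), braid_at \<sigma> (Suc c)]) w J
        = braid_op s \<sigma> a (braid_op s \<sigma> b (braid_op s \<sigma> c w)) J" if "a < 2" "b < 2" "c < 2" for a b c
    proof -
      have c: "tensor_app s 3 (tmul 3 (braid_at \<sigma> (Suc c)) tid) w L = braid_op s \<sigma> c w L" if "length L = 3" for L
        unfolding tensor_app_tmul[OF s] using \<open>c < 2\<close> that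
        by (subst tensor_app_braid_at[OF s]) (auto intro!: braid_op_cong[OF s] tensor_app_tid[OF s])
      have b: "tensor_app s 3 (tmul 3 (braid_at \<sigma> (Suc b)) (tmul 3 (braid_at \<sigma> (Suc c)) tid)) w L
          = braid_op s \<sigma> b (braid_op s \<sigma> c w) L" if "length L = 3" for L
        unfolding tensor_app_tmul[OF s, of 3 3 "braid_at \<sigma> (Suc b)"] using \<open>b < 2\<close> that
        by (subst tensor_app_braid_at[OF s]) (auto intro!: braid_op_cong[OF s] c)
      show ?thesis
        unfolding tprod_def using \<open>a < 2\<close> lJ
        by (simp add: tensor_app_tmul[OF s, of 3 3 "braid_at \<sigma> (Suc a)"] tensor_app_braid_at[OF s])
           (auto intro!: braid_op_cong[OF s, of 3] b)
    qed
    have "tensor_app s 3 (tprod 3 [braid_at \<sigma> 1, braid_at \<sigma> 2, braid_at \<sigma> 1]) w J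
        = tensor_app s 3 (tprod 3 [braid_at \<sigma> 2, braid_at \<sigma> 1, braid_at \<sigma> 2]) w J"
      unfolding tensor_app_def using YB lJ by (intro sum.cong) (auto simp: yang_baxter_def in_multi_iff)
    then show ?thesis using t[of 0 1 0] t[of 1 0 1] l r by (simp add: numeral_2_eq_2)
  next
    case False
    then show ?thesis by (simp add: braid_op_def)
  qed
qed

context
  fixes s :: "'k::field \<Rightarrow> 'w::ab_group_add \<Rightarrow> 'w" and \<sigma> :: "'n::finite \<Rightarrow> 'n \<Rightarrow> 'n \<Rightarrow> 'n \<Rightarrow> 'k"
  assumes s: "vector_space s" and YB: "yang_baxter \<sigma>"
begin

interpretation vector_space s by (rule s)

section \<open>Braid identities and the agreement of the two recursions for the
  antisymmetrizer\<close>

lemma down_braid_commute: "p < q \<Longrightarrow>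
  down_op s \<sigma> p (braid_op s \<sigma> q v) = braid_op s \<sigma> q (down_op s \<sigma> p v)"
proof (induction p)
  case (Suc p)
  then show ?case using braid_op_commute[OF s, of p q \<sigma> "down_op s \<sigma> p v"] by simp
qed simp

lemma up_braid_commute: "n < q \<Longrightarrow>
  up_op s \<sigma> k n (braid_op s \<sigma> q v) = braid_op s \<sigma> q (up_op s \<sigma> k n v)"
proof (induction n arbitrary: v)
  case (Suc n)
  then show ?case using braid_op_commute[OF s, of n q \<sigma> v] by simp
qed simp

lemma up_down_commute: "j < k \<Longrightarrow> up_op s \<sigma> k n (down_op s \<sigma> j v) = down_op s \<sigma> j (up_op s \<sigma> k n v)"
proof (induction n arbitrary: v)
  case (Suc n)
  show ?case
  proof (cases "n < k")
    case False
    then show ?thesis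
      using Suc.IH[OF Suc.prems, of "braid_op s \<sigma> n v"] Suc.prems down_braid_commute[of j n v] by simp
  qed simp
qed simp

lemma up_op_eq: "k < n \<Longrightarrow> up_op s \<sigma> k n v = braid_op s \<sigma> k (up_op s \<sigma> (Suc k) n v)"
proof (induction n arbitrary: v)
  case (Suc n)
  show ?case
  proof (cases "k = n")
    case False
    then show ?thesis using Suc by auto
  qed simp
qed simp

text \<open>The generator commutes with the factors to the right of position \<open>Suc i\<close>;
  Yang-Baxter then turns it into its right neighbour, which commutes with the remaining factors on
  the left.\<close>

lemma up_braid: "k \<le> i \<Longrightarrow> Suc i < n \<Longrightarrow>
  up_op s \<sigma> k n (braid_op s \<sigma> i v) = braid_op s \<sigma> (Suc i) (up_op s \<sigma> k n v)"
proof (induction n arbitrary: v)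
  case (Suc n)
  show ?case
  proof (cases "n = Suc i")
    case True
    then show ?thesis
      using Suc.prems braid_op_yang_baxter[OF s YB, of i v] up_braid_commute[of i "Suc i" k] by simp
  next
    case False
    then show ?thesis
      using Suc.prems Suc.IH[of "braid_op s \<sigma> n v"] braid_op_commute[OF s, of i n \<sigma> v] by simp
  qed
qed simp

text \<open>Induction on \<open>j\<close>. At \<open>j = k\<close> the first factor of the upward
  product extends the downward one; beyond that, \<open>up_braid\<close> shifts each further
  generator one place to the right.\<close>

lemma up_down_eq:
  assumes "k \<le> j" "j < n"
  shows "up_op s \<sigma> k n (down_op s \<sigma> j v) = down_op s \<sigma> (Suc j) (up_op s \<sigma> (Suc k) n v)"
  using assms
proof (induction j)
  case 0
  then show ?case using up_op_eq[of k n v] by simp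
next
  case (Suc j)
  show ?case
  proof (cases "k = Suc j")
    case True
    then have "up_op s \<sigma> k n (down_op s \<sigma> (Suc j) v) = braid_op s \<sigma> k (down_op s \<sigma> (Suc j) (up_op s \<sigma> (Suc k) n v))"
      using Suc.prems up_op_eq[of k n "down_op s \<sigma> (Suc j) v"] up_down_commute[of "Suc j" "Suc k" n v] by simp
    then show ?thesis using True by simp
  next
    case False
    then have "up_op s \<sigma> k n (down_op s \<sigma> (Suc j) v) = braid_op s \<sigma> (Suc j) (up_op s \<sigma> k n (down_op s \<sigma> j v))"
      using Suc.prems up_braid[of k j n] by simp
    then show ?thesis using False Suc by simp
  qed
qed

lemma up_op_sum:
  "up_op s \<sigma> k p (\<lambda>I. \<Sum>j\<in>S. s (c j) (u j I)) I = (\<Sum>j\<in>S. s (c j) (up_op s \<sigma> k p (u j) I))"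
  by (rule up_op_natural[OF linear_scale_self s, where n = "length I"]) auto

lemma down_op_sum:
  "down_op s \<sigma> p (\<lambda>I. \<Sum>j\<in>S. s (c j) (u j I)) I = (\<Sum>j\<in>S. s (c j) (down_op s \<sigma> p (u j) I))"
  by (rule down_op_natural[OF linear_scale_self s, where n = "length I"]) auto

text \<open>Commuting every upward product through every downward one only renumbers the double sum:
  a pair with \<open>k \<le> j\<close> becomes (j+1, k+1) with unchanged sign, the other pairs keep
  their indices.\<close>

lemma up_shuffle_eq:
  "(\<Sum>k=0..n. s ((-1) ^ (n - k)) (up_op s \<sigma> k n (shuffle_op s \<sigma> n w) I)) =
   shuffle_op s \<sigma> (Suc n) (\<lambda>I. \<Sum>k=1..n. s ((-1) ^ (n - k)) (up_op s \<sigma> k n w I)) I"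
proof -
  define t where "t j k = s ((-1) ^ (n - k) * (-1) ^ j) (down_op s \<sigma> j (up_op s \<sigma> k n w) I)" for j k
  have "up_op s \<sigma> k n (shuffle_op s \<sigma> n w) I = (\<Sum>j<n. s ((-1) ^ j) (up_op s \<sigma> k n (down_op s \<sigma> j w) I))" for k
    unfolding up_op_sum[symmetric] shuffle_op_def ..
  then have "(\<Sum>k=0..n. s ((-1) ^ (n - k)) (up_op s \<sigma> k n (shuffle_op s \<sigma> n w) I))
      = (\<Sum>(k, j)\<in>{0..n} \<times> {..<n}. s ((-1) ^ (n - k) * (-1) ^ j) (up_op s \<sigma> k n (down_op s \<sigma> j w) I))"
    by (simp add: scale_sum_right sum.cartesian_product)
  also have "\<dots> = (\<Sum>(k, j)\<in>{0..n} \<times> {..<n}. if k \<le> j then t (Suc j) (Suc k) else t j k)"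
  proof (rule sum.cong[OF refl])
    fix x assume "x \<in> {0..n} \<times> {..<n}"
    then obtain k j where x: "x = (k, j)" and kj: "k \<in> {0..n}" "j \<in> {..<n}" by blast
    have "s ((-1) ^ (n - k) * (-1) ^ j) (up_op s \<sigma> k n (down_op s \<sigma> j w) I) = (if k \<le> j then t (Suc j) (Suc k) else t j k)"
    proof (cases "k \<le> j")
      case True
      then have "n - k = Suc (n - Suc k)" using kj by auto
      then show ?thesis using True kj up_down_eq[of k j n w] by (simp add: t_def del: down_op.simps)
    next
      case False
      then show ?thesis using up_down_commute[of j k n w] by (simp add: t_def)
    qed
    then show "(case x of (k, j) \<Rightarrow> s ((-1) ^ (n - k) * (-1) ^ j) (up_op s \<sigma> k n (down_op s \<sigma> j w) I))
        = (case x of (k, j) \<Rightarrow> if k \<le> j then t (Suc j) (Suc k) else t j k)"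
      by (simp add: x)
  qed
  \<comment> \<open>The two branches fill the complementary regions \<open>k \<le> j\<close> and
    \<open>j < k\<close> of the new index set.\<close>
  also have "\<dots> = (\<Sum>(j, k)\<in>{..<Suc n} \<times> {1..n}. t j k)"
    by (rule sum.reindex_bij_witness[of _
          "\<lambda>(j, k). if k \<le> j then (k - 1, j - 1) else (k, j)"
          "\<lambda>(k, j). if k \<le> j then (Suc j, Suc k) else (j, k)"]) (auto split: if_splits)
  also have "\<dots> = shuffle_op s \<sigma> (Suc n) (\<lambda>I. \<Sum>k=1..n. s ((-1) ^ (n - k)) (up_op s \<sigma> k n w I)) I"
    unfolding shuffle_op_def down_op_sum
    by (simp add: scale_sum_right sum.cartesian_product t_def mult.commute)
  finally show ?thesis .
qed

text \<open>Induction: inserting the second form for \<open>n\<close> into the first recursion and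
  moving the shuffle outward by \<open>up_shuffle_eq\<close> gives the second form for
  \<open>n + 1\<close>.\<close>

lemma antisym_op_shuffle:
  "n > 0 \<Longrightarrow> antisym_op s \<sigma> 0 n v = shuffle_op s \<sigma> n (antisym_op s \<sigma> 1 n v)"
proof (induction n)
  case (Suc n)
  show ?case
  proof (cases "n = 0")
    case True
    then show ?thesis by (auto simp: fun_eq_iff shuffle_op_def)
  next
    case False
    show ?thesis
    proof
      fix I
      have "antisym_op s \<sigma> 0 (Suc n) v I =
          (\<Sum>k=0..n. s ((-1) ^ (n - k)) (up_op s \<sigma> k n (shuffle_op s \<sigma> n (antisym_op s \<sigma> 1 n v)) I))"
        using False Suc.IH by simp
      also have "\<dots> = shuffle_op s \<sigma> (Suc n) (antisym_op s \<sigma> 1 (Suc n) v) I"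
        unfolding up_shuffle_eq using False by simp
      finally show "antisym_op s \<sigma> 0 (Suc n) v I = shuffle_op s \<sigma> (Suc n) (antisym_op s \<sigma> 1 (Suc n) v) I" .
    qed
  qed
qed simp

section \<open>Agreement of the operators with the matrices in the statement\<close>

lemma tensor_app_braid_down:
  assumes "length I = m" "n < m"
  shows "tensor_app s m (braid_down \<sigma> m (Suc n) 1) v I = down_op s \<sigma> n v I"
  using assms
proof (induction n arbitrary: I)
  case 0
  then show ?case by (simp add: braid_down_def tprod_def tensor_app_tid[OF s])
next
  case (Suc n)
  have "braid_down \<sigma> m (Suc (Suc n)) 1 = tmul m (braid_at \<sigma> (Suc n)) (braid_down \<sigma> m (Suc n) 1)"
    by (simp add: braid_down_def tprod_def)
  then show ?case
    using Suc by (simp add: tensor_app_tmul[OF s] tensor_app_braid_at[OF s])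
      (auto intro!: braid_op_cong[OF s, of m])
qed

lemma tprod_append_app:
  "length I = m \<Longrightarrow>
   tensor_app s m (tprod m (Ms @ Ns)) v I = tensor_app s m (tprod m Ms) (tensor_app s m (tprod m Ns) v) I"
proof (induction Ms arbitrary: I)
  case Nil
  then show ?case by (simp add: tprod_def tensor_app_tid[OF s])
next
  case (Cons M Ms)
  have "tprod m ((M # Ms) @ Ns) = tmul m M (tprod m (Ms @ Ns))" "tprod m (M # Ms) = tmul m M (tprod m Ms)"
    by (simp_all add: tprod_def)
  then show ?case
    using Cons by (simp add: tensor_app_tmul[OF s]) (auto intro!: tensor_app_cong)
qed

lemma tensor_app_braid_up:
  assumes "length I = m" "n < m"
  shows "tensor_app s m (braid_up \<sigma> m (Suc k) (Suc n)) v I = up_op s \<sigma> k n v I"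
  using assms
proof (induction n arbitrary: I v)
  case 0
  then show ?case by (simp add: braid_up_def tprod_def tensor_app_tid[OF s])
next
  case (Suc n)
  show ?case
  proof (cases "n < k")
    case True
    then show ?thesis using Suc.prems by (simp add: braid_up_def tprod_def tensor_app_tid[OF s])
  next
    case False
    have "tensor_app s m (tprod m [braid_at \<sigma> (Suc n)]) v L = braid_op s \<sigma> n v L" if "length L = m" for L
      using that Suc.prems unfolding tprod_def
      by (simp add: tensor_app_tmul[OF s] tensor_app_braid_at[OF s])
         (auto intro!: braid_op_cong[OF s, of m] tensor_app_tid[OF s])
    then have "tensor_app s m (braid_up \<sigma> m (Suc k) (Suc (Suc n))) v I
        = tensor_app s m (braid_up \<sigma> m (Suc k) (Suc n)) (braid_op s \<sigma> n v) I"
      using False Suc.prems by (simp add: braid_up_def tprod_append_app) (auto intro!: tensor_app_cong)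
    then show ?thesis using False Suc by simp
  qed
qed

text \<open>Passing from spaces to list positions shifts the summation index by one and flips each
  sign, so "1 minus a sum" becomes an alternating sum whose last term is the identity.\<close>

lemma tensor_app_antisym:
  assumes "length I = m" "n \<le> m"
  shows "tensor_app s m (antisym \<sigma> m (Suc k) n) v I = antisym_op s \<sigma> k n v I"
  using assms
proof (induction n arbitrary: I)
  case 0
  then show ?case by (simp add: tensor_app_tid[OF s])
next
  case (Suc n)
  show ?case
  proof (cases "n < Suc k")
    case True
    then show ?thesis using Suc.prems by (auto simp: tensor_app_tid[OF s] less_Suc_eq)
  next
    case False
    define w where "w = antisym_op s \<sigma> k n v"
    have "tensor_app s m (antisym \<sigma> m (Suc k) (Suc n)) v I
        = tensor_app s m (\<lambda>I J. tid I J - (\<Sum>j=Suc k..n. (-1) ^ (n - j) * braid_up \<sigma> m j (Suc n) I J)) w I"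
      using False Suc by (simp add: tensor_app_tmul[OF s] w_def) (auto intro!: tensor_app_cong)
    also have "\<dots> = w I - (\<Sum>j=Suc k..n. s ((-1) ^ (n - j)) (tensor_app s m (braid_up \<sigma> m j (Suc n)) w I))"
    proof -
      have "(\<Sum>L\<in>multi m. s (\<Sum>j=Suc k..n. (-1) ^ (n - j) * braid_up \<sigma> m j (Suc n) I L) (w L))
          = (\<Sum>j=Suc k..n. s ((-1) ^ (n - j)) (tensor_app s m (braid_up \<sigma> m j (Suc n)) w I))"
        unfolding tensor_app_def scale_sum_left by (subst sum.swap) (simp add: scale_sum_right)
      then show ?thesis
        using tensor_app_tid[OF s Suc.prems(1), of w]
        by (simp add: tensor_app_def scale_left_diff_distrib sum_subtractf)
    qed
    also have "(\<Sum>j=Suc k..n. s ((-1) ^ (n - j)) (tensor_app s m (braid_up \<sigma> m j (Suc n)) w I))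
        = (\<Sum>j=k..<n. s ((-1) ^ (n - Suc j)) (up_op s \<sigma> j n w I))"
    proof -
      have "(\<Sum>j=Suc k..n. s ((-1) ^ (n - j)) (tensor_app s m (braid_up \<sigma> m j (Suc n)) w I))
          = (\<Sum>j=k..<n. s ((-1) ^ (n - Suc j)) (tensor_app s m (braid_up \<sigma> m (Suc j) (Suc n)) w I))"
        by (rule sum.reindex_bij_witness[of _ Suc "\<lambda>j. j - 1"]) auto
      then show ?thesis using Suc.prems by (simp add: tensor_app_braid_up)
    qed
    also have "w I - \<dots> = w I + (\<Sum>j=k..<n. s ((-1) ^ (n - j)) (up_op s \<sigma> j n w I))"
    proof -
      have "s ((-1) ^ (n - Suc j)) x = - s ((-1) ^ (n - j)) x" if "j < n" for j x
      proof -
        have "n - j = Suc (n - Suc j)" using that by simp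
        then show ?thesis by simp
      qed
      then show ?thesis by (simp add: sum_negf)
    qed
    also have "\<dots> = (\<Sum>j=k..n. s ((-1) ^ (n - j)) (up_op s \<sigma> j n w I))"
      using False by (simp flip: atLeastLessThanSuc_atLeastAtMost add: add.commute)
    also have "\<dots> = antisym_op s \<sigma> k (Suc n) v I" using False by (simp add: w_def)
    finally show ?thesis .
  qed
qed

end

lemma shuffle_op_Suc:
  assumes "vector_space s"
  shows "shuffle_op s \<sigma> (Suc n) v (i # I) = v (i # I) - shuffle_op s \<sigma> n (\<lambda>L. braid_op s \<sigma> 0 v (i # L)) I"
proof -
  interpret vector_space s by fact
  have "shuffle_op s \<sigma> (Suc n) v (i # I) = v (i # I) + (\<Sum>p<n. s ((-1) ^ Suc p) (down_op s \<sigma> (Suc p) v (i # I)))"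
    unfolding shuffle_op_def by (subst sum.lessThan_Suc_shift) simp
  then show ?thesis by (simp add: shuffle_op_def down_op_Suc sum_negf del: down_op.simps)
qed

lemma antisym_op_zero:
  assumes s: "vector_space s"
  shows "antisym_op s \<sigma> k p (\<lambda>_. 0) I = 0"
proof (induction p arbitrary: I)
  case (Suc p)
  interpret vector_space s by fact
  have "up_op s \<sigma> j p (antisym_op s \<sigma> k p (\<lambda>_. 0)) I = 0" for j
    using up_op_natural[of "{}" s s "\<lambda>_ x. x" "length I" _ "\<lambda>_ _. 0" I \<sigma> j p] s Suc.IH by simp
  then show ?case by simp
qed simp

lemma antisym_conv_op:
  fixes I J :: "'n::finite list"
  assumes "yang_baxter \<sigma>" "length I = m" "length J = m" "n \<le> m"
  shows "antisym \<sigma> m (Suc k) n I J = antisym_op (*) \<sigma> k n (\<lambda>L. of_bool (L = J)) I"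
proof -
  have "tensor_app (*) m (antisym \<sigma> m (Suc k) n) (\<lambda>L. of_bool (L = J)) I = (\<Sum>L\<in>multi m. if L = J then antisym \<sigma> m (Suc k) n I L else 0)"
    unfolding tensor_app_def by (intro sum.cong) auto
  then have "tensor_app (*) m (antisym \<sigma> m (Suc k) n) (\<lambda>L. of_bool (L = J)) I = antisym \<sigma> m (Suc k) n I J"
    using assms(3) by (simp add: in_multi_iff)
  then show ?thesis using tensor_app_antisym[OF vector_space_mult assms(1,2,4)] by metis
qed

lemma antisym_op_one_Cons:
  assumes "yang_baxter \<sigma>" "length I = n" "length J = n"
  shows "antisym_op (*) \<sigma> 1 (Suc n) (\<lambda>L. of_bool (L = j # J)) (i # I) = of_bool (i = j) * antisym \<sigma> n 1 n I J"
proof (cases "i = j")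
  case True
  then show ?thesis using assms antisym_conv_op[OF assms(1-3), of n 0] by (simp add: antisym_op_Suc del: antisym_op.simps)
next
  case False
  then show ?thesis using antisym_op_zero[OF vector_space_mult, of \<sigma> 0 n I] by (simp add: antisym_op_Suc del: antisym_op.simps)
qed

lemma antisym_two_Cons:
  fixes I J :: "'n::finite list"
  assumes "yang_baxter \<sigma>" "length I = n" "length J = n"
  shows "antisym \<sigma> (Suc n) 2 (Suc n) (i # I) (j # J) = of_bool (i = j) * antisym \<sigma> n 1 n I J"
  using antisym_conv_op[OF assms(1), of "i # I" "Suc n" "j # J" "Suc n" 1] antisym_op_one_Cons[OF assms, of j i] assms(2,3)
  by (simp add: numeral_2_eq_2)

text \<open>Column form of the second recursion: A with index 2 -> n+1 leaves the first index alone
  and is A with index 1 -> n on the tails.\<close>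

lemma antisym_shuffle:
  fixes I J :: "'n::finite list"
  assumes "yang_baxter \<sigma>" "length I = Suc n" "length J = n"
  shows "antisym \<sigma> (Suc n) 1 (Suc n) I (j # J) =
    shuffle_op (*) \<sigma> (Suc n) (\<lambda>L. of_bool (hd L = j) * antisym \<sigma> n 1 n (tl L) J) I"
proof -
  have "antisym \<sigma> (Suc n) 1 (Suc n) I (j # J) = antisym_op (*) \<sigma> 0 (Suc n) (\<lambda>L. of_bool (L = j # J)) I"
    using antisym_conv_op[OF assms(1), of I "Suc n" "j # J" "Suc n" 0] assms by simp
  also have "\<dots> = shuffle_op (*) \<sigma> (Suc n) (antisym_op (*) \<sigma> 1 (Suc n) (\<lambda>L. of_bool (L = j # J))) I"
    by (simp only: antisym_op_shuffle[OF vector_space_mult assms(1)])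
  also have "\<dots> = shuffle_op (*) \<sigma> (Suc n) (\<lambda>L. of_bool (hd L = j) * antisym \<sigma> n 1 n (tl L) J) I"
  proof (rule shuffle_op_cong[OF vector_space_mult _ assms(2)])
    fix L :: "'n list" assume L: "length L = Suc n"
    then obtain l L' where "L = l # L'" "length L' = n" by (cases L) auto
    then show "antisym_op (*) \<sigma> 1 (Suc n) (\<lambda>L. of_bool (L = j # J)) L = of_bool (hd L = j) * antisym \<sigma> n 1 n (tl L) J"
      using antisym_op_one_Cons[OF assms(1) _ assms(3), of L' j l] by (simp del: antisym_op.simps)
  qed
  finally show ?thesis .
qed

section \<open>Relations in the Heisenberg double\<close>

lemma sum_list_all_indices: "(\<Sum>j\<leftarrow>(all_indices :: 'n::finite list). f j) = (\<Sum>j\<in>UNIV. f j)"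
proof -
  have "\<exists>I :: 'n list. set I = UNIV \<and> distinct I"
    using finite_distinct_list[of "UNIV :: 'n set"] by auto
  then have "set (all_indices :: 'n list) = UNIV \<and> distinct (all_indices :: 'n list)"
    unfolding all_indices_def by (rule someI_ex)
  then show ?thesis by (simp add: sum_list_distinct_conv_sum_set)
qed

lemma wedge_simps [simp]: "wedge e [] = 1" "wedge e (i # I) = e i * wedge e I" "wedge e (I @ J) = wedge e I * wedge e J"
  by (simp_all add: wedge_def)

lemma sum_swap_pairs:
  "(\<Sum>m\<in>A. \<Sum>l\<in>B. \<Sum>a\<in>C. \<Sum>p\<in>D. t m l a p) = (\<Sum>a\<in>C. \<Sum>p\<in>D. \<Sum>m\<in>A. \<Sum>l\<in>B. t m l a p)"
proof -
  have "(\<Sum>m\<in>A. \<Sum>l\<in>B. \<Sum>a\<in>C. \<Sum>p\<in>D. t m l a p) = (\<Sum>m\<in>A. \<Sum>a\<in>C. \<Sum>l\<in>B. \<Sum>p\<in>D. t m l a p)"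
    by (intro sum.cong refl sum.swap)
  also have "\<dots> = (\<Sum>a\<in>C. \<Sum>m\<in>A. \<Sum>l\<in>B. \<Sum>p\<in>D. t m l a p)"
    by (rule sum.swap)
  also have "\<dots> = (\<Sum>a\<in>C. \<Sum>m\<in>A. \<Sum>p\<in>D. \<Sum>l\<in>B. t m l a p)"
    by (intro sum.cong refl sum.swap)
  also have "\<dots> = (\<Sum>a\<in>C. \<Sum>p\<in>D. \<Sum>m\<in>A. \<Sum>l\<in>B. t m l a p)"
    by (intro sum.cong refl sum.swap)
  finally show ?thesis .
qed

context exterior_heisenberg_double
begin

interpretation G: graded_hopf_algebra "ext E" by (rule ext_hopf)
interpretation D: graded_hopf_algebra "dext E" by (rule dext_hopf)
interpretation GA: algebra_over "smult (ext E)" by (rule G.algebra)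
interpretation DA: algebra_over "smult (dext E)" by (rule D.algebra)
interpretation HA: algebra_over "hsmult E" by (rule heisenberg_algebra)

lemma hs: "vector_space (hsmult E)"
  by (rule HA.vector_space_axioms)

abbreviation \<sigma> where "\<sigma> \<equiv> braid E"
abbreviation om where "om i \<equiv> emb E (form E i)"
abbreviation ga where "ga i \<equiv> demb E (dform E i)"
abbreviation fm where "fm i j \<equiv> demb E (fmat E i j)"
abbreviation vf where "vf i \<equiv> demb E (vfield E i)"
abbreviation gaw where "gaw J \<equiv> demb E (wedge (dform E) J)"
abbreviation omw where "omw J \<equiv> emb E (wedge (form E) J)"
abbreviation Omr where "Omr I \<equiv> wedge (Omega E) (rev I)"

lemma pair_linear_left: "Vector_Spaces.linear (smult (dext E)) (*) (\<lambda>\<phi>. pair E \<phi> x)"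
  and pair_linear_right: "Vector_Spaces.linear (smult (ext E)) (*) (pair E \<phi>)"
  using pair_bilinear by (auto simp: bilinear_form_def)

lemmas H_scale = HA.scale_mult_left[symmetric] HA.scale_mult_right[symmetric]

lemmas lin_simps = linearD[OF emb_linear] linearD[OF demb_linear] linearD[OF diff_linear]
  linearD[OF pair_linear_left] linearD[OF pair_linear_right]
  linearD[OF G.counit_linear] linearD[OF D.counit_linear]
  HA.scale_right_distrib HA.scale_left_distrib GA.scale_right_distrib GA.scale_left_distrib
  DA.scale_right_distrib DA.scale_left_distrib
  H_scale GA.scale_mult_left[symmetric] GA.scale_mult_right[symmetric]
  DA.scale_mult_left[symmetric] DA.scale_mult_right[symmetric]
  distrib_left distrib_right

lemma linear_mult_left: "Vector_Spaces.linear (hsmult E) (hsmult E) (\<lambda>z. w * z)"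
  and linear_mult_right: "Vector_Spaces.linear (hsmult E) (hsmult E) (\<lambda>z. z * w)"
  by (auto intro!: linearI[OF hs hs] simp: lin_simps)

lemma linear_scale_vector: "Vector_Spaces.linear (*) (hsmult E) (\<lambda>c. hsmult E c z)"
  by (auto intro!: linearI[OF vector_space_mult hs] simp: lin_simps)

lemma fmat_inv_antipode_comp: "inv (antipode (dext E)) (fmat E i j) \<in> component (dext E) 0"
  by (rule D.inv_antipode_comp[OF fmat_comp])

lemma wedge_form_comp: "wedge (form E) I \<in> component (ext E) (length I)"
  by (induction I) (use G.mult_comp[OF form_comp] G.one_comp in auto)

lemma wedge_dform_comp: "wedge (dform E) I \<in> component (dext E) (length I)"
  by (induction I) (use D.mult_comp[OF dform_comp] D.one_comp in auto)

section \<open>Wedge relations with numerical coefficients\<close>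

lemma dext_wedge_numeric:
  assumes "\<And>J. J \<in> multi n \<Longrightarrow> (\<Sum>I\<in>multi n. u I * antisym \<sigma> n 1 n I J) = 0"
  shows "(\<Sum>I\<in>multi n. hsmult E (u I) (gaw I)) = 0"
proof -
  have "(\<Sum>I\<in>multi n. smult (dext E) (u I) 1 * wedge (dform E) I) = 0"
    by (subst dext_wedge)
       (use assms in \<open>auto simp: D.comp_scale D.one_comp mult.commute DA.scale_sum_left[symmetric]\<close>)
  then have "demb E (\<Sum>I\<in>multi n. smult (dext E) (u I) 1 * wedge (dform E) I) = 0"
    by (simp add: lin_simps)
  then show ?thesis by (simp add: linear_sum[OF demb_linear] lin_simps)
qed

lemma ext_wedge_numeric:
  assumes "\<And>I. I \<in> multi n \<Longrightarrow> (\<Sum>J\<in>multi n. antisym \<sigma> n 1 n I J * s J) = 0"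
  shows "(\<Sum>J\<in>multi n. smult (ext E) (s J) (wedge (form E) J)) = 0"
proof -
  have "(\<Sum>J\<in>multi n. smult (ext E) (s J) 1 * wedge (form E) J) = 0"
    by (subst ext_wedge)
       (use assms in \<open>auto simp: G.comp_scale G.one_comp GA.scale_sum_left[symmetric]\<close>)
  then show ?thesis by (simp add: lin_simps)
qed

lemma smult_one_eq_0: "smult (ext E) c 1 = 0 \<Longrightarrow> c = 0"
  using linearD(2)[OF G.counit_linear, of c 1] by (simp add: G.counit_one lin_simps)

text \<open>A with index 1 -> 1 is the identity, so \<open>ext_wedge\<close> for
  \<open>n = 1\<close> is freeness over the degree zero part.\<close>

lemma form_independent:
  assumes "\<And>j. s j \<in> component (ext E) 0" and z: "(\<Sum>j\<in>UNIV. s j * form E j) = 0"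
  shows "s j = 0"
proof -
  have "(\<Sum>J\<in>multi 1. s (hd J) * wedge (form E) J) = 0"
    using z sum_multi_Suc[of "\<lambda>J. s (hd J) * wedge (form E) J" 0] by simp
  then have "\<forall>I\<in>multi 1. (\<Sum>J\<in>multi 1. smult (ext E) (antisym \<sigma> 1 1 1 I J) (s (hd J))) = 0"
    by (subst (asm) ext_wedge) (use assms in auto)
  then have "(\<Sum>J\<in>multi 1. smult (ext E) (antisym \<sigma> 1 1 1 [j] J) (s (hd J))) = 0"
    by (auto simp: in_multi_iff)
  moreover have "smult (ext E) (antisym \<sigma> 1 1 1 [j] [i]) (s i) = (if i = j then s i else 0)" for i
    by (simp add: tid_def)
  ultimately show ?thesis
    using sum_multi_Suc[of "\<lambda>J. smult (ext E) (antisym \<sigma> 1 1 1 [j] J) (s (hd J))" 0] by simp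
qed

section \<open>The left action of the dual and the commutation relations of the generators\<close>

lemma lact_linear_left: "Vector_Spaces.linear (smult (dext E)) (smult (ext E)) (\<lambda>\<phi>. lact E \<phi> x)"
proof -
  have "lact E (\<phi> + \<psi>) x = lact E \<phi> x + lact E \<psi> x" "lact E (smult (dext E) c \<phi>) x = smult (ext E) c (lact E \<phi> x)" for \<phi> \<psi> c
    by (simp_all add: lact_def split_def lin_simps sum_list_addf linear_sum_list[OF GA.linear_scale_self])
  then show ?thesis by (intro linearI[OF D.vs G.vs])
qed

lemma lact_comp:
  assumes "\<phi> \<in> component (dext E) 0" "x \<in> component (ext E) n"
  shows "lact E \<phi> x \<in> component (ext E) n"
  unfolding lact_def
proof (rule G.comp_sum_list, clarify)
  fix x1 x2 assume "(x1, x2) \<in> set (coprod (ext E) x)"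
  then obtain p q where pq: "p + q = n" "x1 \<in> component (ext E) p" "x2 \<in> component (ext E) q"
    using G.coprod_comp[OF assms(2)] by blast
  show "smult (ext E) (pair E \<phi> x2) x1 \<in> component (ext E) n"
    using pq pair_comp[OF assms(1) pq(3)] G.comp_scale by (cases "q = 0") auto
qed

lemma lact_one_left: "lact E 1 x = x"
  by (simp add: lact_def pair_one_left G.counit_right)

lemma lact_one_right: "lact E \<phi> 1 = smult (ext E) (pair E \<phi> 1) 1"
proof -
  have "lact E \<phi> 1 = (\<Sum>(x1, x2)\<leftarrow>[(1, 1)]. smult (ext E) (pair E \<phi> x2) x1)"
    unfolding lact_def
    by (rule tensor_eq_sum[OF G.coprod_one G.vs])
       (auto intro!: linearI[OF G.vs G.vs] simp: lin_simps mult.commute)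
  then show ?thesis by simp
qed

lemma lact_degree_pos:
  assumes "\<phi> \<in> component (dext E) (Suc m)" "a \<in> component (ext E) 0"
  shows "lact E \<phi> a = 0"
proof -
  have "lact E \<phi> a = (\<Sum>(x1, x2)\<leftarrow>coprod (ext E) a. 0)"
    unfolding lact_def
    by (rule sum_list_cong_set) (auto dest!: G.coprod_degree0(2)[OF assms(2)] simp: pair_comp[OF assms(1)])
  then show ?thesis by (simp add: split_def)
qed

text \<open>If one of the two elements has degree 0, so have the legs of its coproduct; all Koszul
  signs are then 1 and the inner sum is the action \<open>lact\<close>.\<close>

lemma cross_mult_degree0:
  assumes \<phi>: "\<phi> \<in> component (dext E) m" and x: "x \<in> component (ext E) n" and mn: "m = 0 \<or> n = 0"
  shows "demb E \<phi> * emb E x = (\<Sum>(\<phi>1, \<phi>2)\<leftarrow>coprod (dext E) \<phi>. emb E (lact E \<phi>1 x) * demb E \<phi>2)"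
proof -
  have "demb E \<phi> * emb E x = (\<Sum>(\<phi>1, \<phi>2)\<leftarrow>coprod (dext E) \<phi>. \<Sum>(x1, x2)\<leftarrow>coprod (ext E) x.
      hsmult E (pair E \<phi>1 x2) (emb E x1 * demb E \<phi>2))"
    unfolding cross_mult[OF \<phi> x]
  proof (intro sum_list_cong_set, clarify, intro sum_list_cong_set, clarify)
    fix \<phi>1 \<phi>2 x1 x2 assume "(\<phi>1, \<phi>2) \<in> set (coprod (dext E) \<phi>)" "(x1, x2) \<in> set (coprod (ext E) x)"
    then have "(m = 0 \<longrightarrow> deg (dext E) \<phi>1 = 0) \<and> (n = 0 \<longrightarrow> deg (ext E) x2 = 0)"
      using D.deg_degree0[OF D.coprod_degree0(1)] G.deg_degree0[OF G.coprod_degree0(2)] \<phi> x by blast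
    with mn have "deg (dext E) \<phi>1 = 0 \<or> deg (ext E) x2 = 0" by auto
    then show "hsmult E (koszul m n * koszul (deg (dext E) \<phi>1) (deg (ext E) x2) * pair E \<phi>1 x2) (emb E x1 * demb E \<phi>2)
        = hsmult E (pair E \<phi>1 x2) (emb E x1 * demb E \<phi>2)"
      using mn by (auto simp: koszul_def)
  qed
  then show ?thesis
    by (simp add: lact_def split_def linear_sum_list[OF emb_linear] sum_list_mult_const[symmetric] lin_simps)
qed

lemma cross_mult_tensor:
  assumes \<phi>: "\<phi> \<in> component (dext E) m" and x: "x \<in> component (ext E) n" and mn: "m = 0 \<or> n = 0"
    and t: "tensor_eq (smult (dext E)) (smult (dext E)) (coprod (dext E) \<phi>) t"
  shows "demb E \<phi> * emb E x = (\<Sum>(\<phi>1, \<phi>2)\<leftarrow>t. emb E (lact E \<phi>1 x) * demb E \<phi>2)"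
  unfolding cross_mult_degree0[OF \<phi> x mn]
  by (rule tensor_eq_sum[OF t hs])
     (auto intro!: linearI[OF D.vs hs] simp: lin_simps linearD[OF lact_linear_left])

lemma fmat_mult_ext:
  assumes "x \<in> component (ext E) n"
  shows "fm i j * emb E x = (\<Sum>k\<in>UNIV. emb E (lact E (fmat E i k) x) * fm k j)"
  using cross_mult_tensor[OF fmat_comp assms _ coprod_fmat] by (simp add: o_def sum_list_all_indices)

lemma vfield_mult_ext:
  assumes "x \<in> component (ext E) n"
  shows "vf i * emb E x = emb E x * vf i + (\<Sum>k\<in>UNIV. emb E (lact E (vfield E k) x) * fm k i)"
  using cross_mult_tensor[OF vfield_comp assms _ coprod_vfield] by (simp add: o_def sum_list_all_indices lact_one_left)

lemma dform_mult_degree0: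
  assumes "a \<in> component (ext E) 0"
  shows "ga i * emb E a = emb E a * ga i"
  using cross_mult_tensor[OF dform_comp assms _ coprod_dform]
  by (simp add: o_def sum_list_all_indices lact_one_left lact_degree_pos[OF dform_comp[unfolded One_nat_def] assms] lin_simps)

lemma counit_rmat_form: "(\<Sum>j\<in>UNIV. smult (ext E) (counit (ext E) (rmat E i j)) (form E j)) = form E i"
proof -
  have "(\<Sum>(x1, x2)\<leftarrow>coprod (ext E) (form E i). smult (ext E) (counit (ext E) x2) x1)
      = (\<Sum>(x1, x2)\<leftarrow>(1, form E i) # [(form E j, rmat E i j). j \<leftarrow> all_indices]. smult (ext E) (counit (ext E) x2) x1)"
    by (rule tensor_eq_sum[OF coprod_form G.vs])
       (auto intro!: linearI[OF G.vs G.vs] simp: lin_simps mult.commute)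
  then show ?thesis
    using G.counit_comp[OF form_comp] by (simp add: G.counit_right o_def sum_list_all_indices)
qed

lemma lact_form:
  assumes "\<phi> \<in> component (dext E) 0"
  shows "lact E \<phi> (form E i) = (\<Sum>j\<in>UNIV. smult (ext E) (pair E \<phi> (rmat E i j)) (form E j))"
proof -
  have "lact E \<phi> (form E i)
      = (\<Sum>(x1, x2)\<leftarrow>(1, form E i) # [(form E j, rmat E i j). j \<leftarrow> all_indices]. smult (ext E) (pair E \<phi> x2) x1)"
    unfolding lact_def
    by (rule tensor_eq_sum[OF coprod_form G.vs])
       (auto intro!: linearI[OF G.vs G.vs] simp: lin_simps mult.commute)
  then show ?thesis
    using pair_comp[OF assms form_comp] by (simp add: o_def sum_list_all_indices)
qed

lemma fmat_form: "fm i j * om k = (\<Sum>m\<in>UNIV. \<Sum>l\<in>UNIV. hsmult E (\<sigma> i k m l) (om m * fm l j))"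
proof -
  have "fm i j * om k = (\<Sum>l\<in>UNIV. \<Sum>m\<in>UNIV. hsmult E (\<sigma> i k m l) (om m * fm l j))"
    by (simp add: fmat_mult_ext[OF form_comp] lact_form[OF fmat_comp] linear_sum[OF emb_linear] sum_distrib_right lin_simps braid_def)
  then show ?thesis by (subst sum.swap)
qed

lemma vfield_form:
  "vf i * om k = om k * vf i + (\<Sum>m\<in>UNIV. \<Sum>l\<in>UNIV. hsmult E (struct_const E k m l) (om m * fm l i))"
proof -
  have "vf i * om k = om k * vf i + (\<Sum>l\<in>UNIV. \<Sum>m\<in>UNIV. hsmult E (struct_const E k m l) (om m * fm l i))"
    by (simp add: vfield_mult_ext[OF form_comp] lact_form[OF vfield_comp] linear_sum[OF emb_linear] sum_distrib_right lin_simps struct_const_def)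
  then show ?thesis by (subst (asm) sum.swap)
qed

text \<open>At \<open>a = 1\<close> the rule \<open>form_mult\<close> expresses \<omega> through the
  \<omega> with these counits as coefficients; independence of the forms fixes them.\<close>

lemma counit_fmat: "counit (dext E) (fmat E i j) = of_bool (i = j)"
proof -
  have "(\<Sum>j\<in>UNIV. smult (ext E) (pair E (fmat E i j) 1 - of_bool (i = j)) 1 * form E j) = 0"
  proof -
    have "form E i = (\<Sum>j\<in>UNIV. smult (ext E) (pair E (fmat E i j) 1) 1 * form E j)"
      using form_mult[OF G.one_comp, of i] by (simp add: lact_one_right)
    moreover have "(\<Sum>j\<in>UNIV. smult (ext E) (of_bool (i = j)) 1 * form E j) = (\<Sum>j\<in>UNIV. if j = i then form E j else 0)"
      by (rule sum.cong) (auto simp: lin_simps)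
    ultimately show ?thesis by (simp add: GA.scale_left_diff_distrib left_diff_distrib sum_subtractf)
  qed
  then have "smult (ext E) (pair E (fmat E i j) 1 - of_bool (i = j)) 1 = 0"
    by (rule form_independent[rotated]) (simp add: G.comp_scale G.one_comp)
  then show ?thesis using smult_one_eq_0 by (simp add: pair_one_right)
qed

lemma diff_one: "diff E 1 = 0"
  using diff_mult[OF G.one_comp, of 1] by simp

lemma counit_vfield: "counit (dext E) (vfield E i) = 0"
proof -
  have "(\<Sum>j\<in>UNIV. smult (ext E) (pair E (vfield E j) 1) 1 * form E j) = 0"
    using diff_vfield[OF G.one_comp] by (simp add: lact_one_right diff_one)
  then have "smult (ext E) (pair E (vfield E i) 1) 1 = 0"
    by (rule form_independent[rotated]) (simp add: G.comp_scale G.one_comp)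
  then show ?thesis using smult_one_eq_0 by (simp add: pair_one_right)
qed

lemma counit_dform: "counit (dext E) (dform E i) = 0"
  using D.counit_comp[OF dform_comp] by simp

lemma dform_fmat: "ga i * fm k j = (\<Sum>m\<in>UNIV. \<Sum>l\<in>UNIV. hsmult E (\<sigma> m l i j) (fm k m * ga l))"
proof -
  have "dlact E (rmat E l i) (fmat E k j) = (\<Sum>m\<in>UNIV. smult (dext E) (\<sigma> m l i j) (fmat E k m))" for l
  proof -
    have "dlact E (rmat E l i) (fmat E k j) = (\<Sum>(h1, h2)\<leftarrow>[(fmat E k m, fmat E m j). m \<leftarrow> all_indices]. smult (dext E) (pair E h2 (rmat E l i)) h1)"
      unfolding dlact_def
      by (rule tensor_eq_sum[OF coprod_fmat D.vs])
         (auto intro!: linearI[OF D.vs D.vs] simp: lin_simps mult.commute)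
    then show ?thesis by (simp add: o_def sum_list_all_indices braid_def)
  qed
  then have "ga i * fm k j = (\<Sum>l\<in>UNIV. \<Sum>m\<in>UNIV. hsmult E (\<sigma> m l i j) (fm k m * ga l))"
    by (simp add: demb_mult[symmetric] dform_mult[OF fmat_comp] sum_distrib_right linear_sum[OF demb_linear] lin_simps)
  then show ?thesis by (subst sum.swap)
qed

text \<open>The signs in \<open>cross_mult\<close> refer to \<open>deg\<close> of the entries of the
  chosen coproduct lists, while \<open>coprod_form\<close> and \<open>coprod_dform\<close> fix these
  lists only as tensors. The explicit lists can be inserted only where the sign is linear in the
  entries.\<close>

lemma dform_form: "ga j * om k = fm k j - om k * ga j"
proof -
  obtain p where p: "Vector_Spaces.linear (smult (ext E)) (smult (ext E)) p"
    "\<And>x. x \<in> component (ext E) 0 \<Longrightarrow> p x = x" "\<And>x n. x \<in> component (ext E) (Suc n) \<Longrightarrow> p x = 0"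
    using G.projection_degree0 by blast
  \<comment> \<open>\<open>\<nu>\<close> is the grading involution in degrees \<open>0, 1\<close> up to sign; it makes the sign of the
    cross-multiplication bilinear.\<close>
  define \<nu> where "\<nu> x = x - p x - p x" for x
  have \<nu>: "Vector_Spaces.linear (smult (ext E)) (smult (ext E)) \<nu>"
    by (rule linearI[OF G.vs G.vs]) (simp_all add: \<nu>_def linearD[OF p(1)] GA.scale_right_diff_distrib)
  have "ga j * om k = (\<Sum>(\<phi>1, \<phi>2)\<leftarrow>coprod (dext E) (dform E j). \<Sum>(x1, x2)\<leftarrow>coprod (ext E) (form E k).
      hsmult E (pair E \<phi>1 (\<nu> x2)) (emb E x1 * demb E \<phi>2))"
    unfolding cross_mult[OF dform_comp form_comp]
  proof (intro sum_list_cong_set, clarify, intro sum_list_cong_set, clarify)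
    fix \<phi>1 \<phi>2 x1 x2 assume a: "(\<phi>1, \<phi>2) \<in> set (coprod (dext E) (dform E j))" "(x1, x2) \<in> set (coprod (ext E) (form E k))"
    obtain m m' where m: "m + m' = 1" "\<phi>1 \<in> component (dext E) m" using D.coprod_comp[OF dform_comp a(1)] by blast
    obtain n n' where n: "n' + n = 1" "x2 \<in> component (ext E) n" using G.coprod_comp[OF form_comp a(2)] by blast
    have "koszul 1 1 * koszul (deg (dext E) \<phi>1) (deg (ext E) x2) * pair E \<phi>1 x2 = pair E \<phi>1 (\<nu> x2)"
    proof (cases "n = 0")
      case True
      then show ?thesis using n p(2)[of x2] G.deg_degree0[of x2] by (simp add: \<nu>_def koszul_def lin_simps)
    next
      case False
      then have n1: "n = 1" using n by simp
      then have nx: "\<nu> x2 = x2" using p(3)[of x2 0] n by (simp add: \<nu>_def)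
      show ?thesis
      proof (cases "m = 1 \<and> \<phi>1 \<noteq> 0 \<and> x2 \<noteq> 0")
        case True
        then show ?thesis using nx n n1 m D.deg_eq[of \<phi>1 1] G.deg_eq[of x2 1] by (simp add: koszul_def)
      next
        case False
        then have "pair E \<phi>1 x2 = 0" using pair_comp[OF m(2) n(2)] n1 by (auto simp: lin_simps)
        then show ?thesis using nx by simp
      qed
    qed
    then show "hsmult E (koszul 1 1 * koszul (deg (dext E) \<phi>1) (deg (ext E) x2) * pair E \<phi>1 x2) (emb E x1 * demb E \<phi>2)
        = hsmult E (pair E \<phi>1 (\<nu> x2)) (emb E x1 * demb E \<phi>2)" by simp
  qed
  also have "\<dots> = (\<Sum>(\<phi>1, \<phi>2)\<leftarrow>coprod (dext E) (dform E j).
      hsmult E (pair E \<phi>1 (\<nu> (form E k))) (demb E \<phi>2) + (\<Sum>i\<in>UNIV. hsmult E (pair E \<phi>1 (\<nu> (rmat E k i))) (om i * demb E \<phi>2)))"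
  proof (intro sum_list_cong_set, clarify)
    fix \<phi>1 \<phi>2
    have "(\<Sum>(x1, x2)\<leftarrow>coprod (ext E) (form E k). hsmult E (pair E \<phi>1 (\<nu> x2)) (emb E x1 * demb E \<phi>2))
        = (\<Sum>(x1, x2)\<leftarrow>(1, form E k) # [(form E j, rmat E k j). j \<leftarrow> all_indices]. hsmult E (pair E \<phi>1 (\<nu> x2)) (emb E x1 * demb E \<phi>2))"
      by (rule tensor_eq_sum[OF coprod_form hs])
         (auto intro!: linearI[OF G.vs hs] simp: lin_simps linearD[OF \<nu>] mult.commute)
    then show "(\<Sum>(x1, x2)\<leftarrow>coprod (ext E) (form E k). hsmult E (pair E \<phi>1 (\<nu> x2)) (emb E x1 * demb E \<phi>2))
        = hsmult E (pair E \<phi>1 (\<nu> (form E k))) (demb E \<phi>2) + (\<Sum>i\<in>UNIV. hsmult E (pair E \<phi>1 (\<nu> (rmat E k i))) (om i * demb E \<phi>2))"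
      by (simp add: o_def sum_list_all_indices emb_one)
  qed
  also have "\<dots> = (\<Sum>(\<phi>1, \<phi>2)\<leftarrow>(1, dform E j) # [(dform E l, fmat E l j). l \<leftarrow> all_indices].
      hsmult E (pair E \<phi>1 (\<nu> (form E k))) (demb E \<phi>2) + (\<Sum>i\<in>UNIV. hsmult E (pair E \<phi>1 (\<nu> (rmat E k i))) (om i * demb E \<phi>2)))"
    by (rule tensor_eq_sum[OF coprod_dform hs])
       (auto intro!: linearI[OF D.vs hs] simp: lin_simps sum.distrib HA.scale_sum_right mult.commute)
  also have "\<dots> = fm k j - om k * ga j"
  proof -
    have \<nu>f: "\<nu> (form E k) = form E k" and \<nu>r: "\<nu> (rmat E k i) = - rmat E k i" for i
      using p(2)[OF rmat_comp] p(3)[OF form_comp[unfolded One_nat_def]] by (simp_all add: \<nu>_def)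
    have c: "counit (ext E) (form E k) = 0" using G.counit_comp[OF form_comp] by simp
    have r0: "pair E (dform E l) (rmat E k i) = 0" for l i using pair_comp[OF dform_comp rmat_comp] by simp
    have pf: "pair E (dform E l) (form E k) = of_bool (l = k)" for l
      using pair_dform_form[OF D.one_comp G.one_comp, of l k] by (simp add: pair_one_left G.counit_one)
    have "(\<Sum>l\<in>UNIV. hsmult E (pair E (dform E l) (form E k)) (fm l j)) = (\<Sum>l\<in>UNIV. if l = k then fm l j else 0)"
      by (rule sum.cong) (auto simp: pf)
    moreover have "(\<Sum>i\<in>UNIV. hsmult E (counit (ext E) (rmat E k i)) (om i)) = om k"
      using arg_cong[OF counit_rmat_form[of k], of "emb E"] by (simp add: linear_sum[OF emb_linear] lin_simps)
    then have "(\<Sum>i\<in>UNIV. hsmult E (counit (ext E) (rmat E k i)) (om i * ga j)) = om k * ga j"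
      using sum_distrib_right[of "\<lambda>i. hsmult E (counit (ext E) (rmat E k i)) (om i)" UNIV "ga j"] by (simp add: lin_simps)
    ultimately show ?thesis
      by (simp add: o_def sum_list_all_indices \<nu>f \<nu>r c r0 pair_one_left lin_simps sum_negf)
  qed
  finally show ?thesis .
qed

text \<open>The exchange relations of the f are forced by associativity: \<gamma> f \<omega> is
  reordered starting from either neighbouring pair, and the terms that still contain both \<omega>
  and \<gamma> agree.\<close>

lemma fmat_fmat:
  "(\<Sum>m\<in>UNIV. \<Sum>l\<in>UNIV. hsmult E (\<sigma> m l i j) (fm k m * fm n l)) =
   (\<Sum>m\<in>UNIV. \<Sum>l\<in>UNIV. hsmult E (\<sigma> k n m l) (fm m i * fm l j))"
proof -
  have 1: "ga i * (fm k j * om n) = (\<Sum>m\<in>UNIV. \<Sum>l\<in>UNIV. hsmult E (\<sigma> m l i j) (fm k m * fm n l))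
      - (\<Sum>m\<in>UNIV. \<Sum>l\<in>UNIV. \<Sum>a\<in>UNIV. \<Sum>p\<in>UNIV. hsmult E (\<sigma> m l i j * \<sigma> k n a p) (om a * fm p m * ga l))"
  proof -
    have "ga i * (fm k j * om n) = (\<Sum>m\<in>UNIV. \<Sum>l\<in>UNIV. hsmult E (\<sigma> m l i j) (fm k m * (ga l * om n)))"
      by (simp add: mult.assoc[symmetric] dform_fmat sum_distrib_right H_scale)
    moreover have "fm k m * (ga l * om n) = fm k m * fm n l - (fm k m * om n) * ga l" for m l
      by (simp add: dform_form right_diff_distrib mult.assoc)
    ultimately show ?thesis
      by (simp add: fmat_form HA.scale_right_diff_distrib sum_subtractf sum_distrib_right HA.scale_sum_right H_scale)
  qed
  have 2: "ga i * (fm k j * om n) = (\<Sum>a\<in>UNIV. \<Sum>p\<in>UNIV. hsmult E (\<sigma> k n a p) (fm a i * fm p j))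
      - (\<Sum>a\<in>UNIV. \<Sum>p\<in>UNIV. \<Sum>m\<in>UNIV. \<Sum>l\<in>UNIV. hsmult E (\<sigma> m l i j * \<sigma> k n a p) (om a * fm p m * ga l))"
  proof -
    have "ga i * (fm k j * om n) = (\<Sum>a\<in>UNIV. \<Sum>p\<in>UNIV. hsmult E (\<sigma> k n a p) (ga i * om a * fm p j))"
      by (simp add: fmat_form sum_distrib_left H_scale mult.assoc)
    moreover have "ga i * om a * fm p j = fm a i * fm p j - om a * (ga i * fm p j)" for a p
      by (simp add: dform_form left_diff_distrib mult.assoc)
    ultimately show ?thesis
      by (simp add: dform_fmat HA.scale_right_diff_distrib sum_subtractf sum_distrib_left HA.scale_sum_right H_scale
          mult.assoc mult.commute)
  qed
  from 1 2 show ?thesis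
    using sum_swap_pairs[of "\<lambda>m l a p. hsmult E (\<sigma> m l i j * \<sigma> k n a p) (om a * fm p m * ga l)" UNIV UNIV UNIV UNIV] by simp
qed

section \<open>Passage between the \<omega> and the \<Omega>\<close>

lemma inv_antipode_fmat_left:
  "(\<Sum>l\<in>UNIV. inv (antipode (dext E)) (fmat E l j) * fmat E k l) = of_bool (k = j)"
proof -
  have "(\<Sum>(x1, x2)\<leftarrow>coprod (dext E) (fmat E k j). inv (antipode (dext E)) x2 * x1)
      = (\<Sum>(x1, x2)\<leftarrow>[(fmat E k l, fmat E l j). l \<leftarrow> all_indices]. inv (antipode (dext E)) x2 * x1)"
    by (rule tensor_eq_sum[OF coprod_fmat D.vs])
       (auto intro!: linearI[OF D.vs D.vs] simp: lin_simps linearD[OF D.inv_antipode_linear])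
  then have "smult (dext E) (of_bool (k = j)) 1 = (\<Sum>l\<in>UNIV. inv (antipode (dext E)) (fmat E l j) * fmat E k l)"
    by (simp only: D.inv_antipode_left[OF fmat_comp] counit_fmat) (simp add: o_def sum_list_all_indices)
  then show ?thesis by (cases "k = j") simp_all
qed

lemma inv_antipode_fmat_right:
  "(\<Sum>l\<in>UNIV. fmat E l j * inv (antipode (dext E)) (fmat E k l)) = of_bool (k = j)"
proof -
  have "(\<Sum>(x1, x2)\<leftarrow>coprod (dext E) (fmat E k j). x2 * inv (antipode (dext E)) x1)
      = (\<Sum>(x1, x2)\<leftarrow>[(fmat E k l, fmat E l j). l \<leftarrow> all_indices]. x2 * inv (antipode (dext E)) x1)"
    by (rule tensor_eq_sum[OF coprod_fmat D.vs])
       (auto intro!: linearI[OF D.vs D.vs] simp: lin_simps linearD[OF D.inv_antipode_linear])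
  then have "smult (dext E) (of_bool (k = j)) 1 = (\<Sum>l\<in>UNIV. fmat E l j * inv (antipode (dext E)) (fmat E k l))"
    by (simp only: D.inv_antipode_right[OF fmat_comp] counit_fmat) (simp add: o_def sum_list_all_indices)
  then show ?thesis by (cases "k = j") simp_all
qed

lemma form_Omega: "om k = (\<Sum>l\<in>UNIV. Omega E l * fm k l)"
proof -
  have "(\<Sum>l\<in>UNIV. Omega E l * fm k l) = (\<Sum>l\<in>UNIV. \<Sum>j\<in>UNIV. om j * demb E (inv (antipode (dext E)) (fmat E l j) * fmat E k l))"
    by (simp add: Omega_def sum_distrib_right demb_mult mult.assoc)
  also have "\<dots> = (\<Sum>j\<in>UNIV. om j * demb E (\<Sum>l\<in>UNIV. inv (antipode (dext E)) (fmat E l j) * fmat E k l))"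
    by (subst sum.swap) (simp add: sum_distrib_left linear_sum[OF demb_linear])
  also have "\<dots> = (\<Sum>j\<in>UNIV. if j = k then om j else 0)"
    by (rule sum.cong) (auto simp: inv_antipode_fmat_left demb_one lin_simps)
  finally show ?thesis by simp
qed

text \<open>Move f past the \<omega> inside \<Omega>, rewrite the new \<omega> as \<Omega> f, and
  exchange the two f by \<open>fmat_fmat\<close>; the f that ends up next to the inverse antipode
  cancels it.\<close>

lemma fmat_Omega: "fm k l * Omega E c = (\<Sum>q\<in>UNIV. \<Sum>a\<in>UNIV. hsmult E (\<sigma> a c q l) (Omega E q * fm k a))"
proof -
  let ?S = "\<lambda>n. demb E (inv (antipode (dext E)) (fmat E c n))"
  have fo: "fm k l * om n = (\<Sum>q\<in>UNIV. Omega E q * (\<Sum>m\<in>UNIV. \<Sum>b\<in>UNIV. hsmult E (\<sigma> m b q l) (fm k m * fm n b)))" for n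
  proof -
    have "fm k l * om n = (\<Sum>a\<in>UNIV. \<Sum>p\<in>UNIV. hsmult E (\<sigma> k n a p) (om a * fm p l))"
      by (rule fmat_form)
    also have "\<dots> = (\<Sum>a\<in>UNIV. \<Sum>p\<in>UNIV. \<Sum>q\<in>UNIV. Omega E q * hsmult E (\<sigma> k n a p) (fm a q * fm p l))"
      by (simp add: form_Omega sum_distrib_right HA.scale_sum_right H_scale mult.assoc)
    also have "\<dots> = (\<Sum>a\<in>UNIV. \<Sum>q\<in>UNIV. \<Sum>p\<in>UNIV. Omega E q * hsmult E (\<sigma> k n a p) (fm a q * fm p l))"
      by (intro sum.cong refl sum.swap)
    also have "\<dots> = (\<Sum>q\<in>UNIV. \<Sum>a\<in>UNIV. \<Sum>p\<in>UNIV. Omega E q * hsmult E (\<sigma> k n a p) (fm a q * fm p l))"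
      by (rule sum.swap)
    also have "\<dots> = (\<Sum>q\<in>UNIV. Omega E q * (\<Sum>m\<in>UNIV. \<Sum>b\<in>UNIV. hsmult E (\<sigma> m b q l) (fm k m * fm n b)))"
      unfolding fmat_fmat by (simp add: sum_distrib_left)
    finally show ?thesis .
  qed
  have inv: "(\<Sum>n\<in>UNIV. fm n b * ?S n) = of_bool (c = b)" for b
    using arg_cong[OF inv_antipode_fmat_right[of b c], of "demb E"]
    by (simp add: linear_sum[OF demb_linear] demb_mult) (auto simp: demb_one lin_simps)
  have "fm k l * Omega E c = (\<Sum>n\<in>UNIV. (fm k l * om n) * ?S n)"
    by (simp add: Omega_def sum_distrib_left mult.assoc)
  also have "\<dots> = (\<Sum>n\<in>UNIV. \<Sum>q\<in>UNIV. \<Sum>m\<in>UNIV. \<Sum>b\<in>UNIV. hsmult E (\<sigma> m b q l) (Omega E q * fm k m * (fm n b * ?S n)))"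
    by (simp add: fo sum_distrib_left sum_distrib_right H_scale mult.assoc)
  also have "\<dots> = (\<Sum>q\<in>UNIV. \<Sum>n\<in>UNIV. \<Sum>m\<in>UNIV. \<Sum>b\<in>UNIV. hsmult E (\<sigma> m b q l) (Omega E q * fm k m * (fm n b * ?S n)))"
    by (rule sum.swap)
  also have "\<dots> = (\<Sum>q\<in>UNIV. \<Sum>m\<in>UNIV. \<Sum>n\<in>UNIV. \<Sum>b\<in>UNIV. hsmult E (\<sigma> m b q l) (Omega E q * fm k m * (fm n b * ?S n)))"
    by (intro sum.cong refl sum.swap)
  also have "\<dots> = (\<Sum>q\<in>UNIV. \<Sum>m\<in>UNIV. \<Sum>b\<in>UNIV. hsmult E (\<sigma> m b q l) (Omega E q * fm k m * (\<Sum>n\<in>UNIV. fm n b * ?S n)))"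
  proof -
    have "(\<Sum>n\<in>UNIV. \<Sum>b\<in>UNIV. hsmult E (\<sigma> m b q l) (Omega E q * fm k m * (fm n b * ?S n))) =
        (\<Sum>b\<in>UNIV. hsmult E (\<sigma> m b q l) (Omega E q * fm k m * (\<Sum>n\<in>UNIV. fm n b * ?S n)))" for q m
      by (subst sum.swap) (simp add: sum_distrib_left HA.scale_sum_right)
    then show ?thesis by simp
  qed
  also have "\<dots> = (\<Sum>q\<in>UNIV. \<Sum>m\<in>UNIV. \<Sum>b\<in>UNIV. if b = c then hsmult E (\<sigma> m b q l) (Omega E q * fm k m) else 0)"
    unfolding inv by (intro sum.cong) auto
  finally show ?thesis by simp
qed

section \<open>The action on the exterior algebra\<close>

text \<open>By freeness, two normally ordered sums for one element are equal as tensors, so bilinear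
  expressions in the factors depend on the element alone. This underlies \<open>vac\<close> and the
  check of left invariance.\<close>

lemma heisenberg_well_defined:
  assumes eq: "(\<Sum>(x, \<phi>)\<leftarrow>t. emb E x * demb E \<phi>) = (\<Sum>(x, \<phi>)\<leftarrow>t'. emb E x * demb E \<phi>)"
    and u: "vector_space u"
    and B1: "\<And>y. Vector_Spaces.linear (smult (ext E)) u (\<lambda>x. B x y)"
    and B2: "\<And>x. Vector_Spaces.linear (smult (dext E)) u (B x)"
  shows "(\<Sum>(x, \<phi>)\<leftarrow>t. B x \<phi>) = (\<Sum>(x, \<phi>)\<leftarrow>t'. B x \<phi>)"
proof -
  have neg: "(\<Sum>x\<leftarrow>t'. - f x) = - (\<Sum>x\<leftarrow>t'. f x :: 'w::ab_group_add)" for f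
    by (induction t') auto
  have "(\<Sum>(x, \<phi>)\<leftarrow>t @ map (\<lambda>(x, \<phi>). (- x, \<phi>)) t'. emb E x * demb E \<phi>) = 0"
    using eq by (simp add: split_def o_def lin_simps neg)
  then have "tensor_eq (smult (ext E)) (smult (dext E)) (t @ map (\<lambda>(x, \<phi>). (- x, \<phi>)) t') []"
    by (rule heisenberg_free)
  from tensor_eq_sum[OF this u B1 B2]
  have "(\<Sum>(x, \<phi>)\<leftarrow>t. B x \<phi>) + (\<Sum>(x, \<phi>)\<leftarrow>map (\<lambda>(x, \<phi>). (- x, \<phi>)) t'. B x \<phi>) = 0" by simp
  then show ?thesis
    by (simp add: split_def o_def linearD(4)[OF B1] neg)
qed

text \<open>\<open>vac z\<close> is the result of applying \<open>z\<close> to the vacuum \<open>1 \<in> \<Gamma>\<^sup>\<and>\<close>, on which \<open>\<Gamma>\<^sup>\<and>\<^sup>*\<close> acts through the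
  counit; \<open>vac (z * emb E x)\<close> is the action of \<open>z\<close> on \<open>x\<close>.\<close>

definition vac :: "'h \<Rightarrow> 'g" where
  "vac z = (SOME y. \<exists>t. z = (\<Sum>(x, \<phi>)\<leftarrow>t. emb E x * demb E \<phi>) \<and>
     y = (\<Sum>(x, \<phi>)\<leftarrow>t. smult (ext E) (counit (dext E) \<phi>) x))"

lemma vac_sum_list:
  "vac (\<Sum>(x, \<phi>)\<leftarrow>t. emb E x * demb E \<phi>) = (\<Sum>(x, \<phi>)\<leftarrow>t. smult (ext E) (counit (dext E) \<phi>) x)"
  unfolding vac_def
proof (rule some_equality, blast)
  fix y assume "\<exists>t'. (\<Sum>(x, \<phi>)\<leftarrow>t. emb E x * demb E \<phi>) = (\<Sum>(x, \<phi>)\<leftarrow>t'. emb E x * demb E \<phi>) \<and>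
      y = (\<Sum>(x, \<phi>)\<leftarrow>t'. smult (ext E) (counit (dext E) \<phi>) x)"
  then obtain t' where t': "(\<Sum>(x, \<phi>)\<leftarrow>t. emb E x * demb E \<phi>) = (\<Sum>(x, \<phi>)\<leftarrow>t'. emb E x * demb E \<phi>)"
    "y = (\<Sum>(x, \<phi>)\<leftarrow>t'. smult (ext E) (counit (dext E) \<phi>) x)" by blast
  show "y = (\<Sum>(x, \<phi>)\<leftarrow>t. smult (ext E) (counit (dext E) \<phi>) x)"
    unfolding t'(2)
    by (rule heisenberg_well_defined[OF t'(1)[symmetric] G.vs])
       (auto intro!: linearI[OF G.vs G.vs] linearI[OF D.vs G.vs] simp: lin_simps mult.commute)
qed

lemma vac_linear: "Vector_Spaces.linear (hsmult E) (smult (ext E)) vac"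
proof (rule linearI[OF hs G.vs])
  fix z w c
  obtain t where t: "z = (\<Sum>(x, \<phi>)\<leftarrow>t. emb E x * demb E \<phi>)" using heisenberg_span by blast
  obtain u where u: "w = (\<Sum>(x, \<phi>)\<leftarrow>u. emb E x * demb E \<phi>)" using heisenberg_span by blast
  have "z + w = (\<Sum>(x, \<phi>)\<leftarrow>t @ u. emb E x * demb E \<phi>)" using t u by simp
  then show "vac (z + w) = vac z + vac w" using vac_sum_list[of "t @ u"] vac_sum_list[of t] vac_sum_list[of u] t u by simp
  have "hsmult E c z = (\<Sum>(x, \<phi>)\<leftarrow>map (\<lambda>(x, \<phi>). (smult (ext E) c x, \<phi>)) t. emb E x * demb E \<phi>)"
    using t by (simp add: split_def o_def lin_simps linear_sum_list[OF HA.linear_scale_self])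
  then show "vac (hsmult E c z) = smult (ext E) c (vac z)"
    using vac_sum_list[of "map (\<lambda>(x, \<phi>). (smult (ext E) c x, \<phi>)) t"] vac_sum_list[of t] t
    by (simp add: split_def o_def lin_simps linear_sum_list[OF GA.linear_scale_self] mult.commute)
qed

lemmas vac_simps = linearD[OF vac_linear]

lemma vac_emb_demb: "vac (emb E x * demb E \<phi>) = smult (ext E) (counit (dext E) \<phi>) x"
  using vac_sum_list[of "[(x, \<phi>)]"] by simp

lemma vac_emb [simp]: "vac (emb E x) = x"
  using vac_emb_demb[of x 1] by (simp add: demb_one D.counit_one)

lemma vac_demb: "vac (demb E \<phi>) = smult (ext E) (counit (dext E) \<phi>) 1"
  using vac_emb_demb[of 1 \<phi>] by (simp add: emb_one)

lemma vac_emb_mult: "vac (emb E y * z) = y * vac z"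
proof -
  obtain t where t: "z = (\<Sum>(x, \<phi>)\<leftarrow>t. emb E x * demb E \<phi>)" using heisenberg_span by blast
  have "emb E y * z = (\<Sum>(x, \<phi>)\<leftarrow>t. emb E (y * x) * demb E \<phi>)"
    using t by (simp add: split_def sum_list_const_mult[symmetric] emb_mult mult.assoc)
  then show ?thesis
    using vac_sum_list[of t] t
    by (simp add: split_def linear_sum_list[OF vac_linear] vac_emb_demb sum_list_const_mult[symmetric] lin_simps)
qed

lemma vac_mult_demb: "vac (z * demb E \<psi>) = smult (ext E) (counit (dext E) \<psi>) (vac z)"
proof -
  obtain t where t: "z = (\<Sum>(x, \<phi>)\<leftarrow>t. emb E x * demb E \<phi>)" using heisenberg_span by blast
  have "z * demb E \<psi> = (\<Sum>(x, \<phi>)\<leftarrow>t. emb E x * demb E (\<phi> * \<psi>))"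
    using t by (simp add: split_def sum_list_mult_const[symmetric] demb_mult mult.assoc)
  then show ?thesis
    using vac_sum_list[of t] t
    by (simp add: split_def linear_sum_list[OF vac_linear] vac_emb_demb D.counit_mult
        linear_sum_list[OF GA.linear_scale_self] mult.commute)
qed

text \<open>Dual elements on the far right contribute only their counit, so \<open>w\<close> enters
  only through its value on the vacuum. Hence the action on the vacuum module is multiplicative:
  \<open>z * w\<close> acts as \<open>z\<close> after \<open>w\<close>.\<close>

lemma vac_mult: "vac (z * w) = vac (z * emb E (vac w))"
proof -
  obtain t where t: "w = (\<Sum>(x, \<phi>)\<leftarrow>t. emb E x * demb E \<phi>)" using heisenberg_span by blast
  have "vac (z * w) = (\<Sum>(x, \<phi>)\<leftarrow>t. vac (z * emb E x * demb E \<phi>))"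
    using t by (simp add: split_def sum_list_const_mult[symmetric] linear_sum_list[OF vac_linear] mult.assoc)
  also have "\<dots> = vac (z * emb E (vac w))"
    using t vac_sum_list[of t]
    by (simp add: vac_mult_demb split_def linear_sum_list[OF emb_linear] linear_sum_list[OF vac_linear]
        sum_list_const_mult[symmetric] lin_simps vac_simps)
  finally show ?thesis .
qed

lemma vac_cross:
  assumes \<phi>: "\<phi> \<in> component (dext E) m" and x: "x \<in> component (ext E) n" and mn: "m = 0 \<or> n = 0"
  shows "vac (demb E \<phi> * emb E x) = lact E \<phi> x"
  unfolding cross_mult_degree0[OF \<phi> x mn]
  using D.sum_counit_right[OF lact_linear_left]
  by (simp add: split_def linear_sum_list[OF vac_linear] vac_emb_demb)

text \<open>The subalgebra generated by \<open>\<Gamma>\<^sup>\<and>\<close> and \<open>\<A>*\<close>.\<close>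

definition degree0_span :: "'h set" where
  "degree0_span = {\<Sum>(x, \<phi>)\<leftarrow>t. emb E x * demb E \<phi> |t. \<forall>(x, \<phi>)\<in>set t. \<phi> \<in> component (dext E) 0}"

lemma degree0_span_emb_demb:
  "\<phi> \<in> component (dext E) 0 \<Longrightarrow> emb E x * demb E \<phi> \<in> degree0_span"
  unfolding degree0_span_def by (intro CollectI exI[of _ "[(x, \<phi>)]"]) auto

lemma degree0_span_zero: "0 \<in> degree0_span"
  unfolding degree0_span_def by (intro CollectI exI[of _ "[]"]) auto

lemma degree0_span_add: "z \<in> degree0_span \<Longrightarrow> w \<in> degree0_span \<Longrightarrow> z + w \<in> degree0_span"
proof -
  assume "z \<in> degree0_span" "w \<in> degree0_span"
  then obtain t u where "z = (\<Sum>(x, \<phi>)\<leftarrow>t. emb E x * demb E \<phi>)" "\<forall>(x, \<phi>)\<in>set t. \<phi> \<in> component (dext E) 0"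
    "w = (\<Sum>(x, \<phi>)\<leftarrow>u. emb E x * demb E \<phi>)" "\<forall>(x, \<phi>)\<in>set u. \<phi> \<in> component (dext E) 0"
    unfolding degree0_span_def by blast
  then show ?thesis unfolding degree0_span_def by (intro CollectI exI[of _ "t @ u"]) auto
qed

lemma degree0_span_induct [consumes 1, case_names gen zero add]:
  assumes "z \<in> degree0_span"
    and "\<And>x \<phi>. \<phi> \<in> component (dext E) 0 \<Longrightarrow> P (emb E x * demb E \<phi>)" "P 0"
    and "\<And>z w. P z \<Longrightarrow> P w \<Longrightarrow> P (z + w)"
  shows "P z"
proof -
  obtain t where "z = (\<Sum>(x, \<phi>)\<leftarrow>t. emb E x * demb E \<phi>)" "\<forall>(x, \<phi>)\<in>set t. \<phi> \<in> component (dext E) 0"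
    using assms(1) unfolding degree0_span_def by blast
  moreover have "\<forall>(x, \<phi>)\<in>set t. \<phi> \<in> component (dext E) 0 \<Longrightarrow> P (\<Sum>(x, \<phi>)\<leftarrow>t. emb E x * demb E \<phi>)" for t
    by (induction t) (use assms(2-4) in auto)
  ultimately show ?thesis by blast
qed

lemma degree0_span_sum: "(\<And>i. i \<in> A \<Longrightarrow> f i \<in> degree0_span) \<Longrightarrow> sum f A \<in> degree0_span"
  by (induction A rule: infinite_finite_induct) (auto intro: degree0_span_zero degree0_span_add)

lemma degree0_span_sum_list: "(\<And>i. i \<in> set l \<Longrightarrow> f i \<in> degree0_span) \<Longrightarrow> (\<Sum>i\<leftarrow>l. f i) \<in> degree0_span"
  by (induction l) (auto intro: degree0_span_zero degree0_span_add)

lemma degree0_span_emb_mult: "z \<in> degree0_span \<Longrightarrow> emb E x * z \<in> degree0_span"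
  by (induction rule: degree0_span_induct)
     (auto simp: mult.assoc[symmetric] emb_mult[symmetric] distrib_left
       intro: degree0_span_emb_demb degree0_span_zero degree0_span_add)

lemma degree0_span_scale: "z \<in> degree0_span \<Longrightarrow> hsmult E c z \<in> degree0_span"
  using degree0_span_emb_mult[of z "smult (ext E) c 1"] by (simp add: lin_simps emb_one)

lemma degree0_span_diff: "z \<in> degree0_span \<Longrightarrow> w \<in> degree0_span \<Longrightarrow> z - w \<in> degree0_span"
  using degree0_span_add[of z "hsmult E (- 1) w"] degree0_span_scale[of w "- 1"] by simp

lemma degree0_span_mult_demb:
  "z \<in> degree0_span \<Longrightarrow> \<psi> \<in> component (dext E) 0 \<Longrightarrow> z * demb E \<psi> \<in> degree0_span"
proof (induction rule: degree0_span_induct)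
  case (gen x \<phi>)
  then show ?case
    using D.mult_comp[of \<phi> 0 \<psi> 0] by (simp add: mult.assoc demb_mult[symmetric] degree0_span_emb_demb)
qed (auto simp: distrib_right intro: degree0_span_zero degree0_span_add)

lemma degree0_span_mult_emb:
  "z \<in> degree0_span \<Longrightarrow> y \<in> component (ext E) n \<Longrightarrow> z * emb E y \<in> degree0_span"
proof (induction rule: degree0_span_induct)
  case (gen x \<phi>)
  have "demb E \<phi> * emb E y \<in> degree0_span"
    unfolding cross_mult_degree0[OF gen(1,2) disjI1[OF refl]]
    by (rule degree0_span_sum_list)
       (auto dest: D.coprod_degree0(2)[OF gen(1)] intro: degree0_span_emb_demb)
  then show ?case by (simp add: mult.assoc degree0_span_emb_mult)
qed (auto simp: distrib_right intro: degree0_span_zero degree0_span_add)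

lemma degree0_span_emb: "emb E x \<in> degree0_span"
  using degree0_span_emb_demb[OF D.one_comp] by (simp add: demb_one)

lemma degree0_span_mult_Omega: "z \<in> degree0_span \<Longrightarrow> z * Omega E i \<in> degree0_span"
  unfolding Omega_def sum_distrib_left mult.assoc[symmetric]
  by (intro degree0_span_sum degree0_span_mult_demb degree0_span_mult_emb[OF _ form_comp] fmat_inv_antipode_comp)

lemma degree0_span_wedge_Omega: "wedge (Omega E) I \<in> degree0_span"
proof (induction I rule: rev_induct)
  case Nil
  then show ?case using degree0_span_emb[of 1] by (simp add: emb_one)
next
  case (snoc i I)
  then show ?case by (simp add: degree0_span_mult_Omega)
qed

text \<open>Acting by zero on a means that the sum of the x a1 <\<phi>, a2> vanishes. Using this for
  the second leg of a and multiplying on the right by S^-1 of the first leg removes the factor from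
  \<A> and leaves that the sum of the <\<phi>, a> x is 0; nondegeneracy of the pairing then kills
  the tensor.\<close>

lemma faithful_degree0:
  assumes z: "z \<in> degree0_span" and zero: "\<And>a. a \<in> component (ext E) 0 \<Longrightarrow> vac (z * emb E a) = 0"
  shows "z = 0"
proof -
  obtain t where t: "z = (\<Sum>(x, \<phi>)\<leftarrow>t. emb E x * demb E \<phi>)" and t0: "\<forall>(x, \<phi>)\<in>set t. \<phi> \<in> component (dext E) 0"
    using z unfolding degree0_span_def by blast
  let ?S = "inv (antipode (ext E))"
  have act: "(\<Sum>(x, \<phi>)\<leftarrow>t. x * lact E \<phi> a) = 0" if a: "a \<in> component (ext E) 0" for a
  proof -
    have "vac (z * emb E a) = (\<Sum>(x, \<phi>)\<leftarrow>t. vac (emb E x * (demb E \<phi> * emb E a)))"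
      using t by (simp add: split_def sum_list_mult_const[symmetric] linear_sum_list[OF vac_linear] mult.assoc)
    also have "\<dots> = (\<Sum>(x, \<phi>)\<leftarrow>t. x * lact E \<phi> a)"
      by (rule sum_list_cong_set) (use t0 vac_cross[OF _ a] in \<open>auto simp: vac_emb_mult\<close>)
    finally show ?thesis using zero[OF a] by simp
  qed
  define T where "T u v w = (\<Sum>(x, \<phi>)\<leftarrow>t. smult (ext E) (pair E \<phi> w) (x * v * ?S u))" for u v w
  have T: "Vector_Spaces.linear (smult (ext E)) (smult (ext E)) (\<lambda>u. T u v w)"
    "Vector_Spaces.linear (smult (ext E)) (smult (ext E)) (\<lambda>v. T u v w)"
    "Vector_Spaces.linear (smult (ext E)) (smult (ext E)) (T u v)" for u v w
    by (auto intro!: linearI[OF G.vs G.vs] simp: T_def split_def lin_simps sum_list_addf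
        linearD[OF G.inv_antipode_linear] linear_sum_list[OF GA.linear_scale_self] mult.commute)
  have pair0: "(\<Sum>(x, \<phi>)\<leftarrow>t. smult (ext E) (pair E \<phi> a) x) = 0" if a: "a \<in> component (ext E) 0" for a
  proof -
    have "0 = (\<Sum>(a1, a2)\<leftarrow>coprod (ext E) a. (\<Sum>(x, \<phi>)\<leftarrow>t. x * lact E \<phi> a2) * ?S a1)"
    proof -
      have "(\<Sum>(a1, a2)\<leftarrow>coprod (ext E) a. (\<Sum>(x, \<phi>)\<leftarrow>t. x * lact E \<phi> a2) * ?S a1) = (\<Sum>(a1, a2)\<leftarrow>coprod (ext E) a. 0)"
        by (rule sum_list_cong_set, clarify) (use act G.coprod_degree0(2)[OF a] in simp)
      then show ?thesis by (simp add: split_def)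
    qed
    also have "\<dots> = (\<Sum>(a1, a2)\<leftarrow>coprod (ext E) a. \<Sum>(y1, y2)\<leftarrow>coprod (ext E) a2. T a1 y1 y2)"
    proof -
      have "(\<Sum>(x, \<phi>)\<leftarrow>t. x * lact E \<phi> a2) * ?S a1 = (\<Sum>(y1, y2)\<leftarrow>coprod (ext E) a2. T a1 y1 y2)" for a1 a2
        unfolding T_def split_def
        by (subst sum_list_swap)
           (simp add: lact_def split_def sum_list_mult_const[symmetric] sum_list_const_mult[symmetric] lin_simps)
      then show ?thesis by simp
    qed
    also have "\<dots> = (\<Sum>(a1, a2)\<leftarrow>coprod (ext E) a. \<Sum>(y1, y2)\<leftarrow>coprod (ext E) a1. T y1 y2 a2)"
      by (rule G.coassoc_sum[OF G.vs T, symmetric])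
    also have "\<dots> = (\<Sum>(a1, a2)\<leftarrow>coprod (ext E) a. smult (ext E) (counit (ext E) a1) (\<Sum>(x, \<phi>)\<leftarrow>t. smult (ext E) (pair E \<phi> a2) x))"
    proof (rule sum_list_cong_set, clarify)
      fix a1 a2 assume "(a1, a2) \<in> set (coprod (ext E) a)"
      then have a1: "a1 \<in> component (ext E) 0" using G.coprod_degree0(1)[OF a] by blast
      have "(\<Sum>(y1, y2)\<leftarrow>coprod (ext E) a1. T y1 y2 a2)
          = (\<Sum>(x, \<phi>)\<leftarrow>t. smult (ext E) (pair E \<phi> a2) (x * (\<Sum>(y1, y2)\<leftarrow>coprod (ext E) a1. y2 * ?S y1)))"
        unfolding T_def split_def
        by (subst sum_list_swap) (simp add: sum_list_const_mult[symmetric] linear_sum_list[OF GA.linear_scale_self] mult.assoc)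
      then show "(\<Sum>(y1, y2)\<leftarrow>coprod (ext E) a1. T y1 y2 a2)
          = smult (ext E) (counit (ext E) a1) (\<Sum>(x, \<phi>)\<leftarrow>t. smult (ext E) (pair E \<phi> a2) x)"
        by (simp add: G.inv_antipode_right[OF a1, unfolded split_def] split_def linear_sum_list[OF GA.linear_scale_self] lin_simps mult.commute)
    qed
    also have "\<dots> = (\<Sum>(x, \<phi>)\<leftarrow>t. smult (ext E) (pair E \<phi> a) x)"
      by (rule G.sum_counit_left)
         (auto intro!: linearI[OF G.vs G.vs] simp: split_def lin_simps sum_list_addf linear_sum_list[OF GA.linear_scale_self] mult.commute)
    finally show ?thesis by simp
  qed
  \<comment> \<open>Nondegeneracy quantifies over the whole exterior algebra, but a \<phi> of degree
    0 sees only the degree zero component of \<open>y\<close>.\<close>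
  have pair: "(\<Sum>(x, \<phi>)\<leftarrow>t. smult (ext E) (pair E \<phi> y) x) = 0" for y
  proof -
    obtain c F where c: "\<And>n. c n \<in> component (ext E) n" "finite F" "\<And>n. n \<notin> F \<Longrightarrow> c n = 0" "y = (\<Sum>n\<in>F. c n)"
      using G.decomposition_exists[of y] by blast
    have "pair E \<phi> y = pair E \<phi> (c 0)" if "\<phi> \<in> component (dext E) 0" for \<phi>
    proof -
      have "pair E \<phi> y = (\<Sum>n\<in>F. pair E \<phi> (c n))" using c(4) linear_sum[OF pair_linear_right] by simp
      also have "\<dots> = (\<Sum>n\<in>F. if n = 0 then pair E \<phi> (c 0) else 0)"
        by (rule sum.cong) (use pair_comp[OF that c(1)] in auto)
      also have "\<dots> = pair E \<phi> (c 0)" using c(2,3) by (auto simp: lin_simps)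
      finally show ?thesis .
    qed
    then have "(\<Sum>(x, \<phi>)\<leftarrow>t. smult (ext E) (pair E \<phi> y) x) = (\<Sum>(x, \<phi>)\<leftarrow>t. smult (ext E) (pair E \<phi> (c 0)) x)"
      using t0 by (intro sum_list_cong_set) auto
    then show ?thesis using pair0[OF c(1)] by simp
  qed
  show ?thesis unfolding t
  proof (rule sum_bilinear_eq_zero[OF G.vs D.vs hs])
    fix \<xi> assume \<xi>: "Vector_Spaces.linear (smult (ext E)) (*) \<xi>"
    show "(\<Sum>(x, \<phi>)\<leftarrow>t. smult (dext E) (\<xi> x) \<phi>) = 0"
    proof (rule pair_nondegenerate_left)
      fix y
      have "pair E (\<Sum>(x, \<phi>)\<leftarrow>t. smult (dext E) (\<xi> x) \<phi>) y = \<xi> (\<Sum>(x, \<phi>)\<leftarrow>t. smult (ext E) (pair E \<phi> y) x)"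
        by (simp add: split_def linear_sum_list[OF pair_linear_left] linear_sum_list[OF \<xi>] lin_simps linearD[OF \<xi>] mult.commute)
      then show "pair E (\<Sum>(x, \<phi>)\<leftarrow>t. smult (dext E) (\<xi> x) \<phi>) y = 0" by (simp add: pair linearD[OF \<xi>])
    qed
  qed (auto intro!: linearI[OF G.vs hs] linearI[OF D.vs hs] simp: lin_simps)
qed

section \<open>Normal ordering of \<gamma> and \<Omega> monomials against \<omega>\<close>

definition fgaw :: "'n \<Rightarrow> 'n list \<Rightarrow> 'h" where
  "fgaw k L = fm k (hd L) * gaw (tl L)"

lemma gaw_Cons: "gaw (j # J) = ga j * gaw J"
  by (simp add: demb_mult)

lemma braid_op_fgaw: "J \<noteq> [] \<Longrightarrow> braid_op (hsmult E) \<sigma> 0 (fgaw k) (j # J) = ga j * fgaw k J"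
  by (cases J) (simp_all add: braid_op_def fgaw_def mult.assoc[symmetric] dform_fmat sum_distrib_right H_scale demb_mult)

text \<open>Each \<gamma> may contract with \<omega> into an f, which then travels left through the
  preceding \<gamma>; every passage is one \<sigma>, and the contractions add up to
  \<open>shuffle_op\<close>. In \<open>fgaw k L\<close> the head of \<open>L\<close> is the lower
  index of f and the tail indexes the \<gamma>, so that all contractions are braidings of one
  family.\<close>

lemma gaw_form:
  "gaw J * om k = hsmult E ((-1) ^ length J) (om k * gaw J - shuffle_op (hsmult E) \<sigma> (length J) (fgaw k) J)"
proof (induction J)
  case Nil
  then show ?case by (simp add: demb_one shuffle_op_def)
next
  case (Cons j J)
  have sh: "shuffle_op (hsmult E) \<sigma> (length J) (\<lambda>L. braid_op (hsmult E) \<sigma> 0 (fgaw k) (j # L)) J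
      = ga j * shuffle_op (hsmult E) \<sigma> (length J) (fgaw k) J"
  proof (cases "J = []")
    case False
    have "shuffle_op (hsmult E) \<sigma> (length J) (\<lambda>L. braid_op (hsmult E) \<sigma> 0 (fgaw k) (j # L)) J
        = (\<Sum>i\<in>{()}. ga j * shuffle_op (hsmult E) \<sigma> (length J) (fgaw k) J)"
      by (rule shuffle_op_natural[OF linear_mult_left hs]) (use False in \<open>auto intro!: braid_op_fgaw\<close>)
    then show ?thesis by simp
  qed (simp add: shuffle_op_def)
  have "gaw (j # J) * om k = hsmult E ((-1) ^ length J)
      (ga j * om k * gaw J - ga j * shuffle_op (hsmult E) \<sigma> (length J) (fgaw k) J)"
    by (simp only: gaw_Cons mult.assoc Cons.IH) (simp add: H_scale right_diff_distrib)
  also have "\<dots> = hsmult E ((-1) ^ length J)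
      (shuffle_op (hsmult E) \<sigma> (length (j # J)) (fgaw k) (j # J) - om k * gaw (j # J))"
    by (simp add: shuffle_op_Suc[OF hs] sh dform_form left_diff_distrib fgaw_def demb_mult mult.assoc)
  finally show ?case by (simp add: HA.scale_right_diff_distrib)
qed

lemma vac_gaw_omw_zero: "length K < length J \<Longrightarrow> vac (gaw J * omw K) = 0"
proof (induction K arbitrary: J)
  case Nil
  then show ?case using D.counit_comp[OF wedge_dform_comp] by (simp add: emb_one vac_demb)
next
  case (Cons k K)
  have J: "length K < length J" using Cons.prems by simp
  have lin: "Vector_Spaces.linear (hsmult E) (smult (ext E)) (\<lambda>z. vac (z * omw K))"
    by (rule linear_comp[OF linear_mult_right vac_linear])
  have fz: "vac (fgaw k L * omw K) = 0" if "length L = length J" for L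
  proof -
    have "vac (fgaw k L * omw K) = vac (fm k (hd L) * emb E (vac (gaw (tl L) * omw K)))"
      unfolding fgaw_def mult.assoc by (rule vac_mult)
    then show ?thesis using Cons that by (simp add: lin_simps vac_simps)
  qed
  have sh: "vac (shuffle_op (hsmult E) \<sigma> (length J) (fgaw k) J * omw K) = 0"
  proof -
    have "shuffle_op (smult (ext E)) \<sigma> (length J) (\<lambda>L. vac (fgaw k L * omw K)) J
        = (\<Sum>i\<in>{()}. vac (shuffle_op (hsmult E) \<sigma> (length J) (fgaw k) J * omw K))"
      by (rule shuffle_op_natural[OF lin G.vs]) auto
    moreover have "shuffle_op (smult (ext E)) \<sigma> (length J) (\<lambda>L. vac (fgaw k L * omw K)) J
        = (\<Sum>i\<in>{}. shuffle_op (smult (ext E)) \<sigma> (length J) (\<lambda>_. 0) J)"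
      by (rule shuffle_op_natural[of _ "smult (ext E)" _ "\<lambda>_ x. x", OF _ G.vs]) (auto simp: fz)
    ultimately show ?thesis by simp
  qed
  have "vac (gaw J * omw (k # K)) = vac (gaw J * om k * omw K)" by (simp add: emb_mult mult.assoc)
  also have "\<dots> = 0"
    using Cons.IH[OF J] sh
    by (simp add: gaw_form lin_simps vac_simps left_diff_distrib HA.scale_right_diff_distrib mult.assoc vac_emb_mult)
  finally show ?case .
qed

text \<open>The product of the signs collected from \<open>gaw_form\<close>, equal to
  (-1)^(n(n-1)/2); what matters later is that it is nonzero.\<close>

definition reorder_sign :: "nat \<Rightarrow> 'k" where
  "reorder_sign n = (\<Prod>i<n. - ((-1) ^ Suc i))"

lemma reorder_sign_simps: "reorder_sign 0 = 1" "reorder_sign (Suc n) = - ((-1) ^ Suc n) * reorder_sign n" "reorder_sign n \<noteq> 0"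
  by (simp_all add: reorder_sign_def)

text \<open>After one contraction the other \<gamma> and \<omega> pair by induction, f contributes
  its counit, and \<open>antisym_shuffle\<close> reassembles A. The term in which \<omega> passes
  all \<gamma> has too many \<gamma> left and vanishes by \<open>vac_gaw_omw_zero\<close>.\<close>

lemma vac_gaw_omw:
  "length J = n \<Longrightarrow> length K = n \<Longrightarrow>
    vac (gaw J * omw K) = smult (ext E) (reorder_sign n * antisym \<sigma> n 1 n J K) 1"
proof (induction n arbitrary: J K)
  case 0
  then show ?case by (simp add: vac_demb D.counit_one emb_one reorder_sign_simps tid_def)
next
  case (Suc n)
  then obtain k K' where K: "K = k # K'" "length K' = n" by (cases K) auto
  have lin: "Vector_Spaces.linear (hsmult E) (smult (ext E)) (\<lambda>z. vac (z * omw K'))"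
    by (rule linear_comp[OF linear_mult_right vac_linear])
  have lin1: "Vector_Spaces.linear (*) (smult (ext E)) (\<lambda>c. smult (ext E) (reorder_sign n * c) 1)"
    by (rule linearI[OF vector_space_mult G.vs]) (auto simp: lin_simps mult_ac)
  have fz: "vac (fgaw k L * omw K') = smult (ext E) (reorder_sign n * (of_bool (hd L = k) * antisym \<sigma> n 1 n (tl L) K')) 1"
    if "length L = Suc n" for L
  proof -
    have "vac (fgaw k L * omw K') = vac (fm k (hd L) * emb E (vac (gaw (tl L) * omw K')))"
      unfolding fgaw_def mult.assoc by (rule vac_mult)
    also have "\<dots> = smult (ext E) (reorder_sign n * antisym \<sigma> n 1 n (tl L) K') (vac (fm k (hd L)))"
      using that K Suc.IH[of "tl L" K'] by (simp add: lin_simps vac_simps emb_one)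
    finally show ?thesis by (cases "hd L = k") (auto simp: vac_demb counit_fmat)
  qed
  have sh: "vac (shuffle_op (hsmult E) \<sigma> (Suc n) (fgaw k) J * omw K') =
      smult (ext E) (reorder_sign n * antisym \<sigma> (Suc n) 1 (Suc n) J K) 1"
  proof -
    have "shuffle_op (smult (ext E)) \<sigma> (Suc n) (\<lambda>L. vac (fgaw k L * omw K')) J
        = (\<Sum>i\<in>{()}. vac (shuffle_op (hsmult E) \<sigma> (Suc n) (fgaw k) J * omw K'))"
      by (rule shuffle_op_natural[OF lin G.vs, where n = "Suc n"]) (use Suc.prems in auto)
    moreover have "shuffle_op (smult (ext E)) \<sigma> (Suc n) (\<lambda>L. vac (fgaw k L * omw K')) J
        = (\<Sum>i\<in>{()}. smult (ext E) (reorder_sign n * shuffle_op (*) \<sigma> (Suc n) (\<lambda>L. of_bool (hd L = k) * antisym \<sigma> n 1 n (tl L) K') J) 1)"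
      by (rule shuffle_op_natural[OF lin1 G.vs, where n = "Suc n"]) (use Suc.prems fz in auto)
    ultimately show ?thesis
      using antisym_shuffle[OF braid_yang_baxter Suc.prems(1) K(2), of k] K(1) by simp
  qed
  have "vac (gaw J * omw K) = vac (gaw J * om k * omw K')" by (simp add: K emb_mult mult.assoc)
  also have "\<dots> = smult (ext E) (- ((-1) ^ Suc n)) (vac (shuffle_op (hsmult E) \<sigma> (Suc n) (fgaw k) J * omw K'))"
    using vac_gaw_omw_zero[of K' J] K Suc.prems
    by (simp add: gaw_form lin_simps vac_simps left_diff_distrib HA.scale_right_diff_distrib mult.assoc vac_emb_mult)
  finally show ?case unfolding sh by (simp add: reorder_sign_simps mult_ac)
qed

text \<open>Write \<omega> as \<Omega> f and move f through the \<Omega> block by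
  \<open>fmat_Omega\<close>. Because the block is written in reversed order the new index is the
  last one of \<open>K\<close>, and the \<open>n\<close> passages form \<sigma> with index n+1 <-
  1.\<close>

lemma sum_form_Omega:
  "(\<Sum>I\<in>multi n. om k * Omr I * y I) =
   (\<Sum>K\<in>multi (Suc n). Omr K * down_op (hsmult E) \<sigma> n (\<lambda>L. fm k (hd L) * y (tl L)) K)"
proof (induction n arbitrary: y)
  case 0
  then show ?case by (simp add: sum_multi_Suc form_Omega sum_distrib_right mult.assoc)
next
  case (Suc n)
  let ?Y = "\<lambda>L. fm k (hd L) * y (tl L)"
  have down: "(\<Sum>c\<in>UNIV. down_op (hsmult E) \<sigma> n (\<lambda>L. fm k (hd L) * (Omega E c * y (c # tl L))) K)
      = (\<Sum>q\<in>UNIV. Omega E q * down_op (hsmult E) \<sigma> (Suc n) ?Y (q # K))" if K: "length K = Suc n" for K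
  proof -
    have "down_op (hsmult E) \<sigma> n (\<lambda>L. \<Sum>c\<in>UNIV. fm k (hd L) * (Omega E c * y (c # tl L))) K
        = (\<Sum>c\<in>UNIV. down_op (hsmult E) \<sigma> n (\<lambda>L. fm k (hd L) * (Omega E c * y (c # tl L))) K)"
      by (rule down_op_natural[OF linearI[OF hs hs] hs]) auto
    moreover have "down_op (hsmult E) \<sigma> n (\<lambda>L. \<Sum>c\<in>UNIV. fm k (hd L) * (Omega E c * y (c # tl L))) K
        = (\<Sum>q\<in>UNIV. Omega E q * down_op (hsmult E) \<sigma> n (\<lambda>L. braid_op (hsmult E) \<sigma> 0 ?Y (q # L)) K)"
    proof (rule down_op_natural[OF linear_mult_left hs _ K])
      fix L :: "'n list" assume "length L = Suc n"
      then obtain l L' where L: "L = l # L'" by (cases L) auto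
      have "(\<Sum>c\<in>UNIV. fm k l * Omega E c * y (c # L'))
          = (\<Sum>c\<in>UNIV. \<Sum>q\<in>UNIV. \<Sum>a\<in>UNIV. hsmult E (\<sigma> a c q l) (Omega E q * fm k a * y (c # L')))"
        by (simp add: fmat_Omega sum_distrib_right H_scale)
      also have "\<dots> = (\<Sum>q\<in>UNIV. \<Sum>c\<in>UNIV. \<Sum>a\<in>UNIV. hsmult E (\<sigma> a c q l) (Omega E q * fm k a * y (c # L')))"
        by (rule sum.swap)
      also have "\<dots> = (\<Sum>q\<in>UNIV. \<Sum>a\<in>UNIV. \<Sum>c\<in>UNIV. hsmult E (\<sigma> a c q l) (Omega E q * fm k a * y (c # L')))"
        by (intro sum.cong refl sum.swap)
      finally show "(\<Sum>c\<in>UNIV. fm k (hd L) * (Omega E c * y (c # tl L)))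
          = (\<Sum>q\<in>UNIV. Omega E q * braid_op (hsmult E) \<sigma> 0 ?Y (q # L))"
        by (simp add: L braid_op_def sum_distrib_left H_scale mult.assoc)
    qed
    ultimately show ?thesis by (simp only: down_op_Suc)
  qed
  have "(\<Sum>I\<in>multi (Suc n). om k * Omr I * y I) = (\<Sum>c\<in>UNIV. \<Sum>I\<in>multi n. om k * Omr I * (Omega E c * y (c # I)))"
    by (simp add: sum_multi_Suc mult.assoc)
  also have "\<dots> = (\<Sum>K\<in>multi (Suc n). Omr K * (\<Sum>c\<in>UNIV. down_op (hsmult E) \<sigma> n (\<lambda>L. fm k (hd L) * (Omega E c * y (c # tl L))) K))"
    unfolding Suc.IH by (subst sum.swap) (simp add: sum_distrib_left)
  also have "\<dots> = (\<Sum>K\<in>multi (Suc n). \<Sum>q\<in>UNIV. Omr (q # K) * down_op (hsmult E) \<sigma> (Suc n) ?Y (q # K))"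
    by (rule sum.cong) (simp_all add: down in_multi_iff sum_distrib_left mult.assoc del: down_op.simps)
  also have "\<dots> = (\<Sum>K\<in>multi (Suc (Suc n)). Omr K * down_op (hsmult E) \<sigma> (Suc n) ?Y K)"
    unfolding sum_multi_Suc[of _ "Suc n"] by (rule sum.swap)
  finally show ?case .
qed

lemma sum_Omega_form:
  "(\<Sum>I\<in>multi n. Omr I * om k * y I) = (\<Sum>K\<in>multi (Suc n). Omr K * (fm k (hd K) * y (tl K)))"
  by (simp add: sum_multi_Suc form_Omega sum_distrib_left sum_distrib_right mult.assoc)
     (rule sum.swap)

section \<open>Faithfulness of the action on all forms\<close>

lemma gaw_expansion_exists:
  "\<exists>Z M. (\<forall>m J. Z m J \<in> degree0_span) \<and> z = (\<Sum>m<M. \<Sum>J\<in>multi m. Z m J * gaw J)"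
proof -
  let ?P = "\<lambda>z. \<exists>Z M. (\<forall>m J. Z m J \<in> degree0_span) \<and> z = (\<Sum>m<M. \<Sum>J\<in>multi m. Z m J * gaw J)"
  have add: "?P (z + w)" if z: "?P z" and w: "?P w" for z w
  proof -
    obtain Z M where Z: "\<And>m J. Z m J \<in> degree0_span" "z = (\<Sum>m<M. \<Sum>J\<in>multi m. Z m J * gaw J)" using z by blast
    obtain W N where W: "\<And>m J. W m J \<in> degree0_span" "w = (\<Sum>m<N. \<Sum>J\<in>multi m. W m J * gaw J)" using w by blast
    let ?V = "\<lambda>m J. (if m < M then Z m J else 0) + (if m < N then W m J else 0)"
    have "z = (\<Sum>m<max M N. \<Sum>J\<in>multi m. (if m < M then Z m J else 0) * gaw J)"
      unfolding Z(2) by (rule sum.mono_neutral_cong_left) auto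
    moreover have "w = (\<Sum>m<max M N. \<Sum>J\<in>multi m. (if m < N then W m J else 0) * gaw J)"
      unfolding W(2) by (rule sum.mono_neutral_cong_left) auto
    ultimately have "z + w = (\<Sum>m<max M N. \<Sum>J\<in>multi m. ?V m J * gaw J)"
      by (simp only: distrib_right sum.distrib)
    moreover have "?V m J \<in> degree0_span" for m J
      using Z(1) W(1) by (auto intro: degree0_span_zero degree0_span_add)
    ultimately show ?thesis by (intro exI[of _ ?V] exI[of _ "max M N"]) blast
  qed
  have zero: "?P 0" by (intro exI[of _ "\<lambda>_ _. 0"] exI[of _ 0]) (simp add: degree0_span_zero)
  have hom: "?P (emb E x * demb E \<phi>)" if \<phi>: "\<phi> \<in> component (dext E) n" for x \<phi> n
  proof -
    obtain u where u: "\<phi> = (\<Sum>I\<in>multi n. u I * wedge (dform E) I)" "\<And>I. u I \<in> component (dext E) 0"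
      using \<phi> dext_span[of n] by auto
    let ?Z = "\<lambda>m J. if m = n then emb E x * demb E (u J) else 0"
    have "emb E x * demb E \<phi> = (\<Sum>J\<in>multi n. emb E x * demb E (u J) * gaw J)"
      by (simp add: u(1) linear_sum[OF demb_linear] sum_distrib_left demb_mult mult.assoc)
    also have "\<dots> = (\<Sum>m<Suc n. \<Sum>J\<in>multi m. ?Z m J * gaw J)" by simp
    finally show ?thesis
      using u(2) by (intro exI[of _ ?Z] exI[of _ "Suc n"]) (auto intro: degree0_span_zero degree0_span_emb_demb)
  qed
  have gen: "?P (emb E x * demb E \<phi>)" for x \<phi>
  proof -
    obtain c F where c: "\<And>n. c n \<in> component (dext E) n" "finite F" "\<And>n. n \<notin> F \<Longrightarrow> c n = 0" "\<phi> = (\<Sum>n\<in>F. c n)"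
      using D.decomposition_exists[of \<phi>] by blast
    have "?P (\<Sum>n\<in>F. emb E x * demb E (c n))"
      using c(2)
    proof (induction F)
      case empty
      then show ?case using zero by simp
    next
      case (insert n F)
      then show ?case using add[OF hom[OF c(1)[of n], of x] insert.IH] by (simp only: sum.insert[OF insert.hyps])
    qed
    then show ?thesis by (simp add: c(4) linear_sum[OF demb_linear] sum_distrib_left)
  qed
  obtain t where t: "z = (\<Sum>(x, \<phi>)\<leftarrow>t. emb E x * demb E \<phi>)" using heisenberg_span by blast
  have "?P (\<Sum>(x, \<phi>)\<leftarrow>t. emb E x * demb E \<phi>)" for t
  proof (induction t)
    case Nil
    then show ?case using zero by simp
  next
    case (Cons p t)
    then show ?case using add[OF gen[of "fst p" "snd p"] Cons.IH] by (simp only: list.map sum_list.Cons split_def)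
  qed
  then show ?thesis using t by simp
qed

lemma gaw_mult_degree0:
  assumes "a \<in> component (ext E) 0"
  shows "gaw J * emb E a = emb E a * gaw J"
proof (induction J)
  case (Cons j J)
  have "gaw (j # J) * emb E a = ga j * emb E a * gaw J"
    by (simp only: gaw_Cons mult.assoc Cons.IH)
  then show ?case by (simp only: gaw_Cons dform_mult_degree0[OF assms] mult.assoc)
qed (simp add: demb_one)

text \<open>The action is triangular in the number of \<gamma>: a test form with \<open>m\<close>
  factors \<omega> is annihilated by all terms with more than \<open>m\<close> factors \<gamma>, and
  the terms with fewer vanish by induction. What survives is the coefficient family contracted with
  A, to which \<open>faithful_degree0\<close> applies.\<close>

lemma faithful:
  assumes zero: "\<And>x n. x \<in> component (ext E) n \<Longrightarrow> vac (z * emb E x) = 0"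
  shows "z = 0"
proof -
  obtain Z M where Z: "\<And>m J. Z m J \<in> degree0_span" and z: "z = (\<Sum>m<M. \<Sum>J\<in>multi m. Z m J * gaw J)"
    using gaw_expansion_exists[of z] by blast
  have "(\<Sum>J\<in>multi m. Z m J * gaw J) = 0" if "m < M" for m
    using that
  proof (induction m rule: less_induct)
    case (less m)
    have act: "vac (Z m' J * gaw J * emb E (a * wedge (form E) K)) = vac (Z m' J * emb E a * emb E (vac (gaw J * omw K)))"
      if a: "a \<in> component (ext E) 0" for a m' J K
    proof -
      have "Z m' J * gaw J * emb E (a * wedge (form E) K) = Z m' J * emb E a * (gaw J * omw K)"
        by (simp add: emb_mult mult.assoc[symmetric]) (simp add: mult.assoc gaw_mult_degree0[OF a, symmetric])
      then show ?thesis using vac_mult by metis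
    qed
    have y: "(\<Sum>J\<in>multi m. hsmult E (antisym \<sigma> m 1 m J K) (Z m J)) = 0" if K: "K \<in> multi m" for K
    proof (rule faithful_degree0)
      show "(\<Sum>J\<in>multi m. hsmult E (antisym \<sigma> m 1 m J K) (Z m J)) \<in> degree0_span"
        by (intro degree0_span_sum degree0_span_scale Z)
      fix a assume a: "a \<in> component (ext E) 0"
      have summand: "(\<Sum>J\<in>multi m'. vac (Z m' J * gaw J * emb E (a * wedge (form E) K)))
          = (if m' = m then smult (ext E) (reorder_sign m) (vac ((\<Sum>J\<in>multi m. hsmult E (antisym \<sigma> m 1 m J K) (Z m J)) * emb E a)) else 0)"
        if m': "m' < M" for m'
      proof (cases m' m rule: linorder_cases)
        case less
        have "(\<Sum>J\<in>multi m'. vac (Z m' J * gaw J * emb E (a * wedge (form E) K)))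
            = vac ((\<Sum>J\<in>multi m'. Z m' J * gaw J) * emb E (a * wedge (form E) K))"
          by (simp add: sum_distrib_right linear_sum[OF vac_linear])
        then show ?thesis using less.IH[OF less m'] less by (simp add: vac_simps)
      next
        case equal
        have "(\<Sum>J\<in>multi m. vac (Z m J * gaw J * emb E (a * wedge (form E) K)))
            = (\<Sum>J\<in>multi m. smult (ext E) (reorder_sign m) (vac (hsmult E (antisym \<sigma> m 1 m J K) (Z m J) * emb E a)))"
          unfolding act[OF a] using K
          by (intro sum.cong refl) (simp add: vac_gaw_omw in_multi_iff lin_simps vac_simps emb_one)
        then show ?thesis
          using equal by (simp add: sum_distrib_right linear_sum[OF vac_linear] GA.scale_sum_right)
      next
        case greater
        then show ?thesis
          unfolding act[OF a] using K by (simp add: vac_gaw_omw_zero in_multi_iff lin_simps vac_simps)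
      qed
      have "a * wedge (form E) K \<in> component (ext E) m"
        using G.mult_comp[OF a wedge_form_comp[of K]] K by (simp add: in_multi_iff)
      then have "0 = vac (z * emb E (a * wedge (form E) K))" using zero by simp
      also have "\<dots> = (\<Sum>m'<M. \<Sum>J\<in>multi m'. vac (Z m' J * gaw J * emb E (a * wedge (form E) K)))"
        by (simp add: z sum_distrib_right linear_sum[OF vac_linear])
      also have "\<dots> = smult (ext E) (reorder_sign m) (vac ((\<Sum>J\<in>multi m. hsmult E (antisym \<sigma> m 1 m J K) (Z m J)) * emb E a))"
        using less.prems by (simp add: summand)
      finally show "vac ((\<Sum>J\<in>multi m. hsmult E (antisym \<sigma> m 1 m J K) (Z m J)) * emb E a) = 0"
        using reorder_sign_simps(3)[of m] by simp
    qed
    \<comment> \<open>Only the contracted coefficients are known to vanish, not the coefficients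
      themselves; the wedge relations of the \<gamma> bridge the gap.\<close>
    show ?case
    proof (rule sum_numeric_kernel[OF hs finite_multi, where T = "multi m" and A = "\<lambda>K J. antisym \<sigma> m 1 m J K"
          and B = "\<lambda>J c. hsmult E c (gaw J)" and G = "\<lambda>J w. w * gaw J" and D = "\<lambda>b w. b * w"
          and u = "hsmult E" and u' = "hsmult E"])
      show "(\<Sum>J\<in>multi m. hsmult E (c J) (gaw J)) = 0"
        if "\<And>K. K \<in> multi m \<Longrightarrow> (\<Sum>J\<in>multi m. antisym \<sigma> m 1 m J K * c J) = 0" for c
        by (rule dext_wedge_numeric) (use that in \<open>simp add: mult.commute\<close>)
    qed (use y in \<open>auto simp: H_scale intro: linear_scale_vector linear_mult_right linear_mult_left\<close>)
  qed
  then show ?thesis by (simp add: z)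
qed

section \<open>The Maurer--Cartan equation\<close>

text \<open>The counit on the vacuum leaves only terms with \<open>\<phi>2\<close> of degree 0. Then
  \<open>\<phi>1\<close> and any \<open>x2\<close> pairing with it both have degree
  \<open>m\<close>, so all surviving terms carry the same sign.\<close>

lemma vac_cross_sign:
  assumes \<phi>: "\<phi> \<in> component (dext E) m" and x: "x \<in> component (ext E) n"
  shows "vac (demb E \<phi> * emb E x) = smult (ext E) (koszul m n * koszul m m) (lact E \<phi> x)"
proof -
  have "vac (demb E \<phi> * emb E x) = (\<Sum>(\<phi>1, \<phi>2)\<leftarrow>coprod (dext E) \<phi>. \<Sum>(x1, x2)\<leftarrow>coprod (ext E) x.
      smult (ext E) (koszul m n * koszul (deg (dext E) \<phi>1) (deg (ext E) x2) * pair E \<phi>1 x2 * counit (dext E) \<phi>2) x1)"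
    by (simp add: cross_mult[OF \<phi> x] split_def linear_sum_list[OF vac_linear] vac_simps vac_emb_demb)
  also have "\<dots> = (\<Sum>(\<phi>1, \<phi>2)\<leftarrow>coprod (dext E) \<phi>. \<Sum>(x1, x2)\<leftarrow>coprod (ext E) x.
      smult (ext E) (koszul m n * koszul m m) (smult (ext E) (counit (dext E) \<phi>2) (smult (ext E) (pair E \<phi>1 x2) x1)))"
  proof (intro sum_list_cong_set, clarify, intro sum_list_cong_set, clarify)
    fix \<phi>1 \<phi>2 x1 x2 assume a: "(\<phi>1, \<phi>2) \<in> set (coprod (dext E) \<phi>)" "(x1, x2) \<in> set (coprod (ext E) x)"
    obtain p q where p: "p + q = m" "\<phi>1 \<in> component (dext E) p" "\<phi>2 \<in> component (dext E) q"
      using D.coprod_comp[OF \<phi> a(1)] by blast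
    obtain q' where q': "x2 \<in> component (ext E) q'" using G.coprod_comp[OF x a(2)] by blast
    have "koszul (deg (dext E) \<phi>1) (deg (ext E) x2) * pair E \<phi>1 x2 * counit (dext E) \<phi>2
        = koszul m m * pair E \<phi>1 x2 * counit (dext E) \<phi>2"
    proof (cases "pair E \<phi>1 x2 = 0 \<or> counit (dext E) \<phi>2 = 0")
      case False
      then have "q = 0" using D.counit_comp[OF p(3)] by blast
      then have "p = m" "q' = m" using p(1) pair_comp[OF p(2) q'] False by auto
      moreover have "\<phi>1 \<noteq> 0" "x2 \<noteq> 0" using False by (auto simp: lin_simps)
      ultimately show ?thesis using D.deg_eq[OF p(2)] G.deg_eq[OF q'] by simp
    qed auto
    then show "smult (ext E) (koszul m n * koszul (deg (dext E) \<phi>1) (deg (ext E) x2) * pair E \<phi>1 x2 * counit (dext E) \<phi>2) x1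
        = smult (ext E) (koszul m n * koszul m m) (smult (ext E) (counit (dext E) \<phi>2) (smult (ext E) (pair E \<phi>1 x2) x1))"
      by (simp add: mult.assoc mult.left_commute mult.commute)
  qed
  also have "\<dots> = smult (ext E) (koszul m n * koszul m m) (\<Sum>(\<phi>1, \<phi>2)\<leftarrow>coprod (dext E) \<phi>. smult (ext E) (counit (dext E) \<phi>2) (lact E \<phi>1 x))"
    by (simp add: lact_def split_def linear_sum_list[OF GA.linear_scale_self])
  also have "\<dots> = smult (ext E) (koszul m n * koszul m m) (lact E \<phi> x)"
    by (simp add: D.sum_counit_right[OF lact_linear_left])
  finally show ?thesis .
qed

lemma counit_lact: "counit (ext E) (lact E \<phi> a) = pair E \<phi> a"
proof -
  have "counit (ext E) (lact E \<phi> a) = (\<Sum>(x1, x2)\<leftarrow>coprod (ext E) a. counit (ext E) x1 * pair E \<phi> x2)"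
    by (simp add: lact_def split_def linear_sum_list[OF G.counit_linear] lin_simps mult.commute)
  also have "\<dots> = pair E \<phi> a" by (rule G.sum_counit_left[OF pair_linear_right])
  finally show ?thesis .
qed

lemma pair_dform_diff:
  assumes a: "a \<in> component (ext E) 0"
  shows "pair E (dform E j) (diff E a) = pair E (vfield E j) a"
proof -
  have "pair E (dform E j) (diff E a) = (\<Sum>i\<in>UNIV. pair E (1 * dform E j) (lact E (vfield E i) a * form E i))"
    by (simp add: diff_vfield[OF a] linear_sum[OF pair_linear_right])
  also have "\<dots> = (\<Sum>i\<in>UNIV. if i = j then pair E (vfield E i) a else 0)"
    by (rule sum.cong)
       (auto simp: pair_dform_form[OF D.one_comp lact_comp[OF vfield_comp a], simplified] pair_one_left counit_lact)
  finally show ?thesis by simp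
qed

text \<open>In the coproduct of d\<omega>, \<gamma> paired with the second leg leaves only \<omega>
  \<otimes> d r, with a minus sign because \<omega> is odd; \<open>pair_dform_diff\<close> turns
  <\<gamma>, d r> into <\<chi>, r>, a structure constant. The other terms vanish by degree.\<close>

lemma lact_dform_diff_form:
  "lact E (dform E j) (diff E (form E k)) = - (\<Sum>i\<in>UNIV. smult (ext E) (struct_const E k i j) (form E i))"
proof -
  let ?p = "pair E (dform E j)"
  have lin: "Vector_Spaces.linear (smult (ext E)) (smult (ext E)) (\<lambda>x. smult (ext E) (?p y) x)"
    "Vector_Spaces.linear (smult (ext E)) (smult (ext E)) (\<lambda>y. smult (ext E) (?p y) x)" for x y
    by (auto intro!: linearI[OF G.vs G.vs] simp: lin_simps mult.commute)
  have "lact E (dform E j) (diff E (form E k))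
      = (\<Sum>(x1, x2)\<leftarrow>coprod (ext E) (form E k). smult (ext E) (?p x2) (diff E x1)) +
        (\<Sum>(x1, x2)\<leftarrow>coprod (ext E) (form E k). smult (ext E) (?p (diff E x2)) (smult (ext E) ((-1) ^ deg (ext E) x1) x1))"
    unfolding lact_def tensor_eq_sum[OF diff_coprod[OF form_comp] G.vs lin] by (simp add: split_def o_def)
  \<comment> \<open>Where d \<open>x2\<close> pairs with \<gamma>, \<open>x2\<close> has degree 0
    and \<open>x1\<close> has degree 1. Replacing the sign by -1 makes the summand bilinear, so that
    \<open>coprod_form\<close> can be inserted.\<close>
  also have "(\<Sum>(x1, x2)\<leftarrow>coprod (ext E) (form E k). smult (ext E) (?p (diff E x2)) (smult (ext E) ((-1) ^ deg (ext E) x1) x1))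
      = (\<Sum>(x1, x2)\<leftarrow>coprod (ext E) (form E k). - smult (ext E) (?p (diff E x2)) x1)"
  proof (rule sum_list_cong_set, clarify)
    fix x1 x2 assume "(x1, x2) \<in> set (coprod (ext E) (form E k))"
    then obtain p q where pq: "p + q = 1" "x1 \<in> component (ext E) p" "x2 \<in> component (ext E) q"
      using G.coprod_comp[OF form_comp] by blast
    show "smult (ext E) (?p (diff E x2)) (smult (ext E) ((-1) ^ deg (ext E) x1) x1) = - smult (ext E) (?p (diff E x2)) x1"
    proof (cases "q = 0 \<and> x1 \<noteq> 0")
      case True
      then show ?thesis using pq G.deg_eq[of x1 1] by simp
    next
      case False
      then have "?p (diff E x2) = 0 \<or> x1 = 0" using pair_comp[OF dform_comp diff_comp[OF pq(3)], of j] by auto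
      then show ?thesis by auto
    qed
  qed
  also have "(\<Sum>(x1, x2)\<leftarrow>coprod (ext E) (form E k). smult (ext E) (?p x2) (diff E x1)) + \<dots>
      = (\<Sum>(x1, x2)\<leftarrow>coprod (ext E) (form E k). smult (ext E) (?p x2) (diff E x1) - smult (ext E) (?p (diff E x2)) x1)"
    by (simp add: split_def sum_list_addf[symmetric])
  also have "\<dots> = (\<Sum>(x1, x2)\<leftarrow>(1, form E k) # [(form E j, rmat E k j). j \<leftarrow> all_indices].
      smult (ext E) (?p x2) (diff E x1) - smult (ext E) (?p (diff E x2)) x1)"
    by (rule tensor_eq_sum[OF coprod_form G.vs])
       (auto intro!: linearI[OF G.vs G.vs] simp: lin_simps mult.commute GA.scale_right_diff_distrib)
  also have "\<dots> = (\<Sum>i\<in>UNIV. - smult (ext E) (struct_const E k i j) (form E i))"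
    using pair_comp[OF dform_comp diff_comp[OF form_comp], of j k] pair_comp[OF dform_comp rmat_comp, of j k]
    by (simp add: o_def sum_list_all_indices diff_one pair_dform_diff[OF rmat_comp] struct_const_def)
  finally show ?thesis by (simp add: sum_negf)
qed

lemma antisym_two_ext: "(\<Sum>J\<in>multi 2. smult (ext E) (antisym \<sigma> 2 1 2 [i, j] J) (w J)) =
   w [i, j] - (\<Sum>m\<in>UNIV. \<Sum>n\<in>UNIV. smult (ext E) (\<sigma> m n i j) (w [m, n]))"
  and antisym_two_num: "(\<Sum>J\<in>multi 2. antisym \<sigma> 2 1 2 [i, j] J * u J) =
   u [i, j] - (\<Sum>m\<in>UNIV. \<Sum>n\<in>UNIV. \<sigma> m n i j * u [m, n])"
proof -
  have gen: "(\<Sum>J\<in>multi 2. s (antisym \<sigma> 2 1 2 [i, j] J) (v J)) =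
      v [i, j] - (\<Sum>m\<in>UNIV. \<Sum>n\<in>UNIV. s (\<sigma> m n i j) (v [m, n]))"
    if s: "vector_space s" for s :: "'k \<Rightarrow> 'w::ab_group_add \<Rightarrow> 'w" and v
  proof -
    interpret vector_space s by fact
    show ?thesis
      using tensor_app_antisym[OF s braid_yang_baxter, of "[i, j]" 2 2 0 v]
      by (simp add: tensor_app_def numeral_2_eq_2 braid_op_def)
  qed
  show "(\<Sum>J\<in>multi 2. smult (ext E) (antisym \<sigma> 2 1 2 [i, j] J) (w J)) =
   w [i, j] - (\<Sum>m\<in>UNIV. \<Sum>n\<in>UNIV. smult (ext E) (\<sigma> m n i j) (w [m, n]))" by (rule gen[OF G.vs])
  show "(\<Sum>J\<in>multi 2. antisym \<sigma> 2 1 2 [i, j] J * u J) =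
   u [i, j] - (\<Sum>m\<in>UNIV. \<Sum>n\<in>UNIV. \<sigma> m n i j * u [m, n])" by (rule gen[OF vector_space_mult])
qed

lemma vac_fmat_form: "vac (fm i j * om k) = (\<Sum>m\<in>UNIV. smult (ext E) (\<sigma> i k m j) (form E m))"
  by (simp add: vac_cross[OF fmat_comp form_comp] lact_form[OF fmat_comp] braid_def)

lemma sum_multi_two: "(\<Sum>I\<in>multi 2. f I) = (\<Sum>m\<in>UNIV. \<Sum>n\<in>UNIV. f [m, n])"
  for f :: "'n list \<Rightarrow> 'w::comm_monoid_add"
  by (simp add: numeral_2_eq_2 sum_multi_Suc)

lemma in_multi_two: "I \<in> multi 2 \<Longrightarrow> \<exists>i j. I = [i, j]"
  by (auto simp: in_multi_iff numeral_2_eq_2 length_Suc_conv)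

lemma sum_of_bool_scale:
  assumes "vector_space s"
  shows "(\<Sum>n\<in>UNIV. s (of_bool (n = j)) (f n)) = f (j :: 'n)"
proof -
  interpret vector_space s by fact
  have "(\<Sum>n\<in>UNIV. s (of_bool (n = j)) (f n)) = (\<Sum>n\<in>UNIV. if n = j then f n else 0)"
    by (rule sum.cong) auto
  then show ?thesis by simp
qed

text \<open>Applying \<gamma> to d\<omega> = s \<omega>\<omega> with s in \<A> shows that s
  contracted with A is -C times 1. The counits of s are then numbers with the same contraction,
  hence they give the same two-form. They also show that the initial condition is solvable.\<close>

lemma maurer_cartan_exists:
  obtains c where "\<And>i j. (\<Sum>J\<in>multi 2. antisym \<sigma> 2 1 2 [i, j] J * c J) = - struct_const E k i j"
    and "diff E (form E k) = (\<Sum>J\<in>multi 2. smult (ext E) (c J) (wedge (form E) J))"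
proof -
  obtain s where s: "diff E (form E k) = (\<Sum>I\<in>multi 2. s I * wedge (form E) I)" "\<And>I. s I \<in> component (ext E) 0"
    using diff_comp[OF form_comp, of k] ext_span[of "Suc 1"] by (auto simp: numeral_2_eq_2)
  have red: "(\<Sum>m\<in>UNIV. \<Sum>n\<in>UNIV. smult (ext E) (\<sigma> m n q j) (s [m, n])) - s [q, j] = smult (ext E) (struct_const E k q j) 1" for q j
  proof -
    have cross: "vac (ga j * emb E (diff E (form E k))) = (\<Sum>i\<in>UNIV. smult (ext E) (struct_const E k i j) (form E i))"
      unfolding vac_cross_sign[OF dform_comp diff_comp[OF form_comp]] lact_dform_diff_form
      by (simp add: koszul_def)
    have gw: "vac (ga j * om m * om n) = (\<Sum>q\<in>UNIV. smult (ext E) (\<sigma> m n q j) (form E q)) - smult (ext E) (of_bool (n = j)) (form E m)" for m n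
    proof -
      have "ga j * om m * om n = fm m j * om n - om m * fm n j + om m * om n * ga j"
        by (simp add: dform_form left_diff_distrib mult.assoc right_diff_distrib)
      then have "vac (ga j * om m * om n) = vac (fm m j * om n) - vac (om m * fm n j) + vac (om m * om n * ga j)"
        by (simp add: vac_simps)
      then show ?thesis by (simp add: vac_fmat_form vac_emb_demb vac_mult_demb counit_fmat counit_dform)
    qed
    have "(\<Sum>i\<in>UNIV. smult (ext E) (struct_const E k i j) (form E i))
        = (\<Sum>m\<in>UNIV. \<Sum>n\<in>UNIV. vac (emb E (s [m, n]) * (ga j * om m * om n)))"
    proof -
      have "ga j * emb E (s [m, n] * wedge (form E) [m, n]) = emb E (s [m, n]) * (ga j * om m * om n)" for m n
        by (simp add: emb_mult mult.assoc[symmetric] dform_mult_degree0[OF s(2)])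
      then show ?thesis
        unfolding cross[symmetric] s(1) by (simp only: sum_multi_two linear_sum[OF emb_linear] linear_sum[OF vac_linear] sum_distrib_left)
    qed
    also have "\<dots> = (\<Sum>m\<in>UNIV. \<Sum>n\<in>UNIV. \<Sum>q\<in>UNIV. smult (ext E) (\<sigma> m n q j) (s [m, n]) * form E q)
        - (\<Sum>m\<in>UNIV. s [m, j] * form E m)"
      unfolding vac_emb_mult gw
      by (simp add: right_diff_distrib sum_subtractf sum_distrib_left lin_simps sum_of_bool_scale[OF G.vs])
    also have "(\<Sum>m\<in>UNIV. \<Sum>n\<in>UNIV. \<Sum>q\<in>UNIV. smult (ext E) (\<sigma> m n q j) (s [m, n]) * form E q)
        = (\<Sum>m\<in>UNIV. \<Sum>q\<in>UNIV. \<Sum>n\<in>UNIV. smult (ext E) (\<sigma> m n q j) (s [m, n]) * form E q)"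
      by (intro sum.cong refl sum.swap)
    also have "\<dots> = (\<Sum>q\<in>UNIV. (\<Sum>m\<in>UNIV. \<Sum>n\<in>UNIV. smult (ext E) (\<sigma> m n q j) (s [m, n])) * form E q)"
      by (subst sum.swap) (simp add: sum_distrib_right)
    finally have "(\<Sum>q\<in>UNIV. ((\<Sum>m\<in>UNIV. \<Sum>n\<in>UNIV. smult (ext E) (\<sigma> m n q j) (s [m, n])) - s [q, j]
        - smult (ext E) (struct_const E k q j) 1) * form E q) = 0"
      by (simp add: left_diff_distrib sum_subtractf lin_simps)
    then have "(\<Sum>m\<in>UNIV. \<Sum>n\<in>UNIV. smult (ext E) (\<sigma> m n q j) (s [m, n])) - s [q, j] - smult (ext E) (struct_const E k q j) 1 = 0"
      by (rule form_independent[rotated]) (intro G.comp_diff G.comp_sum G.comp_scale s(2) G.one_comp)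
    then show ?thesis by simp
  qed
  define c where "c I = counit (ext E) (s I)" for I
  have c: "(\<Sum>m\<in>UNIV. \<Sum>n\<in>UNIV. \<sigma> m n q j * c [m, n]) - c [q, j] = struct_const E k q j" for q j
    using arg_cong[OF red[of q j], of "counit (ext E)"]
    by (simp add: c_def lin_simps linear_sum[OF G.counit_linear] G.counit_one)
  have 1: "(\<Sum>J\<in>multi 2. antisym \<sigma> 2 1 2 [i, j] J * c J) = - struct_const E k i j" for i j
    unfolding antisym_two_num c[symmetric] by simp
  have "(\<Sum>I\<in>multi 2. (s I - smult (ext E) (c I) 1) * wedge (form E) I) = 0"
  proof (subst ext_wedge)
    show "\<forall>I\<in>multi 2. (\<Sum>J\<in>multi 2. smult (ext E) (antisym \<sigma> 2 1 2 I J) (s J - smult (ext E) (c J) 1)) = 0"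
    proof
      fix I :: "'n list" assume "I \<in> multi 2"
      then obtain i j where I: "I = [i, j]" using in_multi_two by blast
      have "(\<Sum>J\<in>multi 2. smult (ext E) (antisym \<sigma> 2 1 2 I J) (s J - smult (ext E) (c J) 1))
          = (\<Sum>J\<in>multi 2. smult (ext E) (antisym \<sigma> 2 1 2 I J) (s J)) - smult (ext E) (\<Sum>J\<in>multi 2. antisym \<sigma> 2 1 2 I J * c J) 1"
        by (simp add: GA.scale_right_diff_distrib sum_subtractf GA.scale_sum_left)
      also have "\<dots> = 0"
        unfolding I 1 antisym_two_ext using red[of i j] by (simp add: algebra_simps)
      finally show "(\<Sum>J\<in>multi 2. smult (ext E) (antisym \<sigma> 2 1 2 I J) (s J - smult (ext E) (c J) 1)) = 0" .
    qed
  qed (intro G.comp_diff s(2) G.comp_scale G.one_comp)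
  then have "diff E (form E k) = (\<Sum>J\<in>multi 2. smult (ext E) (c J) (wedge (form E) J))"
    unfolding s(1) by (simp add: left_diff_distrib sum_subtractf lin_simps)
  with 1 show ?thesis by (rule that)
qed

lemma BRST_initial_iff:
  "BRST_initial E X \<longleftrightarrow> (\<forall>i j k. (\<Sum>J\<in>multi 2. antisym \<sigma> 2 1 2 [i, j] J * X 1 J [k]) = - struct_const E k i j)"
  by (simp add: BRST_initial_def tmul_def)

text \<open>The initial condition fixes \<open>X 1\<close> only after contraction with A, but a
  two-form depends on nothing more.\<close>

lemma maurer_cartan:
  assumes "BRST_initial E X"
  shows "diff E (form E k) = (\<Sum>J\<in>multi 2. smult (ext E) (X 1 J [k]) (wedge (form E) J))"
proof -
  obtain c where c: "\<And>i j. (\<Sum>J\<in>multi 2. antisym \<sigma> 2 1 2 [i, j] J * c J) = - struct_const E k i j"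
    "diff E (form E k) = (\<Sum>J\<in>multi 2. smult (ext E) (c J) (wedge (form E) J))"
    using maurer_cartan_exists[of k] by blast
  have "(\<Sum>J\<in>multi 2. smult (ext E) (c J - X 1 J [k]) (wedge (form E) J)) = 0"
  proof (rule ext_wedge_numeric)
    fix I :: "'n list" assume "I \<in> multi 2"
    then obtain i j where I: "I = [i, j]" using in_multi_two by blast
    show "(\<Sum>J\<in>multi 2. antisym \<sigma> 2 1 2 I J * (c J - X 1 J [k])) = 0"
      using c(1)[of i j] assms unfolding I BRST_initial_iff right_diff_distrib sum_subtractf by simp
  qed
  then show ?thesis by (simp add: c(2) GA.scale_left_diff_distrib sum_subtractf)
qed

section \<open>Commutators with the partial BRST charges\<close>

definition Qpart :: "(nat \<Rightarrow> ('k, 'n) tensor) \<Rightarrow> nat \<Rightarrow> 'h" where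
  "Qpart X R = (\<Sum>i\<in>UNIV. Omega E i * vf i) + (\<Sum>r=1..R. BRST_term E X r)"

definition gcoef :: "(nat \<Rightarrow> ('k, 'n) tensor) \<Rightarrow> nat \<Rightarrow> 'n list \<Rightarrow> 'h" where
  "gcoef X r I = (\<Sum>J\<in>multi r. hsmult E (X r I J) (gaw J))"

definition fgcoef :: "(nat \<Rightarrow> ('k, 'n) tensor) \<Rightarrow> 'n \<Rightarrow> nat \<Rightarrow> 'n list \<Rightarrow> 'h" where
  "fgcoef X k r L = fm k (hd L) * gcoef X r (tl L)"

text \<open>\<open>raise_part\<close> and \<open>contract_part\<close> give the parts of \<open>[Q\<^sub>(\<^sub>r\<^sub>), \<omega>\<^sup>k]\<^sub>+\<close> with \<open>r\<close> and \<open>r - 1\<close> factors \<open>\<gamma>\<close>; the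
  recurrence makes \<open>raise_part\<close> for \<open>r - 1\<close> cancel \<open>contract_part\<close> for \<open>r\<close>.\<close>

definition raise_part :: "(nat \<Rightarrow> ('k, 'n) tensor) \<Rightarrow> 'n \<Rightarrow> nat \<Rightarrow> 'n list \<Rightarrow> 'h" where
  "raise_part X k r K = hsmult E ((-1) ^ r) (fgcoef X k r K) + down_op (hsmult E) \<sigma> (Suc r) (fgcoef X k r) K"

definition contract_part :: "(nat \<Rightarrow> ('k, 'n) tensor) \<Rightarrow> 'n \<Rightarrow> nat \<Rightarrow> 'n list \<Rightarrow> 'h" where
  "contract_part X k r I = - hsmult E ((-1) ^ r) (\<Sum>J\<in>multi r. hsmult E (X r I J) (shuffle_op (hsmult E) \<sigma> r (fgaw k) J))"

section \<open>Commutators with degree zero and with the \<omega>, and the matrices of their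
  parts\<close>

lemma BRST_term_gcoef: "BRST_term E X r = (\<Sum>I\<in>multi (Suc r). Omr I * gcoef X r I)"
  by (simp add: BRST_term_def gcoef_def sum_distrib_left H_scale)

lemma Omr_degree0: "a \<in> component (ext E) 0 \<Longrightarrow> wedge (Omega E) I * emb E a = emb E a * wedge (Omega E) I"
proof (induction I)
  case (Cons i I)
  then have "wedge (Omega E) (i # I) * emb E a = Omega E i * emb E a * wedge (Omega E) I"
    by (simp add: mult.assoc)
  then show ?case using Cons.prems by (simp add: Omega_comm mult.assoc)
qed simp

lemma BRST_term_degree0:
  assumes a: "a \<in> component (ext E) 0"
  shows "BRST_term E X r * emb E a = emb E a * BRST_term E X r"
proof -
  have "Omr I * gaw J * emb E a = emb E a * (Omr I * gaw J)" for I J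
    by (metis Omr_degree0[OF a] gaw_mult_degree0[OF a] mult.assoc)
  then show ?thesis
    by (simp add: BRST_term_def sum_distrib_left sum_distrib_right H_scale)
qed

lemma Qpart_degree0:
  assumes a: "a \<in> component (ext E) 0"
  shows "Qpart X R * emb E a = emb E a * Qpart X R + emb E (diff E a)"
proof -
  have "(\<Sum>i\<in>UNIV. Omega E i * vf i) * emb E a
      = (\<Sum>i\<in>UNIV. Omega E i * emb E a * vf i) + (\<Sum>i\<in>UNIV. \<Sum>k\<in>UNIV. Omega E i * emb E (lact E (vfield E k) a) * fm k i)"
    by (simp add: sum_distrib_right mult.assoc vfield_mult_ext[OF a] distrib_left sum.distrib sum_distrib_left)
  also have "\<dots> = emb E a * (\<Sum>i\<in>UNIV. Omega E i * vf i) + (\<Sum>i\<in>UNIV. \<Sum>k\<in>UNIV. emb E (lact E (vfield E k) a) * (Omega E i * fm k i))"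
    by (simp add: Omega_comm[OF a] Omega_comm[OF lact_comp[OF vfield_comp a]] sum_distrib_left mult.assoc)
  also have "(\<Sum>i\<in>UNIV. \<Sum>k\<in>UNIV. emb E (lact E (vfield E k) a) * (Omega E i * fm k i)) = emb E (diff E a)"
    by (subst sum.swap) (simp add: sum_distrib_left[symmetric] form_Omega[symmetric] diff_vfield[OF a] linear_sum[OF emb_linear] emb_mult)
  finally show ?thesis
    unfolding Qpart_def by (simp add: distrib_left distrib_right sum_distrib_left sum_distrib_right BRST_term_degree0[OF a])
qed

lemma vac_gaw: "J \<noteq> [] \<Longrightarrow> vac (z * gaw J) = 0"
  using D.counit_comp[OF wedge_dform_comp[of J]] by (simp add: vac_mult_demb)

lemma vac_Qpart: "vac (Qpart X R) = 0"
proof -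
  have "vac (BRST_term E X r) = 0" if "r > 0" for r
    using that by (auto simp: BRST_term_def linear_sum[OF vac_linear] vac_simps in_multi_iff vac_gaw intro!: sum.neutral)
  then show ?thesis
    by (simp add: Qpart_def linear_sum[OF vac_linear] vac_simps vac_mult_demb counit_vfield)
qed

lemma BRST_term_form:
  "BRST_term E X r * om k + om k * BRST_term E X r =
   (\<Sum>K\<in>multi (Suc (Suc r)). Omr K * raise_part X k r K) + (\<Sum>I\<in>multi (Suc r). Omr I * contract_part X k r I)"
proof -
  have "gcoef X r I * om k = hsmult E ((-1) ^ r) (om k * gcoef X r I) + contract_part X k r I" for I
    unfolding gcoef_def contract_part_def
    by (simp add: sum_distrib_right sum_distrib_left H_scale gaw_form in_multi_iff HA.scale_right_diff_distrib
        sum_subtractf HA.scale_sum_right mult.commute)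
  then have "BRST_term E X r * om k = hsmult E ((-1) ^ r) (\<Sum>I\<in>multi (Suc r). Omr I * om k * gcoef X r I)
      + (\<Sum>I\<in>multi (Suc r). Omr I * contract_part X k r I)"
    by (simp add: BRST_term_gcoef sum_distrib_right mult.assoc distrib_left sum.distrib H_scale HA.scale_sum_right)
  moreover have "om k * BRST_term E X r = (\<Sum>K\<in>multi (Suc (Suc r)). Omr K * down_op (hsmult E) \<sigma> (Suc r) (fgcoef X k r) K)"
    using sum_form_Omega[of k "gcoef X r" "Suc r"]
    by (simp add: BRST_term_gcoef sum_distrib_left mult.assoc fgcoef_def[abs_def])
  ultimately show ?thesis
    unfolding sum_Omega_form raise_part_def
    by (simp add: fgcoef_def distrib_left sum.distrib HA.scale_sum_right H_scale del: down_op.simps)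
qed

text \<open>Up to the sign (-1)^(r+1) this is the factor ((-1)^(r+1) \<sigma> - 1) X on the right of
  the recurrence for r + 1.\<close>

definition raise_matrix :: "(nat \<Rightarrow> ('k, 'n) tensor) \<Rightarrow> nat \<Rightarrow> 'n list \<Rightarrow> 'n list \<Rightarrow> 'k" where
  "raise_matrix X r I J = (-1) ^ r * shift (X r) I J + down_op (*) \<sigma> (Suc r) (\<lambda>L. shift (X r) L J) I"

lemma raise_part_expand:
  assumes I: "length I = Suc (Suc r)"
  shows "raise_part X k r I = (\<Sum>J\<in>multi (Suc r). hsmult E (raise_matrix X r I J) (fgaw k J))"
proof -
  have fg: "fgcoef X k r L = (\<Sum>J\<in>multi (Suc r). hsmult E (shift (X r) L J) (fgaw k J))" if len: "length L = Suc (Suc r)" for L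
  proof -
    obtain l L' where L: "L = l # L'" using len by (cases L) auto
    have "(\<Sum>J\<in>multi (Suc r). hsmult E (shift (X r) L J) (fgaw k J))
        = (\<Sum>j\<in>UNIV. if j = l then (\<Sum>J\<in>multi r. hsmult E (X r L' J) (fm k j * gaw J)) else 0)"
      unfolding sum_multi_Suc by (rule sum.cong) (auto simp: L shift_def fgaw_def)
    then show ?thesis by (simp add: fgcoef_def gcoef_def L sum_distrib_left H_scale)
  qed
  have "down_op (hsmult E) \<sigma> (Suc r) (fgcoef X k r) I
      = (\<Sum>J\<in>multi (Suc r). hsmult E (down_op (*) \<sigma> (Suc r) (\<lambda>L. shift (X r) L J) I) (fgaw k J))"
    by (rule down_op_natural[OF linear_scale_vector hs fg I])
  then show ?thesis
    unfolding raise_part_def raise_matrix_def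
    by (simp add: fg[OF I] HA.scale_sum_right HA.scale_left_distrib sum.distrib del: down_op.simps)
qed

lemma raise_matrix_app:
  assumes "length I = Suc (Suc r)"
  shows "(\<Sum>J\<in>multi (Suc r). raise_matrix X r I J * a J) =
    (-1) ^ r * (\<Sum>J\<in>multi (Suc r). shift (X r) I J * a J) +
    down_op (*) \<sigma> (Suc r) (\<lambda>L. \<Sum>J\<in>multi (Suc r). shift (X r) L J * a J) I"
proof -
  have "down_op (*) \<sigma> (Suc r) (\<lambda>L. \<Sum>J\<in>multi (Suc r). shift (X r) L J * a J) I
      = (\<Sum>J\<in>multi (Suc r). down_op (*) \<sigma> (Suc r) (\<lambda>L. shift (X r) L J) I * a J)"
    by (rule down_op_natural[OF _ vector_space_mult _ assms])
       (auto intro!: linearI[OF vector_space_mult vector_space_mult] simp: algebra_simps)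
  then show ?thesis
    by (simp add: raise_matrix_def distrib_right sum.distrib sum_distrib_left mult.assoc del: down_op.simps)
qed

lemma BRST_recurrence_iff:
  assumes "r = Suc q"
  shows "BRST_recurrence E X r \<longleftrightarrow> (\<forall>I\<in>multi (Suc r). \<forall>M\<in>multi r.
    (\<Sum>L\<in>multi (Suc r). antisym \<sigma> (Suc r) 1 (Suc r) I L * (\<Sum>K\<in>multi r. X r L K * antisym \<sigma> r 1 r K M)) =
    (-1) ^ r * (\<Sum>L\<in>multi (Suc r). antisym \<sigma> (Suc r) 1 (Suc r) I L * (\<Sum>J\<in>multi r. raise_matrix X q L J * antisym \<sigma> r 2 r J M)))"
proof -
  have "tmul (Suc r) (\<lambda>I J. (-1) ^ r * braid_down \<sigma> (Suc r) (Suc r) 1 I J - tid I J) (tmul r (shift (X q)) (antisym \<sigma> r 2 r)) L M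
      = (-1) ^ r * (\<Sum>J\<in>multi r. raise_matrix X q L J * antisym \<sigma> r 2 r J M)" if L: "L \<in> multi (Suc r)" for L M
  proof -
    let ?W = "\<lambda>L. \<Sum>J\<in>multi r. shift (X q) L J * antisym \<sigma> r 2 r J M"
    have "tmul (Suc r) (\<lambda>I J. (-1) ^ r * braid_down \<sigma> (Suc r) (Suc r) 1 I J - tid I J) (tmul r (shift (X q)) (antisym \<sigma> r 2 r)) L M
        = (-1) ^ r * tensor_app (*) (Suc r) (braid_down \<sigma> (Suc r) (Suc r) 1) ?W L - tensor_app (*) (Suc r) tid ?W L"
      by (simp add: tmul_def tensor_app_def left_diff_distrib sum_subtractf sum_distrib_left mult.assoc)
    also have "\<dots> = (-1) ^ r * down_op (*) \<sigma> r ?W L - ?W L"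
      using L tensor_app_braid_down[OF vector_space_mult braid_yang_baxter, of L "Suc r" r] tensor_app_tid[OF vector_space_mult, of L "Suc r"]
      by (simp add: in_multi_iff)
    also have "\<dots> = (-1) ^ r * ((-1) ^ q * ?W L + down_op (*) \<sigma> r ?W L)"
      by (simp add: assms distrib_left mult.assoc[symmetric] power_add[symmetric] del: down_op.simps)
    finally show ?thesis
      using raise_matrix_app[of L q X "\<lambda>J. antisym \<sigma> r 2 r J M"] L by (simp add: assms in_multi_iff del: down_op.simps)
  qed
  then show ?thesis
    unfolding BRST_recurrence_def Let_def by (simp add: assms tmul_def[of "Suc (Suc q)"] tmul_def[of "Suc q" "X _"] sum_distrib_left mult.left_commute)
qed

declare antisym.simps(2) [simp del] down_op.simps(2) [simp del]

definition contract_matrix :: "(nat \<Rightarrow> ('k, 'n) tensor) \<Rightarrow> nat \<Rightarrow> 'n list \<Rightarrow> 'n list \<Rightarrow> 'k" where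
  "contract_matrix X r I J = (\<Sum>K\<in>multi r. X r I K * shuffle_op (*) \<sigma> r (\<lambda>L. of_bool (L = J)) K)"

lemma sum_of_bool_multi:
  assumes s: "vector_space s" and L: "length L = r"
  shows "(\<Sum>J\<in>multi r. s (of_bool (L = J)) (v J)) = v (L :: 'n list)"
proof -
  interpret vector_space s by fact
  have "(\<Sum>J\<in>multi r. s (of_bool (L = J)) (v J)) = (\<Sum>J\<in>multi r. if J = L then v J else 0)"
    by (rule sum.cong) auto
  then show ?thesis using L by (simp add: in_multi_iff)
qed

lemma contract_part_expand:
  "contract_part X k r I = (\<Sum>J\<in>multi r. hsmult E (- ((-1) ^ r) * contract_matrix X r I J) (fgaw k J))"
proof -
  have sh: "shuffle_op (hsmult E) \<sigma> r (fgaw k) K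
      = (\<Sum>J\<in>multi r. hsmult E (shuffle_op (*) \<sigma> r (\<lambda>L. of_bool (L = J)) K) (fgaw k J))" if "length K = r" for K
    by (rule shuffle_op_natural[OF linear_scale_vector hs _ that]) (simp add: sum_of_bool_multi[OF hs])
  have "(\<Sum>K\<in>multi r. hsmult E (X r I K) (shuffle_op (hsmult E) \<sigma> r (fgaw k) K))
      = (\<Sum>K\<in>multi r. \<Sum>J\<in>multi r. hsmult E (X r I K * shuffle_op (*) \<sigma> r (\<lambda>L. of_bool (L = J)) K) (fgaw k J))"
    by (rule sum.cong) (auto simp: sh in_multi_iff HA.scale_sum_right)
  also have "\<dots> = (\<Sum>J\<in>multi r. hsmult E (contract_matrix X r I J) (fgaw k J))"
    by (subst sum.swap) (simp add: contract_matrix_def HA.scale_sum_left)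
  finally show ?thesis
    by (simp add: contract_part_def HA.scale_sum_right sum_negf)
qed

text \<open>The second recursion for A: the shuffle coming from the contraction, followed by A with
  index 2 -> r, is A with index 1 -> r.\<close>

lemma contract_matrix_app:
  assumes r: "r = Suc q" and M: "length M = r"
  shows "(\<Sum>J\<in>multi r. contract_matrix X r I J * antisym \<sigma> r 2 r J M) = (\<Sum>K\<in>multi r. X r I K * antisym \<sigma> r 1 r K M)"
proof -
  obtain m M' where Mm: "M = m # M'" "length M' = q" using M r by (cases M) auto
  have lm: "Vector_Spaces.linear (*) (*) (\<lambda>c. c * x)" for x :: 'k
    by (rule linearI[OF vector_space_mult vector_space_mult]) (auto simp: algebra_simps)
  have sh: "(\<Sum>J\<in>multi r. shuffle_op (*) \<sigma> r (\<lambda>L. of_bool (L = J)) K * antisym \<sigma> r 2 r J M) = antisym \<sigma> r 1 r K M"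
    if K: "length K = r" for K
  proof -
    have "shuffle_op (*) \<sigma> r (\<lambda>L. antisym \<sigma> r 2 r L M) K
        = (\<Sum>J\<in>multi r. shuffle_op (*) \<sigma> r (\<lambda>L. of_bool (L = J)) K * antisym \<sigma> r 2 r J M)"
      by (rule shuffle_op_natural[OF lm vector_space_mult _ K]) (rule sum_of_bool_multi[OF vector_space_mult, symmetric])
    moreover have "shuffle_op (*) \<sigma> r (\<lambda>L. antisym \<sigma> r 2 r L M) K
        = shuffle_op (*) \<sigma> r (\<lambda>L. of_bool (hd L = m) * antisym \<sigma> q 1 q (tl L) M') K"
    proof (rule shuffle_op_cong[OF vector_space_mult _ K])
      fix L :: "'n list" assume "length L = r"
      then obtain l L' where "L = l # L'" "length L' = q" using r by (cases L) auto
      then show "antisym \<sigma> r 2 r L M = of_bool (hd L = m) * antisym \<sigma> q 1 q (tl L) M'"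
        using antisym_two_Cons[OF braid_yang_baxter, of L' q M' l m] Mm r by simp
    qed
    ultimately show ?thesis
      using antisym_shuffle[OF braid_yang_baxter, of K q M' m] K Mm r by simp
  qed
  have "(\<Sum>J\<in>multi r. contract_matrix X r I J * antisym \<sigma> r 2 r J M)
      = (\<Sum>K\<in>multi r. X r I K * (\<Sum>J\<in>multi r. shuffle_op (*) \<sigma> r (\<lambda>L. of_bool (L = J)) K * antisym \<sigma> r 2 r J M))"
    unfolding contract_matrix_def sum_distrib_right sum_distrib_left mult.assoc by (rule sum.swap)
  also have "\<dots> = (\<Sum>K\<in>multi r. X r I K * antisym \<sigma> r 1 r K M)"
    by (rule sum.cong) (auto simp: sh in_multi_iff)
  finally show ?thesis .
qed

text \<open>For a fixed lower index of f the products f \<gamma> ... \<gamma> inherit the relations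
  of the \<gamma>, and A with index 2 -> q+1 is the identity on that index.\<close>

lemma sum_fgaw_zero:
  assumes "\<And>M. M \<in> multi (Suc q) \<Longrightarrow> (\<Sum>J\<in>multi (Suc q). t J * antisym \<sigma> (Suc q) 2 (Suc q) J M) = 0"
  shows "(\<Sum>J\<in>multi (Suc q). hsmult E (t J) (fgaw k J)) = 0"
proof -
  have "(\<Sum>J\<in>multi q. hsmult E (t (l # J)) (gaw J)) = 0" for l
  proof (rule dext_wedge_numeric)
    fix M :: "'n list" assume M: "M \<in> multi q"
    have "0 = (\<Sum>J\<in>multi (Suc q). t J * antisym \<sigma> (Suc q) 2 (Suc q) J (l # M))"
      using assms[of "l # M"] M by (simp add: in_multi_iff)
    also have "\<dots> = (\<Sum>j\<in>UNIV. of_bool (j = l) * (\<Sum>J\<in>multi q. t (j # J) * antisym \<sigma> q 1 q J M))"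
      unfolding sum_multi_Suc sum_distrib_left
      using M by (intro sum.cong refl) (simp add: antisym_two_Cons[OF braid_yang_baxter] in_multi_iff)
    also have "\<dots> = (\<Sum>J\<in>multi q. t (l # J) * antisym \<sigma> q 1 q J M)"
      by (rule sum_of_bool_scale[OF vector_space_mult])
    finally show "(\<Sum>J\<in>multi q. t (l # J) * antisym \<sigma> q 1 q J M) = 0" by simp
  qed
  moreover have "(\<Sum>J\<in>multi (Suc q). hsmult E (t J) (fgaw k J)) = (\<Sum>l\<in>UNIV. fm k l * (\<Sum>J\<in>multi q. hsmult E (t (l # J)) (gaw J)))"
    by (simp add: sum_multi_Suc fgaw_def sum_distrib_left H_scale)
  ultimately show ?thesis by simp
qed

text \<open>The recurrence makes the total coefficient vanish only after contraction with
  antisymmetrizers on both sides. The contraction on the right is discharged by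
  \<open>sum_fgaw_zero\<close>, the one on the left by \<open>sum_numeric_kernel\<close> with the
  relations of the \<Omega>, behind which the coefficients stand.\<close>

lemma recurrence_cancel:
  assumes rec: "BRST_recurrence E X (Suc q)"
  shows "(\<Sum>I\<in>multi (Suc (Suc q)). Omr I * (raise_part X k q I + contract_part X k (Suc q) I)) = 0"
proof -
  let ?A = "antisym \<sigma> (Suc (Suc q)) 1 (Suc (Suc q))"
  define w where "w I J = raise_matrix X q I J - (-1) ^ Suc q * contract_matrix X (Suc q) I J" for I J
  have yw: "raise_part X k q I + contract_part X k (Suc q) I = (\<Sum>J\<in>multi (Suc q). hsmult E (w I J) (fgaw k J))"
    if "length I = Suc (Suc q)" for I
    unfolding raise_part_expand[OF that] contract_part_expand w_def
    by (simp add: sum.distrib[symmetric] HA.scale_left_distrib)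
  have t0: "(\<Sum>J\<in>multi (Suc q). (\<Sum>I\<in>multi (Suc (Suc q)). ?A I' I * w I J) * antisym \<sigma> (Suc q) 2 (Suc q) J M) = 0"
    if I': "I' \<in> multi (Suc (Suc q))" and M: "M \<in> multi (Suc q)" for I' M
  proof -
    let ?rm = "\<lambda>I. \<Sum>J\<in>multi (Suc q). raise_matrix X q I J * antisym \<sigma> (Suc q) 2 (Suc q) J M"
    let ?xa = "\<lambda>I. \<Sum>K\<in>multi (Suc q). X (Suc q) I K * antisym \<sigma> (Suc q) 1 (Suc q) K M"
    have "(\<Sum>J\<in>multi (Suc q). (\<Sum>I\<in>multi (Suc (Suc q)). ?A I' I * w I J) * antisym \<sigma> (Suc q) 2 (Suc q) J M)
        = (\<Sum>I\<in>multi (Suc (Suc q)). ?A I' I * (\<Sum>J\<in>multi (Suc q). w I J * antisym \<sigma> (Suc q) 2 (Suc q) J M))"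
      unfolding sum_distrib_right sum_distrib_left mult.assoc by (rule sum.swap)
    also have "\<dots> = (\<Sum>I\<in>multi (Suc (Suc q)). ?A I' I * (?rm I - (-1) ^ Suc q * ?xa I))"
    proof -
      have "(\<Sum>J\<in>multi (Suc q). w I J * antisym \<sigma> (Suc q) 2 (Suc q) J M) = ?rm I - (-1) ^ Suc q * ?xa I" for I
        using M contract_matrix_app[OF refl, of M q X I, symmetric]
        by (simp add: w_def left_diff_distrib sum_subtractf in_multi_iff sum_distrib_left mult.assoc sum_negf distrib_right sum.distrib)
      then show ?thesis by simp
    qed
    also have "\<dots> = (\<Sum>I\<in>multi (Suc (Suc q)). ?A I' I * ?rm I) - (-1) ^ Suc q * (\<Sum>I\<in>multi (Suc (Suc q)). ?A I' I * ?xa I)"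
      unfolding right_diff_distrib sum_subtractf sum_distrib_left by (simp add: mult.left_commute)
    also have "(\<Sum>I\<in>multi (Suc (Suc q)). ?A I' I * ?xa I) = (-1) ^ Suc q * (\<Sum>I\<in>multi (Suc (Suc q)). ?A I' I * ?rm I)"
      using rec I' M unfolding BRST_recurrence_iff[OF refl] by blast
    finally show ?thesis
      by (simp only: mult.assoc[symmetric] power_add[symmetric]) simp
  qed
  show ?thesis
  proof (rule sum_numeric_kernel[OF hs finite_multi, where T = "multi (Suc (Suc q))" and A = ?A
        and y = "\<lambda>I. raise_part X k q I + contract_part X k (Suc q) I"
        and B = "\<lambda>I c. hsmult E c (Omr I)" and G = "\<lambda>I w. Omr I * w" and D = "\<lambda>b w. w * b"
        and u = "hsmult E" and u' = "hsmult E"])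
    fix I' :: "'n list" assume I': "I' \<in> multi (Suc (Suc q))"
    have "(\<Sum>I\<in>multi (Suc (Suc q)). hsmult E (?A I' I) (raise_part X k q I + contract_part X k (Suc q) I))
        = (\<Sum>I\<in>multi (Suc (Suc q)). \<Sum>J\<in>multi (Suc q). hsmult E (?A I' I * w I J) (fgaw k J))"
      by (rule sum.cong) (auto simp: yw in_multi_iff HA.scale_sum_right)
    also have "\<dots> = (\<Sum>J\<in>multi (Suc q). hsmult E (\<Sum>I\<in>multi (Suc (Suc q)). ?A I' I * w I J) (fgaw k J))"
      by (subst sum.swap) (simp add: HA.scale_sum_left)
    also have "\<dots> = 0" by (rule sum_fgaw_zero) (rule t0[OF I'])
    finally show "(\<Sum>I\<in>multi (Suc (Suc q)). hsmult E (?A I' I) (raise_part X k q I + contract_part X k (Suc q) I)) = 0" .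
  next
    fix c assume "\<And>I. I \<in> multi (Suc (Suc q)) \<Longrightarrow> (\<Sum>J\<in>multi (Suc (Suc q)). ?A I J * c J) = 0"
    then show "(\<Sum>J\<in>multi (Suc (Suc q)). hsmult E (c J) (Omr J)) = 0" using Omega_wedge by blast
  qed (auto simp: H_scale intro: linear_scale_vector linear_mult_right linear_mult_left)
qed

text \<open>The part of the anticommutator with \<omega> that contains no \<gamma>. It involves only
  the leading term and \<open>X 1\<close>, so it is common to all partial charges with at least one
  X term.\<close>

definition curvature :: "(nat \<Rightarrow> ('k, 'n) tensor) \<Rightarrow> 'n \<Rightarrow> 'h" where
  "curvature X k = (\<Sum>i\<in>UNIV. Omega E i * vf i) * om k + om k * (\<Sum>i\<in>UNIV. Omega E i * vf i)
     + (\<Sum>I\<in>multi 2. Omr I * contract_part X k 1 I)"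

definition raise_sum :: "(nat \<Rightarrow> ('k, 'n) tensor) \<Rightarrow> 'n \<Rightarrow> nat \<Rightarrow> 'h" where
  "raise_sum X k R = (\<Sum>K\<in>multi (Suc (Suc R)). Omr K * raise_part X k R K)"

text \<open>The sum telescopes, and the unmatched \<open>raise_part\<close> of the last term stays
  behind as the defect of the partial charge.\<close>

lemma Qpart_form_curvature:
  assumes "R \<ge> 1" "\<forall>r\<in>{2..R}. BRST_recurrence E X r"
  shows "Qpart X R * om k + om k * Qpart X R = curvature X k + raise_sum X k R"
  using assms
proof (induction R rule: nat_induct_at_least)
  case base
  have "Qpart X 1 * om k + om k * Qpart X 1
      = (\<Sum>i\<in>UNIV. Omega E i * vf i) * om k + om k * (\<Sum>i\<in>UNIV. Omega E i * vf i)
        + (BRST_term E X 1 * om k + om k * BRST_term E X 1)"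
    by (simp add: Qpart_def distrib_left distrib_right)
  then show ?case unfolding BRST_term_form curvature_def raise_sum_def by (simp add: numeral_2_eq_2)
next
  case (Suc q)
  have "Qpart X (Suc q) * om k + om k * Qpart X (Suc q)
      = (Qpart X q * om k + om k * Qpart X q) + (BRST_term E X (Suc q) * om k + om k * BRST_term E X (Suc q))"
    by (simp add: Qpart_def distrib_left distrib_right)
  also have "\<dots> = curvature X k + raise_sum X k (Suc q)
      + (\<Sum>I\<in>multi (Suc (Suc q)). Omr I * (raise_part X k q I + contract_part X k (Suc q) I))"
    using Suc.IH Suc.prems unfolding BRST_term_form by (simp add: raise_sum_def distrib_left sum.distrib)
  finally show ?case using recurrence_cancel[of X q k] Suc.prems Suc.hyps by simp
qed

section \<open>The defect and the curvature acting on forms\<close>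

lemma fgaw_act_zero:
  assumes "a \<in> component (ext E) 0" "Suc (length K) < length J"
  shows "vac (fgaw k J * emb E (a * wedge (form E) K)) = 0"
proof -
  have "fgaw k J * emb E (a * wedge (form E) K) = fm k (hd J) * emb E a * (gaw (tl J) * omw K)"
    unfolding fgaw_def emb_mult by (metis gaw_mult_degree0[OF assms(1)] mult.assoc)
  then have "vac (fgaw k J * emb E (a * wedge (form E) K)) = vac (fm k (hd J) * emb E a * emb E (vac (gaw (tl J) * omw K)))"
    by (metis vac_mult)
  then show ?thesis using assms(2) by (simp add: vac_gaw_omw_zero lin_simps vac_simps)
qed

lemma fgaw_act:
  assumes "length J = Suc n" "length K = n"
  shows "vac (fgaw k J * omw K) = smult (ext E) (reorder_sign n * antisym \<sigma> (Suc n) 2 (Suc n) J (k # K)) 1"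
proof -
  obtain l J' where J: "J = l # J'" "length J' = n" using assms(1) by (cases J) auto
  have "vac (fgaw k J * omw K) = vac (fm k l * emb E (vac (gaw J' * omw K)))"
    unfolding fgaw_def mult.assoc J by (subst vac_mult) simp
  also have "\<dots> = smult (ext E) (reorder_sign n * antisym \<sigma> n 1 n J' K) (vac (fm k l))"
    using vac_gaw_omw[OF J(2) assms(2)] by (simp add: lin_simps vac_simps emb_one)
  finally show ?thesis
    unfolding J(1) antisym_two_Cons[OF braid_yang_baxter J(2) assms(2)] by (auto simp: vac_demb counit_fmat)
qed

text \<open>\<open>raise_part\<close> carries \<open>R\<close> factors \<gamma>, more than the test
  form has factors \<omega>.\<close>

lemma raise_sum_act_zero:
  assumes "a \<in> component (ext E) 0" "length K < R"
  shows "vac (raise_sum X k R * emb E (a * wedge (form E) K)) = 0"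
proof -
  have "vac (Omr I * raise_part X k R I * emb E (a * wedge (form E) K)) = 0" if I: "I \<in> multi (Suc (Suc R))" for I
  proof -
    have "vac (raise_part X k R I * emb E (a * wedge (form E) K)) = 0"
      using I assms by (simp add: raise_part_expand in_multi_iff sum_distrib_right linear_sum[OF vac_linear] H_scale vac_simps fgaw_act_zero)
    then show ?thesis
      unfolding mult.assoc by (subst vac_mult) (simp add: lin_simps vac_simps)
  qed
  then show ?thesis by (simp add: raise_sum_def sum_distrib_right linear_sum[OF vac_linear])
qed

lemma raise_sum_act:
  assumes K: "length K = R"
  shows "vac (raise_sum X k R * omw K) = (\<Sum>I\<in>multi (Suc (Suc R)).
    smult (ext E) (reorder_sign R * (\<Sum>J\<in>multi (Suc R). raise_matrix X R I J * antisym \<sigma> (Suc R) 2 (Suc R) J (k # K))) (vac (Omr I)))"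
proof -
  have "vac (Omr I * raise_part X k R I * omw K) = smult (ext E) (reorder_sign R * (\<Sum>J\<in>multi (Suc R). raise_matrix X R I J * antisym \<sigma> (Suc R) 2 (Suc R) J (k # K))) (vac (Omr I))"
    if I: "I \<in> multi (Suc (Suc R))" for I
  proof -
    have "vac (raise_part X k R I * omw K) = (\<Sum>J\<in>multi (Suc R). smult (ext E) (raise_matrix X R I J) (vac (fgaw k J * omw K)))"
      using I by (simp add: raise_part_expand in_multi_iff sum_distrib_right linear_sum[OF vac_linear] H_scale vac_simps)
    also have "\<dots> = (\<Sum>J\<in>multi (Suc R). smult (ext E) (reorder_sign R * (raise_matrix X R I J * antisym \<sigma> (Suc R) 2 (Suc R) J (k # K))) 1)"
      by (rule sum.cong) (auto simp: fgaw_act[OF _ K] in_multi_iff mult.left_commute)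
    also have "\<dots> = smult (ext E) (reorder_sign R * (\<Sum>J\<in>multi (Suc R). raise_matrix X R I J * antisym \<sigma> (Suc R) 2 (Suc R) J (k # K))) 1"
      by (simp add: GA.scale_sum_left sum_distrib_left)
    finally show ?thesis
      unfolding mult.assoc by (subst vac_mult) (simp add: lin_simps vac_simps emb_one)
  qed
  then show ?thesis by (simp add: raise_sum_def sum_distrib_right linear_sum[OF vac_linear])
qed

lemma curvature_degree0_span: "curvature X k \<in> degree0_span"
proof -
  have Om: "Omega E i \<in> degree0_span" for i using degree0_span_wedge_Omega[of "[i]"] by simp
  have fg: "fgaw k J \<in> degree0_span" if "length J = 1" for J
  proof -
    have "tl J = []" using that by (cases J) auto
    then show ?thesis using degree0_span_emb_demb[OF fmat_comp, of 1] by (simp add: fgaw_def emb_one demb_one)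
  qed
  have "Omr I * contract_part X k 1 I \<in> degree0_span" for I
    unfolding contract_part_expand sum_distrib_left H_scale(2)
  proof (intro degree0_span_sum)
    fix J :: "'n list" assume "J \<in> multi 1"
    then obtain j where "J = [j]" by (auto simp: in_multi_iff length_Suc_conv)
    then have "Omr I * fgaw k J \<in> degree0_span"
      using degree0_span_mult_demb[OF degree0_span_wedge_Omega fmat_comp] by (simp add: fgaw_def demb_one)
    then show "hsmult E (- ((- 1) ^ 1) * contract_matrix X 1 I J) (Omr I * fgaw k J) \<in> degree0_span"
      by (rule degree0_span_scale)
  qed
  then show ?thesis
    unfolding curvature_def sum_distrib_left sum_distrib_right
    by (intro degree0_span_add degree0_span_sum degree0_span_mult_emb[OF _ form_comp] degree0_span_emb_mult
        degree0_span_mult_demb[OF _ vfield_comp] Om)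
qed

text \<open>\<omega> is \<Omega> f, and f acts on the vacuum by its counit, the identity
  matrix.\<close>

lemma vac_mult_form: "vac (z * om m) = vac (z * Omega E m)"
proof -
  have "vac (z * om m) = (\<Sum>l\<in>UNIV. vac (z * Omega E l * fm m l))"
    by (simp add: form_Omega sum_distrib_left linear_sum[OF vac_linear] mult.assoc)
  also have "\<dots> = (\<Sum>l\<in>UNIV. smult (ext E) (of_bool (l = m)) (vac (z * Omega E l)))"
    by (intro sum.cong refl) (auto simp: vac_mult_demb counit_fmat)
  finally show ?thesis by (simp only: sum_of_bool_scale[OF G.vs])
qed

text \<open>On the vacuum the leading term contributes C and the next one \<open>X 1\<close>, both
  against products \<Omega>\<Omega>; the initial condition turns C + X into \<sigma> X. Rewriting
  \<omega>\<omega> through the \<Omega> produces the same \<sigma>, so the sum is X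
  \<omega>\<omega>, which is d\<omega> by Maurer-Cartan.\<close>

lemma vac_Qpart_form:
  assumes X: "BRST_initial E X"
  shows "vac (Qpart X 1 * om k) = diff E (form E k)"
proof -
  let ?v = "\<lambda>i j. vac (Omega E j * Omega E i)"
  have Q0: "vac ((\<Sum>i\<in>UNIV. Omega E i * vf i) * om k) = (\<Sum>m\<in>UNIV. \<Sum>i\<in>UNIV. smult (ext E) (struct_const E k m i) (?v m i))"
  proof -
    have "vac (Omega E i * vf i * om k) = (\<Sum>m\<in>UNIV. smult (ext E) (struct_const E k m i) (?v m i))" for i
    proof -
      have "vac (Omega E i * vf i * om k) = vac (Omega E i * om k * vf i)
          + (\<Sum>m\<in>UNIV. \<Sum>l\<in>UNIV. smult (ext E) (struct_const E k m l) (vac (Omega E i * om m * fm l i)))"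
        by (simp add: mult.assoc vfield_form distrib_left sum_distrib_left H_scale vac_simps linear_sum[OF vac_linear])
      also have "\<dots> = (\<Sum>m\<in>UNIV. \<Sum>l\<in>UNIV. smult (ext E) (of_bool (l = i)) (smult (ext E) (struct_const E k m l) (?v m i)))"
        by (simp add: vac_mult_demb counit_vfield counit_fmat vac_mult_form mult.commute)
      also have "\<dots> = (\<Sum>m\<in>UNIV. smult (ext E) (struct_const E k m i) (?v m i))"
        by (simp only: sum_of_bool_scale[OF G.vs])
      finally show ?thesis .
    qed
    then show ?thesis by (simp add: sum_distrib_right linear_sum[OF vac_linear]) (rule sum.swap)
  qed
  have Q1: "vac (BRST_term E X 1 * om k) = (\<Sum>m\<in>UNIV. \<Sum>i\<in>UNIV. smult (ext E) (X 1 [m, i] [k]) (?v m i))"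
  proof -
    have "vac (Omr I * gaw [j] * om k) = smult (ext E) (of_bool (j = k)) (vac (Omr I))" for I j
    proof -
      have "Omr I * gaw [j] * om k = Omr I * fm k j - Omr I * om k * ga j"
        by (simp add: mult.assoc dform_form right_diff_distrib)
      then show ?thesis by (auto simp: vac_simps vac_mult_demb counit_fmat counit_dform)
    qed
    then have "vac (BRST_term E X 1 * om k)
        = (\<Sum>I\<in>multi 2. \<Sum>j\<in>UNIV. smult (ext E) (of_bool (j = k)) (smult (ext E) (X 1 I [j]) (vac (Omr I))))"
      by (simp add: sum_multi_Suc[of _ 0] BRST_term_def sum_distrib_right linear_sum[OF vac_linear] H_scale vac_simps numeral_2_eq_2 mult.commute)
    then show ?thesis by (simp only: sum_of_bool_scale[OF G.vs] sum_multi_two) simp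
  qed
  have d: "diff E (form E k) = (\<Sum>q\<in>UNIV. \<Sum>p\<in>UNIV. smult (ext E) (\<Sum>m\<in>UNIV. \<Sum>n\<in>UNIV. \<sigma> m n q p * X 1 [m, n] [k]) (?v q p))"
  proof -
    have ww: "wedge (form E) [m, n] = (\<Sum>p\<in>UNIV. \<Sum>q\<in>UNIV. smult (ext E) (\<sigma> m n q p) (?v q p))" for m n
    proof -
      have "wedge (form E) [m, n] = vac (om m * om n)" by (simp add: emb_mult[symmetric])
      also have "\<dots> = (\<Sum>p\<in>UNIV. vac (Omega E p * emb E (vac (fm m p * om n))))"
        by (simp add: form_Omega[of m] sum_distrib_right linear_sum[OF vac_linear] mult.assoc vac_mult[of "Omega E _" "fm m _ * om n"])
      also have "\<dots> = (\<Sum>p\<in>UNIV. \<Sum>q\<in>UNIV. smult (ext E) (\<sigma> m n q p) (vac (Omega E p * om q)))"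
        by (simp add: vac_fmat_form linear_sum[OF emb_linear] sum_distrib_left linear_sum[OF vac_linear] lin_simps vac_simps)
      finally show ?thesis by (simp add: vac_mult_form)
    qed
    have "diff E (form E k) = (\<Sum>m\<in>UNIV. \<Sum>n\<in>UNIV. \<Sum>p\<in>UNIV. \<Sum>q\<in>UNIV. smult (ext E) (\<sigma> m n q p * X 1 [m, n] [k]) (?v q p))"
      unfolding maurer_cartan[OF X] sum_multi_two ww by (simp add: GA.scale_sum_right mult.commute)
    also have "\<dots> = (\<Sum>p\<in>UNIV. \<Sum>q\<in>UNIV. \<Sum>m\<in>UNIV. \<Sum>n\<in>UNIV. smult (ext E) (\<sigma> m n q p * X 1 [m, n] [k]) (?v q p))"
      by (rule sum_swap_pairs)
    also have "\<dots> = (\<Sum>p\<in>UNIV. \<Sum>q\<in>UNIV. smult (ext E) (\<Sum>m\<in>UNIV. \<Sum>n\<in>UNIV. \<sigma> m n q p * X 1 [m, n] [k]) (?v q p))"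
      by (simp add: GA.scale_sum_left)
    also have "\<dots> = (\<Sum>q\<in>UNIV. \<Sum>p\<in>UNIV. smult (ext E) (\<Sum>m\<in>UNIV. \<Sum>n\<in>UNIV. \<sigma> m n q p * X 1 [m, n] [k]) (?v q p))"
      by (rule sum.swap)
    finally show ?thesis .
  qed
  have "struct_const E k q p + X 1 [q, p] [k] = (\<Sum>m\<in>UNIV. \<Sum>n\<in>UNIV. \<sigma> m n q p * X 1 [m, n] [k])" for q p
  proof -
    have "X 1 [q, p] [k] - (\<Sum>m\<in>UNIV. \<Sum>n\<in>UNIV. \<sigma> m n q p * X 1 [m, n] [k]) = - struct_const E k q p"
      using X unfolding BRST_initial_iff antisym_two_num by blast
    then show ?thesis by (simp add: algebra_simps)
  qed
  then have "diff E (form E k) = (\<Sum>q\<in>UNIV. \<Sum>p\<in>UNIV. smult (ext E) (struct_const E k q p + X 1 [q, p] [k]) (?v q p))"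
    unfolding d by simp
  then show ?thesis
    using Q0 Q1 by (simp add: Qpart_def distrib_right vac_simps GA.scale_left_distrib sum.distrib)
qed

text \<open>Both sides are free of \<gamma>, so comparing their actions on \<A> is enough. There the
  defect for \<open>R = 1\<close> is zero and the charge with \<open>R = 1\<close> can be used in
  place of the curvature; commuting a past \<omega> by \<open>form_mult\<close> reduces its action
  to the vacuum values already known.\<close>

lemma curvature_eq:
  assumes X: "BRST_initial E X"
  shows "curvature X k = emb E (diff E (form E k))"
proof -
  have "curvature X k - emb E (diff E (form E k)) = 0"
  proof (rule faithful_degree0)
    show "curvature X k - emb E (diff E (form E k)) \<in> degree0_span"
      by (intro degree0_span_diff curvature_degree0_span degree0_span_emb)
    fix a assume a: "a \<in> component (ext E) 0"
    let ?b = "\<lambda>j. lact E (fmat E k j) a"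
    have b: "?b j \<in> component (ext E) 0" for j by (rule lact_comp[OF fmat_comp a])
    have QA: "vac (Qpart X 1 * emb E c) = diff E c" if "c \<in> component (ext E) 0" for c
      by (simp add: Qpart_degree0[OF that] vac_simps vac_emb_mult vac_Qpart)
    have "vac (Qpart X 1 * om k * emb E a) = diff E (form E k * a)"
    proof -
      have "vac (Qpart X 1 * om k * emb E a) = (\<Sum>j\<in>UNIV. vac (Qpart X 1 * emb E (?b j) * om j))"
        by (simp add: mult.assoc emb_mult[symmetric] form_mult[OF a] linear_sum[OF emb_linear] sum_distrib_left linear_sum[OF vac_linear])
      also have "\<dots> = (\<Sum>j\<in>UNIV. ?b j * diff E (form E j) + diff E (?b j) * form E j)"
        by (simp add: Qpart_degree0[OF b] distrib_right vac_simps mult.assoc vac_emb_mult vac_Qpart_form[OF X, unfolded One_nat_def])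
      also have "\<dots> = diff E (form E k * a)"
        by (simp add: form_mult[OF a] linear_sum[OF diff_linear] diff_mult[OF b] add.commute)
      finally show ?thesis .
    qed
    moreover have "vac (om k * Qpart X 1 * emb E a) = form E k * diff E a"
      by (simp add: mult.assoc vac_emb_mult QA[OF a, unfolded One_nat_def])
    moreover have "vac (raise_sum X k 1 * emb E a) = 0"
      using raise_sum_act_zero[OF a, of "[]" 1 X k] by simp
    moreover have "curvature X k = Qpart X 1 * om k + om k * Qpart X 1 - raise_sum X k 1"
      using Qpart_form_curvature[of 1 X k] by simp
    ultimately have "vac (curvature X k * emb E a) = diff E (form E k * a) + form E k * diff E a"
      by (simp add: distrib_right left_diff_distrib vac_simps)
    then show "vac ((curvature X k - emb E (diff E (form E k))) * emb E a) = 0"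
      by (simp add: left_diff_distrib vac_simps emb_mult[symmetric] diff_mult[OF form_comp])
  qed
  then show ?thesis by simp
qed

lemma Qpart_form:
  assumes "BRST_initial E X" "R \<ge> 1" "\<forall>r\<in>{2..R}. BRST_recurrence E X r"
  shows "Qpart X R * om k = emb E (diff E (form E k)) + raise_sum X k R - om k * Qpart X R"
  using Qpart_form_curvature[of R X k] curvature_eq[OF assms(1), of k] assms(2,3) by (simp add: algebra_simps)

section \<open>Solvability of the recurrence\<close>

lemma vac_Qpart_omw_Cons:
  assumes X: "BRST_initial E X" "R \<ge> 1" "\<forall>r\<in>{2..R}. BRST_recurrence E X r"
    and K: "vac (Qpart X R * omw K) = diff E (wedge (form E) K)"
  shows "vac (Qpart X R * omw (k # K)) = diff E (wedge (form E) (k # K)) + vac (raise_sum X k R * omw K)"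
proof -
  have "vac (Qpart X R * omw (k # K)) = vac (Qpart X R * om k * omw K)" by (simp add: emb_mult mult.assoc)
  also have "\<dots> = diff E (form E k) * wedge (form E) K + vac (raise_sum X k R * omw K) - form E k * diff E (wedge (form E) K)"
    unfolding Qpart_form[OF X]
    by (simp add: distrib_right left_diff_distrib vac_simps emb_mult[symmetric] mult.assoc vac_emb_mult K)
  also have "\<dots> = diff E (wedge (form E) (k # K)) + vac (raise_sum X k R * omw K)"
    by (simp add: diff_mult[OF form_comp])
  finally show ?thesis .
qed

text \<open>The defect needs \<open>R\<close> factors \<omega> to its right, so it is invisible up
  to degree \<open>R\<close> and first appears in degree \<open>R + 1\<close>.\<close>

lemma vac_Qpart_omw:
  assumes X: "BRST_initial E X" "R \<ge> 1" "\<forall>r\<in>{2..R}. BRST_recurrence E X r"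
  shows "length K \<le> R \<Longrightarrow> vac (Qpart X R * omw K) = diff E (wedge (form E) K)"
proof (induction K)
  case Nil
  then show ?case by (simp add: emb_one vac_Qpart diff_one)
next
  case (Cons k K)
  then have "vac (raise_sum X k R * omw K) = 0"
    using raise_sum_act_zero[OF G.one_comp, of K R X k] by simp
  then show ?case using vac_Qpart_omw_Cons[OF X] Cons by simp
qed

text \<open>The \<Omega> commute with \<A>, so a numerical combination of their products acts on
  \<A> by multiplication with its vacuum value; if that is 0, faithfulness makes the combination
  0.\<close>

lemma Omega_combination_zero:
  assumes "(\<Sum>I\<in>multi n. smult (ext E) (c I) (vac (Omr I))) = 0" "I' \<in> multi n"
  shows "(\<Sum>I\<in>multi n. antisym \<sigma> n 1 n I' I * c I) = 0"
proof -
  have "(\<Sum>I\<in>multi n. hsmult E (c I) (Omr I)) = 0"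
  proof (rule faithful_degree0)
    show "(\<Sum>I\<in>multi n. hsmult E (c I) (Omr I)) \<in> degree0_span"
      by (intro degree0_span_sum degree0_span_scale degree0_span_wedge_Omega)
    fix a assume a: "a \<in> component (ext E) 0"
    have "(\<Sum>I\<in>multi n. hsmult E (c I) (Omr I)) * emb E a = emb E a * (\<Sum>I\<in>multi n. hsmult E (c I) (Omr I))"
      by (simp add: sum_distrib_left sum_distrib_right H_scale Omr_degree0[OF a])
    then show "vac ((\<Sum>I\<in>multi n. hsmult E (c I) (Omr I)) * emb E a) = 0"
      using assms(1) by (simp add: vac_emb_mult linear_sum[OF vac_linear] vac_simps)
  qed
  then show ?thesis using Omega_wedge assms(2) by blast
qed

text \<open>A vector \<open>v\<close> in the kernel of A represents the zero form. The partial
  charge sends this form to d 0 plus the defect, which is therefore zero; by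
  \<open>raise_sum_act\<close> the defect is, up to sign, the right-hand side of the recurrence
  applied to \<open>v\<close>.\<close>

lemma recurrence_kernel:
  assumes X: "BRST_initial E X" "R \<ge> 1" "\<forall>r\<in>{2..R}. BRST_recurrence E X r"
    and v: "\<And>K. K \<in> multi (Suc R) \<Longrightarrow> (\<Sum>M\<in>multi (Suc R). antisym \<sigma> (Suc R) 1 (Suc R) K M * v M) = 0"
    and I': "I' \<in> multi (Suc (Suc R))"
  shows "(\<Sum>I\<in>multi (Suc (Suc R)). antisym \<sigma> (Suc (Suc R)) 1 (Suc (Suc R)) I' I *
    (\<Sum>M\<in>multi (Suc R). (\<Sum>J\<in>multi (Suc R). raise_matrix X R I J * antisym \<sigma> (Suc R) 2 (Suc R) J M) * v M)) = 0"
proof -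
  let ?t = "\<lambda>I M. \<Sum>J\<in>multi (Suc R). raise_matrix X R I J * antisym \<sigma> (Suc R) 2 (Suc R) J M"
  define c where "c I = reorder_sign R * (\<Sum>M\<in>multi (Suc R). ?t I M * v M)" for I
  have w0: "(\<Sum>M\<in>multi (Suc R). smult (ext E) (v M) (wedge (form E) M)) = 0"
    by (rule ext_wedge_numeric[OF v])
  have term_eq: "smult (ext E) (v M) (vac (Qpart X R * omw M)) = smult (ext E) (v M) (diff E (wedge (form E) M))
      + (\<Sum>I\<in>multi (Suc (Suc R)). smult (ext E) (reorder_sign R * (?t I M * v M)) (vac (Omr I)))"
    if M: "M \<in> multi (Suc R)" for M
  proof -
    obtain k K where MK: "M = k # K" "length K = R" using M by (auto simp: in_multi_iff length_Suc_conv)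
    show ?thesis
      unfolding MK(1) vac_Qpart_omw_Cons[OF X vac_Qpart_omw[OF X eq_refl[OF MK(2)]]] raise_sum_act[OF MK(2)]
      by (simp add: GA.scale_right_distrib GA.scale_sum_right mult_ac)
  qed
  have "0 = vac (Qpart X R * emb E (\<Sum>M\<in>multi (Suc R). smult (ext E) (v M) (wedge (form E) M)))"
    unfolding w0 by (simp add: lin_simps vac_simps)
  also have "\<dots> = (\<Sum>M\<in>multi (Suc R). smult (ext E) (v M) (vac (Qpart X R * omw M)))"
    by (simp add: linear_sum[OF emb_linear] sum_distrib_left linear_sum[OF vac_linear] linearD[OF emb_linear] H_scale vac_simps)
  also have "\<dots> = diff E (\<Sum>M\<in>multi (Suc R). smult (ext E) (v M) (wedge (form E) M))
      + (\<Sum>M\<in>multi (Suc R). \<Sum>I\<in>multi (Suc (Suc R)). smult (ext E) (reorder_sign R * (?t I M * v M)) (vac (Omr I)))"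
    by (simp add: term_eq sum.distrib linear_sum[OF diff_linear] linearD[OF diff_linear])
  also have "\<dots> = (\<Sum>I\<in>multi (Suc (Suc R)). smult (ext E) (c I) (vac (Omr I)))"
    unfolding w0 by (subst sum.swap) (simp add: linearD[OF diff_linear] c_def GA.scale_sum_left sum_distrib_left)
  finally have "(\<Sum>I\<in>multi (Suc (Suc R)). smult (ext E) (c I) (vac (Omr I))) = 0" by (rule sym)
  note Omega_combination_zero[OF this I']
  then have "reorder_sign R * (\<Sum>I\<in>multi (Suc (Suc R)). antisym \<sigma> (Suc (Suc R)) 1 (Suc (Suc R)) I' I *
      (\<Sum>M\<in>multi (Suc R). ?t I M * v M)) = 0"
    by (simp add: c_def sum_distrib_left mult.left_commute)
  then show ?thesis using reorder_sign_simps(3) by simp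
qed

text \<open>With A g A = A the columns of 1 - g A lie in the kernel of A, which the right-hand side
  annihilates by \<open>recurrence_kernel\<close>. The right-hand side is thus unchanged by g A on
  its right, and \<open>Y\<close> is what precedes that A.\<close>

lemma recurrence_step:
  assumes X: "BRST_initial E X" "R \<ge> 1" "\<forall>r\<in>{2..R}. BRST_recurrence E X r"
  obtains Y where "BRST_recurrence E (X(Suc R := Y)) (Suc R)"
proof -
  let ?n = "Suc R"
  let ?A = "antisym \<sigma> ?n 1 ?n" and ?A' = "antisym \<sigma> (Suc ?n) 1 (Suc ?n)"
  let ?t = "\<lambda>I M. \<Sum>J\<in>multi ?n. raise_matrix X R I J * antisym \<sigma> ?n 2 ?n J M"
  obtain g where g: "\<And>I J. I \<in> multi ?n \<Longrightarrow> J \<in> multi ?n \<Longrightarrow>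
      (\<Sum>K\<in>multi ?n. ?A I K * (\<Sum>L\<in>multi ?n. g K L * ?A L J)) = ?A I J"
    using matrix_generalized_inverse[of "multi ?n" "multi ?n" ?A, OF finite_multi finite_multi] by blast
  have B: "(\<Sum>I\<in>multi (Suc ?n). ?A' I' I * ?t I M0) =
      (\<Sum>I\<in>multi (Suc ?n). ?A' I' I * (\<Sum>M\<in>multi ?n. ?t I M * (\<Sum>L\<in>multi ?n. g M L * ?A L M0)))"
    if I': "I' \<in> multi (Suc ?n)" and M0: "M0 \<in> multi ?n" for I' M0
  proof -
    define v where "v M = of_bool (M0 = M) - (\<Sum>L\<in>multi ?n. g M L * ?A L M0)" for M
    have pick: "(\<Sum>M\<in>multi ?n. f M * of_bool (M0 = M)) = f M0" for f :: "'n list \<Rightarrow> 'k"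
      using sum_of_bool_multi[OF vector_space_mult, of M0 ?n f] M0 by (simp add: in_multi_iff mult.commute)
    have "(\<Sum>M\<in>multi ?n. ?A K M * v M) = 0" if "K \<in> multi ?n" for K
      using g[OF that M0] by (simp only: v_def right_diff_distrib sum_subtractf pick) simp
    from recurrence_kernel[OF X this I']
    have "(\<Sum>I\<in>multi (Suc ?n). ?A' I' I * (\<Sum>M\<in>multi ?n. ?t I M * v M)) = 0" by simp
    then show ?thesis by (simp only: v_def right_diff_distrib sum_subtractf pick) simp
  qed
  define Y where "Y I L = (-1) ^ ?n * (\<Sum>M\<in>multi ?n. ?t I M * g M L)" for I L
  \<comment> \<open>The matrix reads only \<open>X R\<close>, so it does not see the new entry at
    \<open>Suc R\<close>.\<close>
  have rm: "raise_matrix (X(?n := Y)) R = raise_matrix X R"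
    by (simp add: raise_matrix_def fun_eq_iff del: down_op.simps)
  have "BRST_recurrence E (X(?n := Y)) ?n"
    unfolding BRST_recurrence_iff[OF refl] rm
  proof (intro ballI)
    fix I :: "'n list" and M0 :: "'n list" assume IM: "I \<in> multi (Suc ?n)" "M0 \<in> multi ?n"
    define T where "T L = (\<Sum>M\<in>multi ?n. ?t L M * (\<Sum>K\<in>multi ?n. g M K * ?A K M0))" for L
    have y: "(\<Sum>K\<in>multi ?n. Y L K * ?A K M0) = (-1) ^ ?n * T L" for L
    proof -
      have "(\<Sum>K\<in>multi ?n. Y L K * ?A K M0) = (\<Sum>K\<in>multi ?n. \<Sum>M\<in>multi ?n. (-1) ^ ?n * (?t L M * (g M K * ?A K M0)))"
        unfolding Y_def sum_distrib_left[of "(-1) ^ ?n"] sum_distrib_right[of _ "multi ?n" "?A _ M0"] by (simp only: mult.assoc)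
      also have "\<dots> = (\<Sum>M\<in>multi ?n. \<Sum>K\<in>multi ?n. (-1) ^ ?n * (?t L M * (g M K * ?A K M0)))"
        by (rule sum.swap)
      finally show ?thesis by (simp only: T_def sum_distrib_left[of "(-1) ^ ?n"] sum_distrib_left[of "?t L _"])
    qed
    show "(\<Sum>L\<in>multi (Suc ?n). ?A' I L * (\<Sum>K\<in>multi ?n. (X(?n := Y)) ?n L K * ?A K M0)) =
        (-1) ^ ?n * (\<Sum>L\<in>multi (Suc ?n). ?A' I L * ?t L M0)"
      unfolding B[OF IM] fun_upd_same y T_def[symmetric] by (simp add: sum_distrib_left mult.left_commute)
  qed
  then show ?thesis by (rule that)
qed

lemma BRST_recurrence_cong:
  assumes "X r = Y r" "X (r - 1) = Y (r - 1)"
  shows "BRST_recurrence E X r \<longleftrightarrow> BRST_recurrence E Y r"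
  using assms by (simp add: BRST_recurrence_def)

text \<open>For \<open>n \<ge> 1\<close> a step changes only \<open>X (Suc n)\<close>, which enters
  neither the initial condition nor the earlier recurrences.\<close>

lemma recurrence_solvable: "\<exists>X. BRST_initial E X \<and> (\<forall>r\<in>{2..n}. BRST_recurrence E X r)"
proof (induction n)
  case 0
  have "\<exists>c. \<forall>i j. (\<Sum>J\<in>multi 2. antisym \<sigma> 2 1 2 [i, j] J * c J) = - struct_const E k i j" for k
    using maurer_cartan_exists[of k] by metis
  then obtain c where "\<And>k i j. (\<Sum>J\<in>multi 2. antisym \<sigma> 2 1 2 [i, j] J * c k J) = - struct_const E k i j"
    by metis
  then have "BRST_initial E (\<lambda>_ J K. c (hd K) J)" by (simp add: BRST_initial_iff)
  then show ?case by (intro exI[of _ "\<lambda>_ J K. c (hd K) J"]) auto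
next
  case (Suc n)
  then obtain X where X: "BRST_initial E X" "\<And>r. r \<in> {2..n} \<Longrightarrow> BRST_recurrence E X r" by blast
  show ?case
  proof (cases "n \<ge> 1")
    case True
    obtain Y where Y: "BRST_recurrence E (X(Suc n := Y)) (Suc n)"
      using recurrence_step[OF X(1) True] X(2) by blast
    have "BRST_initial E (X(Suc n := Y))" using X(1) True by (simp add: BRST_initial_def)
    moreover have "BRST_recurrence E (X(Suc n := Y)) r" if "r \<in> {2..Suc n}" for r
    proof (cases "r = Suc n")
      case False
      then have "BRST_recurrence E (X(Suc n := Y)) r = BRST_recurrence E X r"
        using that by (intro BRST_recurrence_cong) auto
      then show ?thesis using X(2) that False by auto
    qed (use Y in simp)
    ultimately show ?thesis by blast
  next
    case False
    then show ?thesis using X(1) by (intro exI[of _ X]) auto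
  qed
qed

section \<open>Properties of the BRST charge\<close>

text \<open>The graded commutator with \<open>Q\<close> and d satisfy the same Leibniz rule, and
  forms are sums of products of degree zero elements and the \<omega>.\<close>

lemma commutator_from_generators:
  assumes degree0: "\<And>a. a \<in> component (ext E) 0 \<Longrightarrow> Q * emb E a = emb E a * Q + emb E (diff E a)"
    and form: "\<And>k. Q * om k = emb E (diff E (form E k)) - om k * Q"
    and x: "x \<in> component (ext E) n"
  shows "Q * emb E x = emb E (diff E x) + hsmult E ((-1) ^ n) (emb E x * Q)"
proof -
  have w: "Q * omw I = emb E (diff E (wedge (form E) I)) + hsmult E ((-1) ^ length I) (omw I * Q)" for I
  proof (induction I)
    case Nil
    then show ?case by (simp add: emb_one diff_one lin_simps)
  next
    case (Cons k I)
    have "Q * omw (k # I) = Q * om k * omw I" by (simp add: emb_mult mult.assoc)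
    also have "\<dots> = emb E (diff E (form E k) * wedge (form E) I) - om k * (Q * omw I)"
      by (simp add: form left_diff_distrib mult.assoc emb_mult)
    also have "\<dots> = emb E (diff E (form E k) * wedge (form E) I) - emb E (form E k * diff E (wedge (form E) I))
        - hsmult E ((-1) ^ length I) (omw (k # I) * Q)"
      by (simp add: Cons.IH distrib_left H_scale emb_mult mult.assoc)
    also have "\<dots> = emb E (diff E (wedge (form E) (k # I))) + hsmult E ((-1) ^ length (k # I)) (omw (k # I) * Q)"
      by (simp add: diff_mult[OF form_comp] lin_simps)
    finally show ?case .
  qed
  obtain s where s: "x = (\<Sum>I\<in>multi n. s I * wedge (form E) I)" "\<And>I. s I \<in> component (ext E) 0"
    using x ext_span[of n] by auto
  have "Q * emb E (s I * wedge (form E) I) = emb E (diff E (s I * wedge (form E) I))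
      + hsmult E ((-1) ^ n) (emb E (s I * wedge (form E) I) * Q)" if "I \<in> multi n" for I
  proof -
    have "Q * emb E (s I * wedge (form E) I) = emb E (s I) * (Q * omw I) + emb E (diff E (s I) * wedge (form E) I)"
      by (simp add: emb_mult mult.assoc[symmetric] degree0[OF s(2)] distrib_right)
    then show ?thesis
      using that w[of I]
      by (simp add: in_multi_iff diff_mult[OF s(2)] lin_simps emb_mult mult.assoc add_ac)
  qed
  then show ?thesis
    by (simp add: s(1) linear_sum[OF emb_linear] linear_sum[OF diff_linear] sum_distrib_left sum_distrib_right
        sum.distrib HA.scale_sum_right)
qed

section \<open>Nilpotency and right invariance of an element that acts as d and kills the
  vacuum\<close>

context
  fixes Q :: 'h
  assumes commutator: "\<And>x n. x \<in> component (ext E) n \<Longrightarrow>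
      Q * emb E x = emb E (diff E x) + hsmult E ((-1) ^ n) (emb E x * Q)"
    and vacuum: "vac Q = 0"
begin

lemma vac_charge_emb: "x \<in> component (ext E) n \<Longrightarrow> vac (Q * emb E x) = diff E x"
  by (simp add: commutator vac_simps vac_emb_mult vacuum)

text \<open>In the commutator with a form the mixed terms cancel by sign, so the square commutes
  with all forms; it kills the vacuum and hence acts by zero.\<close>

lemma charge_square: "Q * Q = 0"
proof (rule faithful)
  fix x n assume x: "x \<in> component (ext E) n"
  have "Q * Q * emb E x = Q * (emb E (diff E x) + hsmult E ((-1) ^ n) (emb E x * Q))"
    by (simp only: mult.assoc commutator[OF x])
  also have "\<dots> = Q * emb E (diff E x) + hsmult E ((-1) ^ n) (Q * emb E x * Q)"
    by (simp only: distrib_left H_scale mult.assoc)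
  also have "\<dots> = emb E x * (Q * Q)"
    unfolding commutator[OF x] commutator[OF diff_comp[OF x]]
    by (simp add: diff_diff lin_simps mult.assoc power_add[symmetric] flip: power_mult_distrib)
  finally show "vac (Q * Q * emb E x) = 0"
    using vac_mult[of Q Q] by (simp add: vac_emb_mult vacuum lin_simps vac_simps)
qed

text \<open>An element of degree 0 pairs to zero with every d \<open>x2\<close>, so only the terms
  with d on the first leg survive.\<close>

lemma lact_diff:
  assumes h: "h \<in> component (dext E) 0" and x: "x \<in> component (ext E) n"
  shows "lact E h (diff E x) = diff E (lact E h x)"
proof -
  have lin: "Vector_Spaces.linear (smult (ext E)) (smult (ext E)) (\<lambda>x. smult (ext E) (pair E h y) x)"
    "Vector_Spaces.linear (smult (ext E)) (smult (ext E)) (\<lambda>y. smult (ext E) (pair E h y) x)" for x y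
    by (auto intro!: linearI[OF G.vs G.vs] simp: lin_simps mult.commute)
  have "lact E h (diff E x)
      = (\<Sum>(x1, x2)\<leftarrow>coprod (ext E) x. smult (ext E) (pair E h x2) (diff E x1)) +
        (\<Sum>(x1, x2)\<leftarrow>coprod (ext E) x. smult (ext E) (pair E h (diff E x2)) (smult (ext E) ((-1) ^ deg (ext E) x1) x1))"
    unfolding lact_def tensor_eq_sum[OF diff_coprod[OF x] G.vs lin] by (simp add: split_def o_def)
  also have "(\<Sum>(x1, x2)\<leftarrow>coprod (ext E) x. smult (ext E) (pair E h (diff E x2)) (smult (ext E) ((-1) ^ deg (ext E) x1) x1))
      = (\<Sum>(x1, x2)\<leftarrow>coprod (ext E) x. 0)"
  proof (rule sum_list_cong_set, clarify)
    fix x1 x2 assume "(x1, x2) \<in> set (coprod (ext E) x)"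
    then obtain q where "x2 \<in> component (ext E) q" using G.coprod_comp[OF x] by blast
    then have "pair E h (diff E x2) = 0" using pair_comp[OF h diff_comp] by blast
    then show "smult (ext E) (pair E h (diff E x2)) (smult (ext E) ((-1) ^ deg (ext E) x1) x1) = 0" by simp
  qed
  finally show ?thesis
    by (simp add: lact_def split_def linear_sum_list[OF diff_linear] linearD[OF diff_linear])
qed

text \<open>Both products act on forms by d and the action of \<open>h\<close>, in either order, and
  these commute by \<open>lact_diff\<close>. Right invariance follows because the coaction then
  collapses to the antipode identity.\<close>

lemma charge_commutes:
  assumes h: "h \<in> component (dext E) 0"
  shows "demb E h * Q = Q * demb E h"
proof -
  have "demb E h * Q - Q * demb E h = 0"
  proof (rule faithful)
    fix x n assume x: "x \<in> component (ext E) n"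
    have "vac (demb E h * Q * emb E x) = lact E h (diff E x)"
      unfolding mult.assoc
      by (subst vac_mult) (simp add: vac_charge_emb[OF x] vac_cross[OF h diff_comp[OF x]])
    moreover have "vac (Q * demb E h * emb E x) = diff E (lact E h x)"
      unfolding mult.assoc
      by (subst vac_mult) (simp add: vac_cross[OF h x] vac_charge_emb[OF lact_comp[OF h x]])
    ultimately show "vac ((demb E h * Q - Q * demb E h) * emb E x) = 0"
      by (simp add: left_diff_distrib vac_simps lact_diff[OF h x])
  qed
  then show ?thesis by simp
qed

lemma charge_right_invariant: "right_invariant E Q"
  unfolding right_invariant_def
proof
  fix h assume h: "h \<in> component (dext E) 0"
  have "right_coaction E Q h = (\<Sum>(h1, h2)\<leftarrow>coprod (dext E) h. Q * demb E (h1 * antipode (dext E) h2))"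
    unfolding right_coaction_def
  proof (rule sum_list_cong_set, clarify)
    fix h1 h2 assume "(h1, h2) \<in> set (coprod (dext E) h)"
    then have "h1 \<in> component (dext E) 0" using D.coprod_degree0(1)[OF h] by blast
    then show "demb E h1 * Q * demb E (antipode (dext E) h2) = Q * demb E (h1 * antipode (dext E) h2)"
      by (simp add: charge_commutes demb_mult mult.assoc[symmetric])
  qed
  also have "\<dots> = Q * demb E (\<Sum>(h1, h2)\<leftarrow>coprod (dext E) h. h1 * antipode (dext E) h2)"
    by (simp add: split_def sum_list_const_mult linear_sum_list[OF demb_linear])
  also have "\<dots> = hsmult E (pair E h 1) Q"
    by (simp add: D.antipode_right linearD[OF demb_linear] demb_one H_scale pair_one_right)
  finally show "right_coaction E Q h = hsmult E (pair E h 1) Q" .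
qed

end

section \<open>Left invariance and degree from normal ordering\<close>

lemma ract_linear_left: "Vector_Spaces.linear (smult (ext E)) (smult (ext E)) (\<lambda>x. ract E x \<phi>)"
proof (rule linearI[OF G.vs G.vs])
  have l: "Vector_Spaces.linear (smult (ext E)) (smult (ext E)) (\<lambda>x1. smult (ext E) (pair E \<phi> x1) x2)"
    "Vector_Spaces.linear (smult (ext E)) (smult (ext E)) (\<lambda>x2. smult (ext E) (pair E \<phi> x1) x2)" for x1 x2
    by (auto intro!: linearI[OF G.vs G.vs] simp: lin_simps mult.commute)
  show "ract E (x + y) \<phi> = ract E x \<phi> + ract E y \<phi>" for x y
    unfolding ract_def using tensor_eq_sum[OF G.coprod_add G.vs l, of x y] by simp
  show "ract E (smult (ext E) c x) \<phi> = smult (ext E) c (ract E x \<phi>)" for c x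
    unfolding ract_def using tensor_eq_sum[OF G.coprod_smult G.vs l, of c x]
    by (simp add: split_def o_def linear_sum_list[OF GA.linear_scale_self] lin_simps)
qed

lemma ract_linear_right: "Vector_Spaces.linear (smult (dext E)) (smult (ext E)) (ract E x)"
proof -
  have "ract E x (\<phi> + \<psi>) = ract E x \<phi> + ract E x \<psi>" "ract E x (smult (dext E) c \<phi>) = smult (ext E) c (ract E x \<phi>)" for \<phi> \<psi> c
    by (simp_all add: ract_def split_def lin_simps sum_list_addf linear_sum_list[OF GA.linear_scale_self])
  then show ?thesis by (intro linearI[OF D.vs G.vs])
qed

lemma ract_form:
  assumes "h \<in> component (dext E) 0"
  shows "ract E (form E i) h = smult (ext E) (pair E h 1) (form E i)"
proof -
  have "ract E (form E i) h
      = (\<Sum>(x1, x2)\<leftarrow>(1, form E i) # [(form E j, rmat E i j). j \<leftarrow> all_indices]. smult (ext E) (pair E h x1) x2)"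
    unfolding ract_def
    by (rule tensor_eq_sum[OF coprod_form G.vs])
       (auto intro!: linearI[OF G.vs G.vs] simp: lin_simps mult.commute)
  then show ?thesis
    using pair_comp[OF assms form_comp] by (simp add: o_def sum_list_all_indices)
qed

lemma ract_one: "ract E 1 h = smult (ext E) (pair E h 1) 1"
proof -
  have "ract E 1 h = (\<Sum>(x1, x2)\<leftarrow>[(1, 1)]. smult (ext E) (pair E h x1) x2)"
    unfolding ract_def
    by (rule tensor_eq_sum[OF G.coprod_one G.vs])
       (auto intro!: linearI[OF G.vs G.vs] simp: lin_simps mult.commute)
  then show ?thesis by simp
qed

text \<open>An element of degree 0 pairs nontrivially only with first legs of degree 0, where the
  Koszul sign is 1; the right action therefore behaves as over an ungraded Hopf algebra.\<close>

lemma ract_mult: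
  assumes h: "h \<in> component (dext E) 0" and x: "x \<in> component (ext E) m" and y: "y \<in> component (ext E) n"
  shows "ract E (x * y) h = (\<Sum>(h1, h2)\<leftarrow>coprod (dext E) h. ract E x h1 * ract E y h2)"
proof -
  have "ract E (x * y) h = (\<Sum>(x1, x2)\<leftarrow>coprod (ext E) x. \<Sum>(y1, y2)\<leftarrow>coprod (ext E) y.
      smult (ext E) (pair E h (smult (ext E) (koszul (deg (ext E) x2) (deg (ext E) y1)) (x1 * y1))) (x2 * y2))"
  proof -
    have "ract E (x * y) h = (\<Sum>(z1, z2)\<leftarrow>[(smult (ext E) (koszul (deg (ext E) x2) (deg (ext E) y1)) (x1 * y1), x2 * y2).
        (x1, x2) \<leftarrow> coprod (ext E) x, (y1, y2) \<leftarrow> coprod (ext E) y]. smult (ext E) (pair E h z1) z2)"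
      unfolding ract_def
      by (rule tensor_eq_sum[OF G.coprod_mult[OF x y] G.vs])
         (auto intro!: linearI[OF G.vs G.vs] simp: lin_simps mult.commute)
    then show ?thesis by (simp add: sum_list_concat_map split_def o_def)
  qed
  also have "\<dots> = (\<Sum>(x1, x2)\<leftarrow>coprod (ext E) x. \<Sum>(y1, y2)\<leftarrow>coprod (ext E) y. \<Sum>(h1, h2)\<leftarrow>coprod (dext E) h.
      smult (ext E) (pair E h1 x1 * pair E h2 y1) (x2 * y2))"
  proof (intro sum_list_cong_set, clarify, intro sum_list_cong_set, clarify)
    fix x1 x2 y1 y2 assume "(x1, x2) \<in> set (coprod (ext E) x)" "(y1, y2) \<in> set (coprod (ext E) y)"
    then obtain p q where p: "x1 \<in> component (ext E) p" and q: "y1 \<in> component (ext E) q"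
      using G.coprod_comp[OF x] G.coprod_comp[OF y] by metis
    have "koszul (deg (ext E) x2) (deg (ext E) y1) * pair E h (x1 * y1) = pair E h (x1 * y1)" (is "?l = _")
    proof (cases "q = 0")
      case True
      then show ?thesis using q G.deg_degree0[of y1] by (simp add: koszul_def)
    next
      case False
      then show ?thesis using pair_comp[OF h G.mult_comp[OF p q]] by simp
    qed
    also have "pair E h (x1 * y1) = (\<Sum>(h1, h2)\<leftarrow>coprod (dext E) h. pair E h1 x1 * pair E h2 y1)"
      unfolding pair_mult_right[OF h p q]
      by (rule sum_list_cong_set) (auto dest!: D.coprod_degree0(2)[OF h] simp: D.deg_degree0 koszul_def)
    finally have e: "?l = (\<Sum>(h1, h2)\<leftarrow>coprod (dext E) h. pair E h1 x1 * pair E h2 y1)" .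
    have "smult (ext E) (\<Sum>l\<leftarrow>ls. f l) z = (\<Sum>l\<leftarrow>ls. smult (ext E) (f l) z)" for f :: "'d \<times> 'd \<Rightarrow> 'k" and ls z
      by (induction ls) (auto simp: GA.scale_left_distrib)
    then show "smult (ext E) (pair E h (smult (ext E) (koszul (deg (ext E) x2) (deg (ext E) y1)) (x1 * y1))) (x2 * y2)
        = (\<Sum>(h1, h2)\<leftarrow>coprod (dext E) h. smult (ext E) (pair E h1 x1 * pair E h2 y1) (x2 * y2))"
      by (simp only: linearD(2)[OF pair_linear_right] e) (simp add: split_def)
  qed
  also have "\<dots> = (\<Sum>(h1, h2)\<leftarrow>coprod (dext E) h. \<Sum>(x1, x2)\<leftarrow>coprod (ext E) x. \<Sum>(y1, y2)\<leftarrow>coprod (ext E) y.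
      smult (ext E) (pair E h1 x1 * pair E h2 y1) (x2 * y2))"
    unfolding split_def
    by (simp only: sum_list_swap[of _ "coprod (dext E) h" "coprod (ext E) y"]) (rule sum_list_swap)
  also have "\<dots> = (\<Sum>(h1, h2)\<leftarrow>coprod (dext E) h. ract E x h1 * ract E y h2)"
    unfolding ract_def split_def sum_list_mult_const[symmetric] sum_list_const_mult[symmetric]
    by (simp add: GA.scale_mult_left[symmetric] GA.scale_mult_right[symmetric] mult.commute
        sum_list_swap[of _ "coprod (ext E) x" "coprod (ext E) y"])
  finally show ?thesis .
qed

lemma ract_wedge_form:
  assumes "h \<in> component (dext E) 0"
  shows "ract E (wedge (form E) I) h = smult (ext E) (pair E h 1) (wedge (form E) I)"
  using assms
proof (induction I arbitrary: h)
  case Nil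
  then show ?case by (simp add: ract_one)
next
  case (Cons i I)
  have "ract E (wedge (form E) (i # I)) h = (\<Sum>(h1, h2)\<leftarrow>coprod (dext E) h. ract E (form E i) h1 * ract E (wedge (form E) I) h2)"
    using ract_mult[OF Cons.prems form_comp wedge_form_comp] by simp
  also have "\<dots> = (\<Sum>(h1, h2)\<leftarrow>coprod (dext E) h. smult (ext E) (counit (dext E) h1) (form E i * ract E (wedge (form E) I) h2))"
    by (rule sum_list_cong_set)
       (auto simp: ract_form pair_one_right lin_simps dest: D.coprod_degree0(1)[OF Cons.prems])
  also have "\<dots> = form E i * ract E (wedge (form E) I) h"
    by (rule D.sum_counit_left) (auto intro!: linearI[OF D.vs G.vs] simp: lin_simps linearD[OF ract_linear_right])
  finally show ?case using Cons by (simp add: lin_simps)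
qed

text \<open>Normally ordered elements whose \<open>\<Gamma>\<^sup>\<and>\<close>-factors are left-invariant.\<close>

definition wedge_span :: "(nat \<Rightarrow> nat \<Rightarrow> bool) \<Rightarrow> 'h set" where
  "wedge_span P = {\<Sum>(x, \<phi>)\<leftarrow>t. emb E x * demb E \<phi> |t.
     \<forall>(x, \<phi>)\<in>set t. \<exists>I q. x = wedge (form E) I \<and> \<phi> \<in> component (dext E) q \<and> P (length I) q}"

lemma wedge_span_gen:
  assumes "\<phi> \<in> component (dext E) q" "P (length I) q"
  shows "omw I * demb E \<phi> \<in> wedge_span P"
  unfolding wedge_span_def
  by (intro CollectI exI[of _ "[(wedge (form E) I, \<phi>)]"]) (use assms in auto)

lemma wedge_span_zero: "0 \<in> wedge_span P"
  unfolding wedge_span_def by (intro CollectI exI[of _ "[]"]) auto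

lemma wedge_span_add:
  assumes "z \<in> wedge_span P" "w \<in> wedge_span P"
  shows "z + w \<in> wedge_span P"
proof -
  obtain t u where "z = (\<Sum>(x, \<phi>)\<leftarrow>t. emb E x * demb E \<phi>)" "w = (\<Sum>(x, \<phi>)\<leftarrow>u. emb E x * demb E \<phi>)"
    "\<forall>(x, \<phi>)\<in>set t. \<exists>I q. x = wedge (form E) I \<and> \<phi> \<in> component (dext E) q \<and> P (length I) q"
    "\<forall>(x, \<phi>)\<in>set u. \<exists>I q. x = wedge (form E) I \<and> \<phi> \<in> component (dext E) q \<and> P (length I) q"
    using assms unfolding wedge_span_def by blast
  then show ?thesis unfolding wedge_span_def by (intro CollectI exI[of _ "t @ u"]) auto
qed

lemma wedge_span_induct [consumes 1, case_names gen zero add]: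
  assumes "z \<in> wedge_span P"
    and "\<And>I q \<phi>. \<phi> \<in> component (dext E) q \<Longrightarrow> P (length I) q \<Longrightarrow> R (omw I * demb E \<phi>)" "R 0"
    and "\<And>z w. R z \<Longrightarrow> R w \<Longrightarrow> R (z + w)"
  shows "R z"
proof -
  obtain t where "z = (\<Sum>(x, \<phi>)\<leftarrow>t. emb E x * demb E \<phi>)"
    "\<forall>(x, \<phi>)\<in>set t. \<exists>I q. x = wedge (form E) I \<and> \<phi> \<in> component (dext E) q \<and> P (length I) q"
    using assms(1) unfolding wedge_span_def by blast
  moreover have "\<forall>(x, \<phi>)\<in>set t. \<exists>I q. x = wedge (form E) I \<and> \<phi> \<in> component (dext E) q \<and> P (length I) q \<Longrightarrow>
      R (\<Sum>(x, \<phi>)\<leftarrow>t. emb E x * demb E \<phi>)" for t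
    by (induction t) (use assms(2-4) in auto)
  ultimately show ?thesis by blast
qed

lemma wedge_span_sum: "(\<And>i. i \<in> A \<Longrightarrow> f i \<in> wedge_span P) \<Longrightarrow> sum f A \<in> wedge_span P"
  by (induction A rule: infinite_finite_induct) (auto intro: wedge_span_zero wedge_span_add)

lemma wedge_span_sum_list: "(\<And>i. i \<in> set l \<Longrightarrow> f i \<in> wedge_span P) \<Longrightarrow> (\<Sum>i\<leftarrow>l. f i) \<in> wedge_span P"
  by (induction l) (auto intro: wedge_span_zero wedge_span_add)

lemma wedge_span_mult_demb:
  assumes "z \<in> wedge_span P" "\<psi> \<in> component (dext E) n" "\<And>p q. P p q \<Longrightarrow> P' p (q + n)"
  shows "z * demb E \<psi> \<in> wedge_span P'"
  using assms(1)
proof (induction rule: wedge_span_induct)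
  case (gen I q \<phi>)
  then show ?case
    using wedge_span_gen[OF D.mult_comp[OF gen(1) assms(2)], of P' I] assms(3) by (simp add: mult.assoc demb_mult)
qed (auto simp: distrib_right intro: wedge_span_zero wedge_span_add)

lemma wedge_span_scale:
  assumes "z \<in> wedge_span P"
  shows "hsmult E c z \<in> wedge_span P"
  using wedge_span_mult_demb[OF assms D.comp_scale[OF D.one_comp], of P c] by (simp add: linearD[OF demb_linear] demb_one H_scale)

text \<open>Moving \<omega> past a degree zero element of the dual only pairs legs of the latter
  with r. Numbers rather than elements of \<A> appear, so the front factor stays a product of the
  \<omega>.\<close>

lemma wedge_span_mult_form:
  assumes "z \<in> wedge_span P" "\<And>p q. P p q \<Longrightarrow> q = 0 \<and> P' (Suc p) 0"
  shows "z * om k \<in> wedge_span P'"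
  using assms(1)
proof (induction rule: wedge_span_induct)
  case (gen I q \<phi>)
  then have \<phi>: "\<phi> \<in> component (dext E) 0" and P': "P' (length (I @ [j])) 0" for j using assms(2) by auto
  have "omw I * demb E \<phi> * om k = (\<Sum>(\<phi>1, \<phi>2)\<leftarrow>coprod (dext E) \<phi>. omw I * (emb E (lact E \<phi>1 (form E k)) * demb E \<phi>2))"
    by (simp add: mult.assoc cross_mult_degree0[OF \<phi> form_comp] split_def sum_list_const_mult)
  also have "\<dots> \<in> wedge_span P'"
  proof (rule wedge_span_sum_list, clarify)
    fix \<phi>1 \<phi>2 assume "(\<phi>1, \<phi>2) \<in> set (coprod (dext E) \<phi>)"
    then have "\<phi>1 \<in> component (dext E) 0" "\<phi>2 \<in> component (dext E) 0" using D.coprod_degree0[OF \<phi>] by blast+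
    then have "omw I * (emb E (lact E \<phi>1 (form E k)) * demb E \<phi>2)
        = (\<Sum>j\<in>UNIV. hsmult E (pair E \<phi>1 (rmat E k j)) (omw (I @ [j]) * demb E \<phi>2))"
      by (simp add: lact_form linear_sum[OF emb_linear] sum_distrib_left sum_distrib_right lin_simps emb_mult mult.assoc)
    also have "\<dots> \<in> wedge_span P'"
      by (intro wedge_span_sum wedge_span_scale wedge_span_gen[of \<phi>2 0]) (use P' \<open>\<phi>2 \<in> _\<close> in auto)
    finally show "omw I * (emb E (lact E \<phi>1 (form E k)) * demb E \<phi>2) \<in> wedge_span P'" .
  qed
  finally show ?case .
qed (auto simp: distrib_right intro: wedge_span_zero wedge_span_add)

lemma wedge_span_Omega: "wedge (Omega E) L \<in> wedge_span (\<lambda>p q. p = length L \<and> q = 0)"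
proof (induction L rule: rev_induct)
  case Nil
  then show ?case using wedge_span_gen[OF D.one_comp, of "\<lambda>p q. p = 0 \<and> q = 0" "[]"] by (simp add: emb_one demb_one)
next
  case (snoc i L)
  have "wedge (Omega E) L * (om j * demb E (inv (antipode (dext E)) (fmat E i j))) \<in> wedge_span (\<lambda>p q. p = length (L @ [i]) \<and> q = 0)" for j
    unfolding mult.assoc[symmetric]
    by (rule wedge_span_mult_demb[OF wedge_span_mult_form[OF snoc, of "\<lambda>p q. p = length (L @ [i]) \<and> q = 0"] fmat_inv_antipode_comp]) auto
  then show ?case unfolding Omega_def[of E i] wedge_simps sum_distrib_left mult_1_right by (rule wedge_span_sum)
qed

text \<open>The predicate records one more \<omega> than the degree of the dual factor, as r + 1
  factors \<Omega> stand before r factors \<gamma>; membership gives left invariance and degree 1 at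
  once.\<close>

lemma Qpart_wedge_span: "Qpart X R \<in> wedge_span (\<lambda>p q. p = Suc q)"
proof -
  have "Omr I * gaw J \<in> wedge_span (\<lambda>p q. p = Suc q)" if "length I = Suc (length J)" for I J
    by (rule wedge_span_mult_demb[OF wedge_span_Omega wedge_dform_comp]) (use that in auto)
  moreover have "Omega E i * vf i \<in> wedge_span (\<lambda>p q. p = Suc q)" for i
    using wedge_span_mult_demb[OF wedge_span_Omega[of "[i]"] vfield_comp, of "\<lambda>p q. p = Suc q" i] by simp
  ultimately show ?thesis
    unfolding Qpart_def BRST_term_def
    by (intro wedge_span_add wedge_span_sum wedge_span_scale) (auto simp: in_multi_iff)
qed

text \<open>\<open>left_invariant\<close> quantifies over all normally ordered representations; by
  \<open>heisenberg_well_defined\<close> it is enough to check one with products of the \<omega> in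
  front.\<close>

lemma wedge_span_left_invariant:
  assumes "z \<in> wedge_span P"
  shows "left_invariant E z"
  unfolding left_invariant_def
proof (intro allI impI ballI)
  fix t h assume t: "z = (\<Sum>(x, \<phi>)\<leftarrow>t. emb E x * demb E \<phi>)" and h: "h \<in> component (dext E) 0"
  obtain u where u: "z = (\<Sum>(x, \<phi>)\<leftarrow>u. emb E x * demb E \<phi>)"
    "\<forall>(x, \<phi>)\<in>set u. \<exists>I q. x = wedge (form E) I \<and> \<phi> \<in> component (dext E) q \<and> P (length I) q"
    using assms unfolding wedge_span_def by blast
  have "(\<Sum>(x, \<phi>)\<leftarrow>t. emb E (ract E x h) * demb E \<phi>) = (\<Sum>(x, \<phi>)\<leftarrow>u. emb E (ract E x h) * demb E \<phi>)"
    by (rule heisenberg_well_defined[OF _ hs])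
       (use t u(1) in \<open>auto intro!: linearI[OF G.vs hs] linearI[OF D.vs hs] simp: lin_simps linearD[OF ract_linear_left]\<close>)
  also have "\<dots> = (\<Sum>(x, \<phi>)\<leftarrow>u. hsmult E (pair E h 1) (emb E x * demb E \<phi>))"
    by (rule sum_list_cong_set) (use u(2) in \<open>fastforce simp: ract_wedge_form[OF h] linearD[OF emb_linear] H_scale\<close>)
  also have "\<dots> = hsmult E (pair E h 1) z"
    unfolding u(1) by (simp add: split_def linear_sum_list[OF HA.linear_scale_self])
  finally show "(\<Sum>(x, \<phi>)\<leftarrow>t. emb E (ract E x h) * demb E \<phi>) = hsmult E (pair E h 1) z" .
qed

lemma wedge_span_heisenberg_comp:
  assumes "z \<in> wedge_span (\<lambda>p q. p = Suc q)"
  shows "z \<in> heisenberg_comp E 1"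
proof -
  obtain u where u: "z = (\<Sum>(x, \<phi>)\<leftarrow>u. emb E x * demb E \<phi>)"
    "\<forall>(x, \<phi>)\<in>set u. \<exists>I q. x = wedge (form E) I \<and> \<phi> \<in> component (dext E) q \<and> length I = Suc q"
    using assms unfolding wedge_span_def by blast
  have "\<forall>(x, \<phi>)\<in>set u. \<exists>m n. x \<in> component (ext E) m \<and> \<phi> \<in> component (dext E) n \<and> int m - int n = 1"
  proof clarify
    fix x \<phi> assume "(x, \<phi>) \<in> set u"
    then obtain I q where "x = wedge (form E) I" "\<phi> \<in> component (dext E) q" "length I = Suc q" using u(2) by blast
    then show "\<exists>m n. x \<in> component (ext E) m \<and> \<phi> \<in> component (dext E) n \<and> int m - int n = 1"
      using wedge_form_comp[of I] by (intro exI[of _ "Suc q"] exI[of _ q]) auto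
  qed
  then show ?thesis unfolding heisenberg_comp_def using u(1) by blast
qed

section \<open>Truncation at the height\<close>

lemma Omr_zero:
  assumes h: "is_height \<sigma> h" and I: "length I > h"
  shows "Omr I = 0"
proof -
  have "(\<Sum>J\<in>multi (length I). hsmult E (of_bool (I = J)) (Omr J)) = 0"
    by (subst Omega_wedge) (use h I in \<open>auto simp: is_height_def in_multi_iff intro!: sum.neutral\<close>)
  then show ?thesis by (simp add: sum_of_bool_multi[OF hs refl])
qed

lemma height_pos:
  assumes "is_height \<sigma> h"
  shows "h \<ge> 1"
proof (rule ccontr)
  assume "\<not> h \<ge> 1"
  then have "antisym \<sigma> 1 1 1 [i] [i] = 0" for i using assms by (auto simp: is_height_def in_multi_iff)
  then show False by (simp add: tid_def antisym.simps(2))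
qed

theorem BRST_charge_is_BRST_operator:
  assumes h: "is_height \<sigma> h" and X: "BRST_initial E X" "\<forall>r\<in>{2..h - 1}. BRST_recurrence E X r"
  shows "is_BRST_operator E (BRST_charge E h X)"
proof -
  have h1: "h \<ge> 1" by (rule height_pos[OF h])
  \<comment> \<open>Adding the term r = h changes nothing, since its block of h + 1 factors \<Omega>
    is zero. It secures the condition R \<ge> 1 of \<open>Qpart_form\<close> also for h = 1.\<close>
  have charge: "BRST_charge E h X = Qpart X h"
  proof -
    have "BRST_term E X h = 0"
      unfolding BRST_term_def
      by (intro sum.neutral ballI) (use Omr_zero[OF h] in \<open>auto simp: in_multi_iff\<close>)
    then show ?thesis using h1 by (cases h) (auto simp: BRST_charge_def Qpart_def)
  qed
  \<comment> \<open>The added recurrence for r = h reads 0 = 0: both sides begin with A with index 1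
    -> h+1.\<close>
  have rec: "\<forall>r\<in>{2..h}. BRST_recurrence E X r"
  proof
    fix r assume r: "r \<in> {2..h}"
    show "BRST_recurrence E X r"
    proof (cases "r = h")
      case True
      have "antisym \<sigma> (h + 1) 1 (h + 1) I J = 0" if "I \<in> multi (h + 1)" "J \<in> multi (h + 1)" for I J
        using h that unfolding is_height_def by auto
      then show ?thesis unfolding BRST_recurrence_def Let_def True tmul_def[of "h + 1"] by simp
    next
      case False
      then show ?thesis using X(2) r by auto
    qed
  qed
  have "raise_sum X k h = 0" for k
    unfolding raise_sum_def by (intro sum.neutral ballI) (use Omr_zero[OF h] in \<open>auto simp: in_multi_iff\<close>)
  then have form: "Qpart X h * om k = emb E (diff E (form E k)) - om k * Qpart X h" for k
    using Qpart_form[OF X(1) h1 rec, of k] by simp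
  have comm: "Qpart X h * emb E x = emb E (diff E x) + hsmult E ((-1) ^ n) (emb E x * Qpart X h)"
    if "x \<in> component (ext E) n" for x n
    by (rule commutator_from_generators[OF _ form that]) (rule Qpart_degree0)
  have "Qpart X h * Qpart X h = 0" by (rule charge_square[OF _ vac_Qpart]) (rule comm)
  moreover have "right_invariant E (Qpart X h)" by (rule charge_right_invariant[OF _ vac_Qpart]) (rule comm)
  ultimately show ?thesis
    unfolding is_BRST_operator_def bi_invariant_def charge
    using wedge_span_left_invariant[OF Qpart_wedge_span] wedge_span_heisenberg_comp[OF Qpart_wedge_span] comm
    by simp
qed

end

theorem mainTheorem1:
  fixes E :: "('k::field, 'n::finite, 'g::ring_1, 'd::ring_1, 'h::ring_1) heisenberg_data"
    and h :: nat
  assumes "exterior_heisenberg_double E"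
    and "is_height (braid E) h"
  shows "(\<exists>X. BRST_initial E X \<and> (\<forall>r\<in>{2..h - 1}. BRST_recurrence E X r)) \<and>
         (\<forall>X. BRST_initial E X \<and> (\<forall>r\<in>{2..h - 1}. BRST_recurrence E X r) \<longrightarrow>
              is_BRST_operator E (BRST_charge E h X))"
proof -
  interpret exterior_heisenberg_double E by fact
  show ?thesis using recurrence_solvable BRST_charge_is_BRST_operator[OF assms(2)] by blast
qed

end
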